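(* Let $b:[0,\infty)\times\mathbb{R}^d\to\mathbb{R}^d$ be measurable with $b(t,\cdot)\in\mathcal{C}_b^1(\mathbb{R}^d)$ for each $t>0$ and $t\mapsto\|b(t,\cdot)\|_{\mathcal{C}_b^1}\in L^\infty([0,\infty))$. Let $\mu_0\in\mathcal{P}(\mathbb{R}^d)$, let $W$ be a $d$-dimensional Brownian motion and let $X$ be the solution of the McKean-Vlasov SDE $$dX_t=\langle b(t,X_t-\cdot),\mu_t\rangle\,dt+dW_t,\qquad \mu_t=\operatorname{Law}(X_t),$$ with initial law $\mu_0$. Then for each $t>0$, $X_t$ has a density $p_t$ with respect to the Lebesgue measure which is smooth, i.e. $p_t\in C^\infty(\mathbb{R}^d)$.
   Context: $\mathcal{P}(\mathbb{R}^d)$ is the set of Borel probability measures on $\mathbb{R}^d$, and $\langle b(t,x-\cdot),\mu\rangle:=\int_{\mathbb{R}^d}b(t,x-y)\,\mu(dy)$. $W$ is independent of $X_0$. $\mathcal{C}_b^1(\mathbb{R}^d)$ is the space of (continuously) differentiable bounded functions with bounded derivative, with norm $\|f\|_{\mathcal{C}_b^1}:=\|f\|_{L^\infty}+\|\nabla f\|_{L^\infty}$. The equation is known to be well-posed. *)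

theory Defs
  imports "HOL-Probability.Probability"
begin

fun Ck :: "nat \<Rightarrow> ('a::real_normed_vector \<Rightarrow> 'b::real_normed_vector) \<Rightarrow> bool" where
  "Ck 0 f \<longleftrightarrow> continuous_on UNIV f"
| "Ck (Suc k) f \<longleftrightarrow>
     (\<forall>x. f differentiable (at x)) \<and> (\<forall>v. Ck k (\<lambda>x. frechet_derivative f (at x) v))"

definition smooth :: "('a::real_normed_vector \<Rightarrow> 'b::real_normed_vector) \<Rightarrow> bool" where
  "smooth f \<longleftrightarrow> (\<forall>k. Ck k f)"

definition Cb1 :: "('a::euclidean_space \<Rightarrow> 'b::euclidean_space) set" where
  "Cb1 = {f. Ck 1 f \<and> bounded (range f)
             \<and> bounded (range (\<lambda>x. onorm (frechet_derivative f (at x))))}"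

text \<open>For \<open>f \<in> Cb1\<close> the functions under the suprema are bounded and continuous, so that these
  suprema are the essential suprema. The value at other \<open>f\<close> has no meaning.\<close>

definition Cb1_norm :: "('a::euclidean_space \<Rightarrow> 'b::euclidean_space) \<Rightarrow> real" where
  "Cb1_norm f = (SUP x. norm (f x)) + (SUP x. onorm (frechet_derivative f (at x)))"

definition Linfty_on :: "real set \<Rightarrow> (real \<Rightarrow> real) set" where
  "Linfty_on S = {f \<in> borel_measurable (lebesgue_on S). \<exists>C. AE t in lebesgue_on S. \<bar>f t\<bar> \<le> C}"

text \<open>Processes are indexed by real times; only the times \<open>t \<ge> 0\<close> matter.\<close>

definition adapted_to :: "(real \<Rightarrow> 'w measure) \<Rightarrow> (real \<Rightarrow> 'w \<Rightarrow> 'b::topological_space) \<Rightarrow> bool" where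
  "adapted_to F X \<longleftrightarrow> (\<forall>t\<ge>0. X t \<in> borel_measurable (F t))"

definition continuous_paths :: "'w measure \<Rightarrow> (real \<Rightarrow> 'w \<Rightarrow> 'b::topological_space) \<Rightarrow> bool" where
  "continuous_paths M X \<longleftrightarrow> (AE \<omega> in M. continuous_on {0..} (\<lambda>t. X t \<omega>))"

definition filtered_prob_space :: "'w measure \<Rightarrow> (real \<Rightarrow> 'w measure) \<Rightarrow> bool" where
  "filtered_prob_space M F \<longleftrightarrow>
     prob_space M \<and> filtration (space M) F \<and> (\<forall>t. sets (F t) \<subseteq> sets M)"

definition brownian_motion ::
    "'w measure \<Rightarrow> (real \<Rightarrow> 'w measure) \<Rightarrow> (real \<Rightarrow> 'w \<Rightarrow> real ^ 'd) \<Rightarrow> bool" where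
  "brownian_motion M F W \<longleftrightarrow>
     adapted_to F W \<and> continuous_paths M W \<and> (AE \<omega> in M. W 0 \<omega> = 0) \<and>
     (\<forall>s t. 0 \<le> s \<and> s < t \<longrightarrow>
        distributed M lborel (\<lambda>\<omega>. W t \<omega> - W s \<omega>)
          (\<lambda>x. ennreal (\<Prod>i\<in>UNIV. normal_density 0 (sqrt (t - s)) (x $ i))) \<and>
        prob_space.indep_set M (sets (F s))
          (sets (vimage_algebra (space M) (\<lambda>\<omega>. W t \<omega> - W s \<omega>) borel)))"

definition indep_of_process ::
    "'w measure \<Rightarrow> ('w \<Rightarrow> 'b::topological_space) \<Rightarrow> (real \<Rightarrow> 'w \<Rightarrow> 'c::topological_space) \<Rightarrow> bool" where
  "indep_of_process M Y W \<longleftrightarrow>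
     prob_space.indep_set M
       (sets (vimage_algebra (space M) Y borel))
       (sets (vimage_algebra (space M) (\<lambda>\<omega>. \<lambda>t\<in>{0..}. W t \<omega>) (\<Pi>\<^sub>M t\<in>{0..}. borel)))"

definition mean_field_drift ::
    "(real \<Rightarrow> real ^ 'd \<Rightarrow> real ^ 'd) \<Rightarrow> real \<Rightarrow> real ^ 'd \<Rightarrow> (real ^ 'd) measure \<Rightarrow> real ^ 'd" where
  "mean_field_drift b t x \<mu> = (\<integral>y. b t (x - y) \<partial>\<mu>)"

definition McKean_Vlasov_solution ::
    "'w measure \<Rightarrow> (real \<Rightarrow> 'w measure) \<Rightarrow> (real \<Rightarrow> real ^ 'd \<Rightarrow> real ^ 'd) \<Rightarrow> (real ^ 'd) measure \<Rightarrow>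
     (real \<Rightarrow> 'w \<Rightarrow> real ^ 'd) \<Rightarrow> (real \<Rightarrow> 'w \<Rightarrow> real ^ 'd) \<Rightarrow> bool" where
  "McKean_Vlasov_solution M F b \<mu>0 W X \<longleftrightarrow>
     adapted_to F X \<and> continuous_paths M X \<and> distr M borel (X 0) = \<mu>0 \<and>
     (AE \<omega> in M. \<forall>t\<ge>0.
        set_integrable lborel {0..t} (\<lambda>s. mean_field_drift b s (X s \<omega>) (distr M borel (X s))) \<and>
        X t \<omega> = X 0 \<omega>
          + (LINT s:{0..t}|lborel. mean_field_drift b s (X s \<omega>) (distr M borel (X s))) + W t \<omega>)"

end

theory Submission
  imports Defs
begin

text \<open>
  Let \<open>D\<close> be the difference operator with step \<open>h\<close>. For every \<open>m\<close> and every bounded continuous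
  \<open>f\<close>, the expectation of \<open>(D ^ m) f (X t)\<close> is bounded by a constant times \<open>sup \<bar>f\<bar> * \<bar>h\<bar> powr (m / 2)\<close>,
  locally uniformly in \<open>t > 0\<close>. This is proved by induction on \<open>m\<close> from Duhamel's formula: of the
  \<open>m + 1\<close> differences in front of \<open>\<nabla> heat (t - q) f\<close>, one is spent on the heat kernel, where it
  gains \<open>\<bar>h\<bar> powr (1 / 2)\<close> at the price of the integrable singularity \<open>(t - q) powr (- 3 / 4)\<close>. The
  others are moved by discrete integration by parts onto the law \<open>\<mu>\<close> of \<open>X q\<close> and onto the drift,
  and since the drift is the convolution of \<open>b\<close> and \<open>\<mu>\<close>, its differences are again controlled by
  differences of \<open>\<mu>\<close> tested against the bounded function \<open>b\<close>. Testing with trigonometric functions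
  and \<open>h = \<pi> \<xi> / \<bar>\<xi>\<bar>\<^sup>2\<close> shows that the characteristic function decays faster than any power, and
  Fourier inversion gives the smooth density.

  In Duhamel's formula the Ito calculus is replaced by a bound of order \<open>(r' - r) powr (3 / 2)\<close>
  on the increments of the difference of the two sides.
\<close>

section \<open>The Gaussian measure\<close>

text \<open>Differences replace derivatives because the law is not known to have a density
  beforehand, whereas an iterated difference tested against a bounded function is always a finite
  number. Half a power of \<open>h\<close> per step is a compromise: the Lipschitz bound for the
  gradient gains a full \<open>\<bar>h\<bar>\<close> but costs \<open>(t - q) powr - 1\<close>,
  which is not integrable at \<open>q = t\<close>; its geometric mean with the plain bound of order
  \<open>(t - q) powr (- 1 / 2)\<close> has the integrable exponent - 3 / 4. The initial law may be
  a point mass, so no bound can be uniform down to time 0: each induction step starts Duhamel's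
  formula at half the earliest time, and the heat semigroup over the elapsed time gains the factor
  required of the initial term. In a time step \<delta>, the Brownian part is treated exactly by the
  semigroup property and only the drift is expanded; freezing it costs \<delta> times a Brownian
  displacement of order \<open>sqrt \<delta>\<close>, and an exponent 3 / 2 > 1 forces a vanishing
  derivative. The final choice of \<open>h\<close> makes a shift by \<open>h\<close> reverse the
  sign of the trigonometric functions, so that each difference multiplies them by - 2.\<close>

definition axis_index :: "real ^ 'd \<Rightarrow> 'd" where
  "axis_index v = (SOME i. v = axis i 1)"

lemma axis_index_axis [simp]: "axis_index (axis i 1) = i"
  unfolding axis_index_def by (rule some_equality) (auto simp: axis_eq_axis)

text \<open>Links products over \<open>Basis\<close>, by which the product formulas for
  \<open>lborel\<close> are indexed, with products over coordinates. \<open>g\<close> takes both the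
  index and the basis vector so that factors such as \<open>f i (x \<bullet> v)\<close> fit.\<close>

lemma prod_Basis_vec: "(\<Prod>v\<in>Basis. g (axis_index v) v) = (\<Prod>i\<in>UNIV. g i (axis i 1 :: real ^ 'd))"
proof -
  have B: "(Basis :: (real ^ 'd) set) = range (\<lambda>i. axis i 1)"
    by (auto simp: Basis_vec_def)
  have inj: "inj (\<lambda>i::'d. axis i (1::real))"
    by (auto simp: inj_on_def axis_eq_axis)
  show ?thesis
    by (simp add: B prod.reindex[OF inj])
qed

lemma nn_integral_lborel_vec_prod:
  fixes f :: "'d::finite \<Rightarrow> real \<Rightarrow> ennreal"
  assumes [measurable]: "\<And>i. f i \<in> borel_measurable borel"
  shows "(\<integral>\<^sup>+x. (\<Prod>i\<in>UNIV. f i ((x::real ^ 'd) $ i)) \<partial>lborel) = (\<Prod>i\<in>UNIV. (\<integral>\<^sup>+x. f i x \<partial>lborel))"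
proof -
  have "(\<integral>\<^sup>+x. (\<Prod>v\<in>Basis. f (axis_index v) ((x::real ^ 'd) \<bullet> v)) \<partial>lborel)
      = (\<Prod>v\<in>Basis. (\<integral>\<^sup>+x. f (axis_index (v::real ^ 'd)) x \<partial>lborel))"
    by (rule nn_integral_lborel_prod) auto
  then show ?thesis
    by (simp add: prod_Basis_vec[where g="\<lambda>i v. f i (_ \<bullet> v)"]
        prod_Basis_vec[where g="\<lambda>i v. \<integral>\<^sup>+x. f i x \<partial>lborel"] inner_axis)
qed

definition gauss_density :: "real \<Rightarrow> real ^ 'd \<Rightarrow> real" where
  "gauss_density \<tau> y = (\<Prod>i\<in>UNIV. normal_density 0 (sqrt \<tau>) (y $ i))"

definition gauss :: "real \<Rightarrow> (real ^ 'd) measure" where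
  "gauss \<tau> = density lborel (\<lambda>y. ennreal (gauss_density \<tau> y))"

lemma gauss_density_nonneg [simp]: "0 \<le> gauss_density \<tau> y"
  by (simp add: gauss_density_def prod_nonneg)

lemma gauss_density_eq:
  assumes "0 < \<tau>"
  shows "gauss_density \<tau> (y::real ^ 'd) = (1 / sqrt (2 * pi * \<tau>)) ^ CARD('d) * exp (- (norm y)\<^sup>2 / (2 * \<tau>))"
proof -
  have "gauss_density \<tau> y = (\<Prod>i\<in>UNIV. (1 / sqrt (2 * pi * \<tau>)) * exp (- (y $ i)\<^sup>2 / (2 * \<tau>)))"
    using assms by (simp add: gauss_density_def normal_density_def)
  also have "\<dots> = (1 / sqrt (2 * pi * \<tau>)) ^ CARD('d) * exp (\<Sum>i\<in>UNIV. - (y $ i)\<^sup>2 / (2 * \<tau>))"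
    by (simp only: prod.distrib prod_constant exp_sum[OF finite])
  also have "(\<Sum>i\<in>UNIV. - (y $ i)\<^sup>2 / (2 * \<tau>)) = - (norm y)\<^sup>2 / (2 * \<tau>)"
    by (simp add: norm_vec_def L2_set_def sum_nonneg sum_divide_distrib sum_negf)
  finally show ?thesis .
qed

lemma measurable_vec_nth [measurable (raw)]:
  fixes f :: "'a \<Rightarrow> real ^ 'd"
  assumes [measurable]: "f \<in> borel_measurable M"
  shows "(\<lambda>x. f x $ i) \<in> borel_measurable M"
  by (rule measurable_compose[OF assms]) (intro borel_measurable_continuous_onI continuous_intros)

lemma gauss_density_measurable2 [measurable]:
  "(\<lambda>(\<tau>, y). gauss_density \<tau> y) \<in> borel_measurable (borel \<Otimes>\<^sub>M (borel :: (real ^ 'd) measure))"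
  unfolding gauss_density_def normal_density_def by measurable

lemma gauss_density_measurable [measurable]: "gauss_density \<tau> \<in> borel_measurable borel"
  unfolding gauss_density_def[abs_def] by measurable

lemma sets_gauss [simp, measurable_cong]: "sets (gauss \<tau>) = sets borel"
  by (simp add: gauss_def)

lemma space_gauss [simp]: "space (gauss \<tau>) = UNIV"
  by (simp add: gauss_def)

lemma nn_integral_gauss:
  assumes [measurable]: "f \<in> borel_measurable borel"
  shows "(\<integral>\<^sup>+y. f y \<partial>gauss \<tau>) = (\<integral>\<^sup>+y. ennreal (gauss_density \<tau> y) * f y \<partial>lborel)"
  unfolding gauss_def by (rule nn_integral_density) auto

lemma integral_gauss:
  fixes f :: "real ^ 'd \<Rightarrow> 'b::{banach, second_countable_topology}"
  assumes [measurable]: "f \<in> borel_measurable borel"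
  shows "(\<integral>y. f y \<partial>gauss \<tau>) = (\<integral>y. gauss_density \<tau> y *\<^sub>R f y \<partial>lborel)"
  unfolding gauss_def by (rule integral_density) auto

lemma prob_space_gauss:
  assumes "0 < \<tau>"
  shows "prob_space (gauss \<tau> :: (real ^ 'd) measure)"
proof
  have 1: "(\<integral>\<^sup>+x. ennreal (normal_density 0 (sqrt \<tau>) x) \<partial>lborel) = 1"
    using assms by (subst nn_integral_eq_integral) auto
  have "emeasure (gauss \<tau> :: (real ^ 'd) measure) UNIV
      = (\<integral>\<^sup>+y. (\<Prod>i\<in>UNIV. ennreal (normal_density 0 (sqrt \<tau>) ((y::real ^ 'd) $ i))) \<partial>lborel)"
    unfolding gauss_def by (subst emeasure_density) (auto simp: gauss_density_def prod_ennreal)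
  also have "\<dots> = 1"
    by (subst nn_integral_lborel_vec_prod) (auto simp: 1)
  finally show "emeasure (gauss \<tau> :: (real ^ 'd) measure) (space (gauss \<tau>)) = 1"
    by simp
qed

text \<open>The integrand factorises over the coordinates, which leaves the convolution of two
  normal densities on the line.\<close>

lemma gauss_density_conv:
  assumes "0 < \<sigma>" "0 < \<tau>"
  shows "(\<integral>\<^sup>+y. ennreal (gauss_density \<tau> (x - y) * gauss_density \<sigma> y) \<partial>lborel)
    = ennreal (gauss_density (\<sigma> + \<tau>) (x::real ^ 'd))"
proof -
  have "(\<integral>\<^sup>+y. ennreal (gauss_density \<tau> (x - y) * gauss_density \<sigma> y) \<partial>lborel)
     = (\<integral>\<^sup>+y. (\<Prod>i\<in>UNIV. ennreal (normal_density 0 (sqrt \<tau>) (x $ i - y $ i) * normal_density 0 (sqrt \<sigma>) (y $ i))) \<partial>lborel)"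
    by (simp add: gauss_density_def prod_ennreal prod.distrib)
  also have "\<dots> = (\<Prod>i\<in>UNIV. \<integral>\<^sup>+y. ennreal (normal_density 0 (sqrt \<tau>) (x $ i - y) * normal_density 0 (sqrt \<sigma>) y) \<partial>lborel)"
    by (rule nn_integral_lborel_vec_prod) measurable
  also have "\<dots> = (\<Prod>i\<in>UNIV. ennreal (normal_density 0 (sqrt (\<sigma> + \<tau>)) (x $ i)))"
    using assms fun_cong[OF conv_normal_density_zero_mean[of "sqrt \<tau>" "sqrt \<sigma>"]] by (simp add: add.commute)
  finally show ?thesis
    by (simp add: gauss_density_def prod_ennreal)
qed

lemma nn_integral_lborel_shift:
  fixes c :: "'a::euclidean_space"
  assumes [measurable]: "f \<in> borel_measurable borel"
  shows "(\<integral>\<^sup>+y. f (c + y) \<partial>lborel) = (\<integral>\<^sup>+y. f y \<partial>lborel)"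
  by (subst (2) lborel_distr_plus[of c, symmetric], subst nn_integral_distr) auto

lemma integral_lborel_shift:
  fixes c :: "'a::euclidean_space" and f :: "'a \<Rightarrow> 'b::{banach, second_countable_topology}"
  assumes [measurable]: "f \<in> borel_measurable borel"
  shows "(\<integral>y. f (c + y) \<partial>lborel) = (\<integral>y. f y \<partial>lborel)"
  by (subst (2) lborel_distr_plus[of c, symmetric], subst integral_distr) auto

lemma gauss_convolution:
  assumes "0 < \<sigma>" "0 < \<tau>"
  shows "distr (gauss \<sigma> \<Otimes>\<^sub>M gauss \<tau>) borel (\<lambda>(y, z). y + z) = (gauss (\<sigma> + \<tau>) :: (real ^ 'd) measure)"
proof (rule measure_eqI)
  fix A :: "(real ^ 'd) set" assume "A \<in> sets (distr (gauss \<sigma> \<Otimes>\<^sub>M gauss \<tau>) borel (\<lambda>(y, z). y + z))"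
  then have [measurable]: "A \<in> sets borel" by simp
  interpret \<sigma>: prob_space "gauss \<sigma> :: (real ^ 'd) measure" by (rule prob_space_gauss) fact
  interpret \<tau>: prob_space "gauss \<tau> :: (real ^ 'd) measure" by (rule prob_space_gauss) fact
  let ?g = gauss_density
  have "emeasure (distr (gauss \<sigma> \<Otimes>\<^sub>M gauss \<tau>) borel (\<lambda>(y, z). y + z)) A
      = (\<integral>\<^sup>+p. indicator A (fst p + snd p) \<partial>(gauss \<sigma> \<Otimes>\<^sub>M gauss \<tau>))"
    by (subst nn_integral_indicator[symmetric]) (simp, subst nn_integral_distr, auto simp: split_beta)
  also have "\<dots> = (\<integral>\<^sup>+y. \<integral>\<^sup>+z. indicator A (y + z) \<partial>gauss \<tau> \<partial>gauss \<sigma>)"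
    by (subst \<tau>.nn_integral_fst[symmetric]) auto
  also have "\<dots> = (\<integral>\<^sup>+y. ennreal (?g \<sigma> y) * (\<integral>\<^sup>+z. ennreal (?g \<tau> z) * indicator A (y + z) \<partial>lborel) \<partial>lborel)"
    by (subst nn_integral_gauss) (auto simp: nn_integral_gauss)
  also have "\<dots> = (\<integral>\<^sup>+y. ennreal (?g \<sigma> y) * (\<integral>\<^sup>+w. ennreal (?g \<tau> (w - y)) * indicator A w \<partial>lborel) \<partial>lborel)"
  proof (rule nn_integral_cong, rule arg_cong2[where f="(*)"], rule refl)
    fix y :: "real ^ 'd"
    show "(\<integral>\<^sup>+z. ennreal (?g \<tau> z) * indicator A (y + z) \<partial>lborel) = (\<integral>\<^sup>+w. ennreal (?g \<tau> (w - y)) * indicator A w \<partial>lborel)"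
      by (subst nn_integral_lborel_shift[of "\<lambda>w. ennreal (?g \<tau> (w - y)) * indicator A w" y, symmetric]) auto
  qed
  also have "\<dots> = (\<integral>\<^sup>+y. \<integral>\<^sup>+w. ennreal (?g \<tau> (w - y) * ?g \<sigma> y) * indicator A w \<partial>lborel \<partial>lborel)"
    by (subst nn_integral_cmult[symmetric]) (auto intro!: nn_integral_cong simp: ennreal_mult ac_simps)
  also have "\<dots> = (\<integral>\<^sup>+w. \<integral>\<^sup>+y. ennreal (?g \<tau> (w - y) * ?g \<sigma> y) * indicator A w \<partial>lborel \<partial>lborel)"
    by (subst lborel_pair.Fubini') auto
  also have "\<dots> = (\<integral>\<^sup>+w. ennreal (?g (\<sigma> + \<tau>) w) * indicator A w \<partial>lborel)"
    by (subst nn_integral_multc) (auto simp: gauss_density_conv[OF assms])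
  also have "\<dots> = emeasure (gauss (\<sigma> + \<tau>)) A"
    unfolding gauss_def by (subst emeasure_density) auto
  finally show "emeasure (distr (gauss \<sigma> \<Otimes>\<^sub>M gauss \<tau>) borel (\<lambda>(y, z). y + z)) A = emeasure (gauss (\<sigma> + \<tau>)) A" .
qed simp

text \<open>Cameron--Martin. All smoothing estimates for the heat semigroup come from this shift formula, so
  that no kernel is ever differentiated.\<close>

lemma gauss_density_shift:
  assumes "0 < \<tau>"
  shows "gauss_density \<tau> (y - d) = gauss_density \<tau> y * exp ((y \<bullet> d) / \<tau> - (norm d)\<^sup>2 / (2 * \<tau>))"
proof -
  have "(norm (y - d))\<^sup>2 = (norm y)\<^sup>2 - 2 * (y \<bullet> d) + (norm d)\<^sup>2"
    by (simp add: power2_norm_eq_inner inner_diff_left inner_diff_right inner_commute)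
  then have "- (norm (y - d))\<^sup>2 / (2 * \<tau>) = - (norm y)\<^sup>2 / (2 * \<tau>) + ((y \<bullet> d) / \<tau> - (norm d)\<^sup>2 / (2 * \<tau>))"
    using assms by (simp only:) (simp add: field_simps)
  then show ?thesis
    by (simp only: gauss_density_eq[OF assms] exp_add mult.assoc)
qed

lemma integral_gauss_shift:
  fixes f :: "real ^ 'd \<Rightarrow> 'b::{banach, second_countable_topology}"
  assumes "0 < \<tau>" and [measurable]: "f \<in> borel_measurable borel"
  shows "(\<integral>y. f (d + y) \<partial>gauss \<tau>) = (\<integral>y. exp ((y \<bullet> d) / \<tau> - (norm d)\<^sup>2 / (2 * \<tau>)) *\<^sub>R f y \<partial>gauss \<tau>)"
proof -
  have "(\<integral>y. f (d + y) \<partial>gauss \<tau>) = (\<integral>y. gauss_density \<tau> (d + y - d) *\<^sub>R f (d + y) \<partial>lborel)"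
    by (simp add: integral_gauss)
  also have "\<dots> = (\<integral>y. gauss_density \<tau> (y - d) *\<^sub>R f y \<partial>lborel)"
    by (rule integral_lborel_shift) measurable
  also have "\<dots> = (\<integral>y. gauss_density \<tau> y *\<^sub>R (exp ((y \<bullet> d) / \<tau> - (norm d)\<^sup>2 / (2 * \<tau>)) *\<^sub>R f y) \<partial>lborel)"
    by (simp add: gauss_density_shift[OF assms(1)])
  finally show ?thesis
    by (simp add: integral_gauss)
qed

text \<open>Completing the square: by the shift formula, the exponentially weighted density is a
  constant multiple of a translate, which again has mass 1.\<close>

lemma
  assumes "0 < \<tau>"
  shows gauss_exp_integrable: "integrable (gauss \<tau>) (\<lambda>y::real ^ 'd. exp ((y \<bullet> d) / \<tau>))"
    and gauss_exp_integral: "(\<integral>y. exp ((y \<bullet> d) / \<tau>) \<partial>gauss \<tau>) = exp ((norm d)\<^sup>2 / (2 * \<tau>))"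
proof -
  interpret prob_space "gauss \<tau> :: (real ^ 'd) measure" by (rule prob_space_gauss) fact
  have *: "gauss_density \<tau> y * exp ((y \<bullet> d) / \<tau>) = exp ((norm d)\<^sup>2 / (2 * \<tau>)) * gauss_density \<tau> (- d + y)" for y
    using gauss_density_shift[OF assms, of y d] by (simp add: exp_diff field_simps)
  have "(\<integral>\<^sup>+y. ennreal (exp ((y \<bullet> d) / \<tau>)) \<partial>gauss \<tau>)
      = (\<integral>\<^sup>+y. ennreal (exp ((norm d)\<^sup>2 / (2 * \<tau>))) * ennreal (gauss_density \<tau> (- d + y)) \<partial>lborel)"
    by (subst nn_integral_gauss) (auto simp: ennreal_mult[symmetric] *)
  also have "\<dots> = ennreal (exp ((norm d)\<^sup>2 / (2 * \<tau>))) * (\<integral>\<^sup>+y. ennreal (gauss_density \<tau> (- d + y)) \<partial>lborel)"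
    by (rule nn_integral_cmult) measurable
  also have "(\<integral>\<^sup>+y. ennreal (gauss_density \<tau> (- d + y)) \<partial>lborel) = (\<integral>\<^sup>+y. ennreal (gauss_density \<tau> (y::real ^ 'd)) \<partial>lborel)"
    by (rule nn_integral_lborel_shift[of "\<lambda>y. ennreal (gauss_density \<tau> y)" "- d"]) measurable
  also have "\<dots> = 1"
    using emeasure_space_1 by (simp add: gauss_def emeasure_density)
  finally have "has_bochner_integral (gauss \<tau>) (\<lambda>y. exp ((y \<bullet> d) / \<tau>)) (exp ((norm d)\<^sup>2 / (2 * \<tau>)))"
    by (intro has_bochner_integral_nn_integral) auto
  then show "integrable (gauss \<tau>) (\<lambda>y::real ^ 'd. exp ((y \<bullet> d) / \<tau>))"
    and "(\<integral>y. exp ((y \<bullet> d) / \<tau>) \<partial>gauss \<tau>) = exp ((norm d)\<^sup>2 / (2 * \<tau>))"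
    by (auto simp: has_bochner_integral_iff)
qed

section \<open>\<open>L\<^sup>1\<close> estimates for the Cameron-Martin weight\<close>

lemma exp_taylor2: "\<bar>exp z - 1 - z\<bar> \<le> z\<^sup>2 * exp \<bar>z\<bar>" for z :: real
proof -
  obtain t where t: "\<bar>t\<bar> \<le> \<bar>z\<bar>" "exp z = (\<Sum>m<2. z ^ m / fact m) + exp t / fact 2 * z ^ 2"
    using Maclaurin_exp_le by blast
  then have "exp z - 1 - z = exp t / 2 * z\<^sup>2"
    by (simp add: numeral_2_eq_2)
  then have "\<bar>exp z - 1 - z\<bar> = exp t / 2 * z\<^sup>2"
    by (simp only: abs_mult abs_divide) simp
  also have "\<dots> \<le> exp \<bar>z\<bar> * z\<^sup>2"
  proof (rule mult_right_mono)
    have "exp t \<le> exp \<bar>z\<bar>" using t by simp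
    then show "exp t / 2 \<le> exp \<bar>z\<bar>" using exp_gt_zero[of t] by linarith
  qed simp
  finally show ?thesis by (simp add: mult.commute)
qed

lemma square_le_exp: "n\<^sup>2 \<le> 2 * exp \<bar>n\<bar>" for n :: real
  using exp_lower_Taylor_quadratic[of "\<bar>n\<bar>"] by simp

lemma exp_abs_le: "exp \<bar>a\<bar> \<le> exp a + exp (- a)" for a :: real
  by (cases "a \<ge> 0") auto

text \<open>Here \<open>n\<close> stands for a standard normal variable and \<open>k\<close> for the
  length of a normalised shift. What matters is that the majorant of the remainder is a factor
  \<open>k\<^sup>2\<close> times a function of \<open>n\<close> alone, integrable under the
  Gaussian.\<close>

lemma exp_tilt_bound:
  fixes n k :: real
  assumes "0 \<le> k" "k \<le> 1"
  shows "\<bar>exp (k * n - k\<^sup>2 / 2) - 1 - k * n\<bar> \<le> 3 * k\<^sup>2 * (exp (2 * n) + exp (- 2 * n))"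
proof -
  have kn: "\<bar>k * n\<bar> \<le> \<bar>n\<bar>"
    using assms by (simp add: abs_mult mult_left_le_one_le)
  \<comment> \<open>The error is split into the Taylor remainder of \<open>exp (k * n)\<close> and
    the effect of the normalising factor \<open>exp (- k\<^sup>2 / 2)\<close>; they contribute 2 and
    1 to the constant 3.\<close>
  have "\<bar>exp (k * n) - 1 - k * n\<bar> \<le> (k * n)\<^sup>2 * exp \<bar>k * n\<bar>"
    by (rule exp_taylor2)
  also have "\<dots> \<le> k\<^sup>2 * (2 * exp \<bar>n\<bar>) * exp \<bar>n\<bar>"
    using kn square_le_exp[of n] by (intro mult_mono) (auto simp: power_mult_distrib mult_left_mono)
  finally have 1: "\<bar>exp (k * n) - 1 - k * n\<bar> \<le> 2 * k\<^sup>2 * exp (2 * \<bar>n\<bar>)"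
    unfolding mult_2 exp_add by (simp add: power2_eq_square mult_ac)
  have "\<bar>exp (k * n - k\<^sup>2 / 2) - exp (k * n)\<bar> = exp (k * n) * (1 - exp (- (k\<^sup>2 / 2)))"
  proof -
    have "exp (k * n - k\<^sup>2 / 2) = exp (k * n) * exp (- (k\<^sup>2 / 2))"
      by (simp add: mult_exp_exp)
    moreover have "exp (k * n) * exp (- (k\<^sup>2 / 2)) \<le> exp (k * n) * 1"
      by (intro mult_left_mono) auto
    ultimately show ?thesis by (simp add: algebra_simps)
  qed
  also have "\<dots> \<le> exp (2 * \<bar>n\<bar>) * (k\<^sup>2)"
  proof (rule mult_mono)
    show "exp (k * n) \<le> exp (2 * \<bar>n\<bar>)" using kn by simp
    have "1 - k\<^sup>2 / 2 \<le> exp (- (k\<^sup>2 / 2))" using exp_ge_add_one_self[of "- (k\<^sup>2 / 2)"] by simp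
    then show "1 - exp (- (k\<^sup>2 / 2)) \<le> k\<^sup>2" using zero_le_power2[of k] by linarith
  qed auto
  finally have 2: "\<bar>exp (k * n - k\<^sup>2 / 2) - exp (k * n)\<bar> \<le> exp (2 * \<bar>n\<bar>) * k\<^sup>2" .
  have "3 * k\<^sup>2 * exp (2 * \<bar>n\<bar>) = 2 * k\<^sup>2 * exp (2 * \<bar>n\<bar>) + exp (2 * \<bar>n\<bar>) * k\<^sup>2"
    by simp
  with 1 2 have "\<bar>exp (k * n - k\<^sup>2 / 2) - 1 - k * n\<bar> \<le> 3 * k\<^sup>2 * exp (2 * \<bar>n\<bar>)"
    by linarith
  also have "\<dots> \<le> 3 * k\<^sup>2 * (exp (2 * n) + exp (- 2 * n))"
    using exp_abs_le[of "2 * n"] by (intro mult_left_mono) (auto simp: abs_mult)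
  finally show ?thesis .
qed

text \<open>The number \<open>12 * exp 2\<close> is the constant of \<open>gauss_tilt_le\<close>,
  and the dimension enters through the sum over coordinates in \<open>gauss_norm_le\<close>. A
  single constant serves all heat estimates.\<close>

definition heat_const :: "'d::finite itself \<Rightarrow> real" where
  "heat_const _ = 12 * exp 2 * real CARD('d)"

lemma heat_const_ge: "12 * exp 2 \<le> heat_const TYPE('d::finite)"
proof -
  have "real CARD('d) \<ge> 1" by (simp add: Suc_leI)
  then show ?thesis by (simp add: heat_const_def)
qed

lemma heat_const_pos: "0 < heat_const TYPE('d::finite)"
  using heat_const_ge[where 'd='d] exp_gt_zero[of 2] by linarith

text \<open>Rescaling \<open>d\<close> to length \<open>sqrt \<tau>\<close> makes \<open>N\<close> a
  standard normal variable with \<open>(y \<bullet> d) / \<tau> = k * N y\<close>, so the scalar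
  bounds apply pointwise. The integral of the majorant is \<open>exp (2\<^sup>2 / 2)\<close> for
  each of its two summands.\<close>

lemma gauss_majorant:
  fixes d :: "real ^ 'd"
  assumes "0 < \<tau>" "d \<noteq> 0"
  defines "k \<equiv> norm d / sqrt \<tau>"
  obtains G where "integrable (gauss \<tau>) G" "(\<integral>y. G y \<partial>gauss \<tau>) = 2 * exp 2"
    "\<And>y. \<bar>(y \<bullet> d) / \<tau>\<bar> \<le> k * G y"
    "\<And>y. k \<le> 1 \<Longrightarrow> \<bar>exp ((y \<bullet> d) / \<tau> - (norm d)\<^sup>2 / (2 * \<tau>)) - 1 - (y \<bullet> d) / \<tau>\<bar> \<le> 3 * k\<^sup>2 * G y"
proof -
  define e where "e = (1 / k) *\<^sub>R d"
  have k: "k > 0" using assms by (simp add: k_def)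
  have e: "(norm e)\<^sup>2 = \<tau>" 
    using assms k by (simp add: e_def k_def power_divide)
  define N where "N y = (y \<bullet> e) / \<tau>" for y
  have Z: "(y \<bullet> d) / \<tau> = k * N y" for y
    using k by (simp add: N_def e_def)
  have k2: "(norm d)\<^sup>2 / (2 * \<tau>) = k\<^sup>2 / 2"
    using assms by (simp add: k_def power_divide)
  define G where "G y = exp (2 * N y) + exp (- 2 * N y)" for y
  have *: "integrable (gauss \<tau>) (\<lambda>y. exp (a * N y))" "(\<integral>y. exp (a * N y) \<partial>gauss \<tau>) = exp (a\<^sup>2 / 2)" for a
    using gauss_exp_integrable[OF assms(1), of "a *\<^sub>R e"] gauss_exp_integral[OF assms(1), of "a *\<^sub>R e"] e assms(1)
    by (simp_all add: N_def power_mult_distrib)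
  show thesis
  proof
    show "integrable (gauss \<tau>) G"
      using *(1)[of 2] *(1)[of "-2"] unfolding G_def by simp
    show "(\<integral>y. G y \<partial>gauss \<tau>) = 2 * exp 2"
      using *(1)[of 2] *(1)[of "-2"] *(2)[of 2] *(2)[of "-2"] unfolding G_def by simp
    show "\<bar>(y \<bullet> d) / \<tau>\<bar> \<le> k * G y" for y
    proof -
      have "\<bar>N y\<bar> \<le> exp \<bar>2 * N y\<bar>"
        using exp_ge_add_one_self[of "\<bar>2 * N y\<bar>"] by linarith
      also have "\<dots> \<le> G y"
        using exp_abs_le[of "2 * N y"] by (simp add: G_def)
      finally show ?thesis
        using k by (simp add: Z abs_mult)
    qed
    show "\<bar>exp ((y \<bullet> d) / \<tau> - (norm d)\<^sup>2 / (2 * \<tau>)) - 1 - (y \<bullet> d) / \<tau>\<bar> \<le> 3 * k\<^sup>2 * G y" if "k \<le> 1" for y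
      using exp_tilt_bound[of k "N y"] that k by (simp only: Z k2 G_def)
  qed
qed

lemma
  fixes d :: "real ^ 'd"
  assumes "0 < \<tau>"
  shows gauss_linear_integrable: "integrable (gauss \<tau>) (\<lambda>y. (y \<bullet> d) / \<tau>)"
    and gauss_linear_le: "(\<integral>y. \<bar>(y \<bullet> d) / \<tau>\<bar> \<partial>gauss \<tau>) \<le> 6 * exp 2 * (norm d / sqrt \<tau>)"
proof -
  have "integrable (gauss \<tau>) (\<lambda>y. (y \<bullet> d) / \<tau>) \<and> (\<integral>y. \<bar>(y \<bullet> d) / \<tau>\<bar> \<partial>gauss \<tau>) \<le> 6 * exp 2 * (norm d / sqrt \<tau>)"
  proof (cases "d = 0")
    case False
    obtain G where G: "integrable (gauss \<tau>) G" "(\<integral>y. G y \<partial>gauss \<tau>) = 2 * exp 2"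
      "\<And>y. \<bar>(y \<bullet> d) / \<tau>\<bar> \<le> norm d / sqrt \<tau> * G y"
      using gauss_majorant[OF assms False] by metis
    have i: "integrable (gauss \<tau>) (\<lambda>y. (y \<bullet> d) / \<tau>)"
      by (rule Bochner_Integration.integrable_bound[OF integrable_mult_right[OF G(1), of "norm d / sqrt \<tau>"]])
        (use G(3) order_trans[OF _ abs_ge_self] in \<open>auto simp del: abs_divide\<close>)
    have "(\<integral>y. \<bar>(y \<bullet> d) / \<tau>\<bar> \<partial>gauss \<tau>) \<le> (\<integral>y. norm d / sqrt \<tau> * G y \<partial>gauss \<tau>)"
      by (rule integral_mono) (use i G in \<open>auto simp del: abs_divide\<close>)
    also have "\<dots> = norm d / sqrt \<tau> * (2 * exp 2)"
      using G by simp
    \<comment> \<open>The constant is enlarged from 2 to 6 to agree with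
      \<open>gauss_taylor_le\<close>, so that the two bounds add up to 12 in
      \<open>gauss_tilt_le\<close>.\<close>
    also have "\<dots> \<le> norm d / sqrt \<tau> * (6 * exp 2)"
      using assms by (intro mult_left_mono) auto
    finally show ?thesis using i by (simp add: mult_ac)
  qed simp
  then show "integrable (gauss \<tau>) (\<lambda>y. (y \<bullet> d) / \<tau>)"
    "(\<integral>y. \<bar>(y \<bullet> d) / \<tau>\<bar> \<partial>gauss \<tau>) \<le> 6 * exp 2 * (norm d / sqrt \<tau>)" by auto
qed

abbreviation gauss_tilt :: "real \<Rightarrow> real ^ 'd \<Rightarrow> real ^ 'd \<Rightarrow> real" where
  "gauss_tilt \<tau> d y \<equiv> exp ((y \<bullet> d) / \<tau> - (norm d)\<^sup>2 / (2 * \<tau>))"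

lemma
  fixes d :: "real ^ 'd"
  assumes "0 < \<tau>"
  shows gauss_tilt_integrable: "integrable (gauss \<tau>) (gauss_tilt \<tau> d)"
    and gauss_tilt_integral: "(\<integral>y. gauss_tilt \<tau> d y \<partial>gauss \<tau>) = 1"
  using gauss_exp_integrable[OF assms, of d] gauss_exp_integral[OF assms, of d]
  by (simp_all add: exp_diff)

lemma gauss_taylor_le:
  fixes d :: "real ^ 'd"
  assumes "0 < \<tau>"
  shows "(\<integral>y. \<bar>gauss_tilt \<tau> d y - 1 - (y \<bullet> d) / \<tau>\<bar> \<partial>gauss \<tau>) \<le> 6 * exp 2 * ((norm d)\<^sup>2 / \<tau>)"
proof (cases "d = 0")
  case False
  interpret prob_space "gauss \<tau> :: (real ^ 'd) measure" by (rule prob_space_gauss) fact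
  define k where "k = norm d / sqrt \<tau>"
  have k2: "(norm d)\<^sup>2 / \<tau> = k\<^sup>2"
    using assms by (simp add: k_def power_divide)
  obtain G where G: "integrable (gauss \<tau>) G" "(\<integral>y. G y \<partial>gauss \<tau>) = 2 * exp 2"
    "\<And>y. \<bar>(y \<bullet> d) / \<tau>\<bar> \<le> k * G y"
    "\<And>y. k \<le> 1 \<Longrightarrow> \<bar>gauss_tilt \<tau> d y - 1 - (y \<bullet> d) / \<tau>\<bar> \<le> 3 * k\<^sup>2 * G y"
    using gauss_majorant[OF assms False] unfolding k_def by metis
  note int = gauss_tilt_integrable[OF assms, of d] gauss_linear_integrable[OF assms, of d]
  show ?thesis
  proof (cases "k \<le> 1")
    case True
    have "(\<integral>y. \<bar>gauss_tilt \<tau> d y - 1 - (y \<bullet> d) / \<tau>\<bar> \<partial>gauss \<tau>) \<le> (\<integral>y. 3 * k\<^sup>2 * G y \<partial>gauss \<tau>)"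
      by (rule integral_mono) (use int G True in auto)
    then show ?thesis using G by (simp add: k2 mult_ac)
  next
    case False
    have "(\<integral>y. \<bar>gauss_tilt \<tau> d y - 1 - (y \<bullet> d) / \<tau>\<bar> \<partial>gauss \<tau>)
        \<le> (\<integral>y. gauss_tilt \<tau> d y + (1 + \<bar>(y \<bullet> d) / \<tau>\<bar>) \<partial>gauss \<tau>)"
    proof (rule integral_mono)
      show "\<bar>gauss_tilt \<tau> d y - 1 - (y \<bullet> d) / \<tau>\<bar> \<le> gauss_tilt \<tau> d y + (1 + \<bar>(y \<bullet> d) / \<tau>\<bar>)" for y
        using exp_gt_zero[of "(y \<bullet> d) / \<tau> - (norm d)\<^sup>2 / (2 * \<tau>)"] by linarith
    qed (use int in \<open>auto simp del: abs_divide\<close>)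
    also have "\<dots> = 1 + (1 + (\<integral>y. \<bar>(y \<bullet> d) / \<tau>\<bar> \<partial>gauss \<tau>))"
      using int integrable_abs[OF int(2)]
      by (simp add: gauss_tilt_integral[OF assms] prob_space[unfolded space_gauss] del: abs_divide)
    also have "(\<integral>y. \<bar>(y \<bullet> d) / \<tau>\<bar> \<partial>gauss \<tau>) \<le> (\<integral>y. k * G y \<partial>gauss \<tau>)"
      by (rule integral_mono) (use int G in \<open>auto simp del: abs_divide\<close>)
    also have "\<dots> = k * (2 * exp 2)" using G by simp
    also have "1 + (1 + k * (2 * exp 2)) \<le> 6 * exp 2 * k\<^sup>2"
    proof -
      have "k \<le> k\<^sup>2" using False by (simp add: power2_eq_square)
      moreover have "1 \<le> k\<^sup>2" using False by (simp add: one_le_power)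
      moreover have "exp 2 \<ge> (1::real)" by simp
      moreover have "1 * 1 \<le> exp 2 * k\<^sup>2" using calculation by (intro mult_mono) auto
      moreover have "k * (2 * exp 2) \<le> 2 * (exp 2 * k\<^sup>2)" using calculation by simp
      moreover have "6 * exp 2 * k\<^sup>2 = 6 * (exp 2 * k\<^sup>2)" by simp
      ultimately show ?thesis by linarith
    qed
    finally show ?thesis by (simp add: k2)
  qed
qed (use prob_space_gauss[OF assms] in \<open>simp add: prob_space.prob_space\<close>)

text \<open>The left side is the \<open>L\<^sup>1\<close> distance between the Gaussian and its
  translate by \<open>d\<close>. It is controlled by the first-order expansion for
  \<open>k \<le> 1\<close> and by the total mass 2 otherwise.\<close>

lemma gauss_tilt_le:
  fixes d :: "real ^ 'd"
  assumes "0 < \<tau>"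
  shows "(\<integral>y. \<bar>gauss_tilt \<tau> d y - 1\<bar> \<partial>gauss \<tau>) \<le> 12 * exp 2 * (norm d / sqrt \<tau>)"
proof -
  interpret prob_space "gauss \<tau> :: (real ^ 'd) measure" by (rule prob_space_gauss) fact
  define k where "k = norm d / sqrt \<tau>"
  have k0: "k \<ge> 0" using assms by (simp add: k_def)
  note int = gauss_tilt_integrable[OF assms, of d] gauss_linear_integrable[OF assms, of d]
  have "(\<integral>y. \<bar>gauss_tilt \<tau> d y - 1\<bar> \<partial>gauss \<tau>) \<le> 12 * exp 2 * k"
  proof (cases "k \<le> 1")
    case True
    have "(\<integral>y. \<bar>gauss_tilt \<tau> d y - 1\<bar> \<partial>gauss \<tau>)
        \<le> (\<integral>y. \<bar>gauss_tilt \<tau> d y - 1 - (y \<bullet> d) / \<tau>\<bar> + \<bar>(y \<bullet> d) / \<tau>\<bar> \<partial>gauss \<tau>)"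
      by (rule integral_mono) (use int in \<open>auto simp del: abs_divide\<close>)
    also have "\<dots> = (\<integral>y. \<bar>gauss_tilt \<tau> d y - 1 - (y \<bullet> d) / \<tau>\<bar> \<partial>gauss \<tau>) + (\<integral>y. \<bar>(y \<bullet> d) / \<tau>\<bar> \<partial>gauss \<tau>)"
      by (rule Bochner_Integration.integral_add) (use int in \<open>auto simp del: abs_divide\<close>)
    also have "\<dots> \<le> 6 * exp 2 * ((norm d)\<^sup>2 / \<tau>) + 6 * exp 2 * (norm d / sqrt \<tau>)"
      by (intro add_mono gauss_taylor_le gauss_linear_le assms)
    also have "\<dots> = 6 * exp 2 * (k\<^sup>2 + k)"
      using assms by (simp add: k_def power_divide algebra_simps)
    also have "\<dots> \<le> 6 * exp 2 * (k + k)"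
      using True k0 by (intro mult_left_mono add_right_mono) (auto simp: power2_eq_square mult_left_le)
    finally show ?thesis by simp
  next
    case False
    have "(\<integral>y. \<bar>gauss_tilt \<tau> d y - 1\<bar> \<partial>gauss \<tau>) \<le> (\<integral>y. gauss_tilt \<tau> d y + 1 \<partial>gauss \<tau>)"
    proof (rule integral_mono)
      show "\<bar>gauss_tilt \<tau> d y - 1\<bar> \<le> gauss_tilt \<tau> d y + 1" for y
        using exp_gt_zero[of "(y \<bullet> d) / \<tau> - (norm d)\<^sup>2 / (2 * \<tau>)"] by linarith
    qed (use int in auto)
    also have "\<dots> = 2"
      using int by (simp add: gauss_tilt_integral[OF assms] prob_space[unfolded space_gauss])
    also have "\<dots> \<le> 12 * exp 2 * k"
    proof -
      have "1 * 1 \<le> exp 2 * k" using False by (intro mult_mono) auto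
      then show ?thesis by linarith
    qed
    finally show ?thesis .
  qed
  then show ?thesis by (simp add: k_def)
qed

lemma
  assumes "0 < \<tau>"
  shows gauss_norm_integrable: "integrable (gauss \<tau>) (\<lambda>y::real ^ 'd. norm y)"
    and gauss_norm_le: "(\<integral>y. norm (y::real ^ 'd) \<partial>gauss \<tau>) \<le> heat_const TYPE('d) * sqrt \<tau>"
proof -
  \<comment> \<open>The vector \<open>axis i \<tau>\<close> turns the linear bound into a bound on
    coordinate \<open>i\<close>; its length \<tau> gives
    \<open>\<tau> / sqrt \<tau> = sqrt \<tau>\<close>.\<close>
  have c: "(y \<bullet> axis i \<tau>) / \<tau> = y $ i" for y :: "real ^ 'd" and i
    using assms by (simp add: inner_axis)
  have na: "norm (axis i \<tau> :: real ^ 'd) = \<tau>" for i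
    using assms by (simp add: norm_eq_sqrt_inner inner_axis_axis)
  have i: "integrable (gauss \<tau>) (\<lambda>y::real ^ 'd. \<bar>y $ i\<bar>)" for i
    using gauss_linear_integrable[OF assms, of "axis i \<tau> :: real ^ 'd"] unfolding c by (rule integrable_abs)
  have le: "(\<integral>y. \<bar>(y::real ^ 'd) $ i\<bar> \<partial>gauss \<tau>) \<le> 6 * exp 2 * sqrt \<tau>" for i
    using gauss_linear_le[OF assms, of "axis i \<tau> :: real ^ 'd"] assms unfolding c
    by (simp only: na real_div_sqrt[OF less_imp_le])
  have s: "norm y \<le> (\<Sum>i\<in>UNIV. \<bar>y $ i\<bar>)" for y :: "real ^ 'd"
    by (rule norm_le_l1_cart)
  have isum: "integrable (gauss \<tau>) (\<lambda>y::real ^ 'd. (\<Sum>i\<in>UNIV. \<bar>y $ i\<bar>))"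
    using i by simp
  show n: "integrable (gauss \<tau>) (\<lambda>y::real ^ 'd. norm y)"
    by (rule Bochner_Integration.integrable_bound[OF isum]) (use s order_trans[OF _ abs_ge_self] in auto)
  have "(\<integral>y. norm (y::real ^ 'd) \<partial>gauss \<tau>) \<le> (\<integral>y. (\<Sum>i\<in>UNIV. \<bar>(y::real ^ 'd) $ i\<bar>) \<partial>gauss \<tau>)"
    by (rule integral_mono) (use n isum s in auto)
  also have "\<dots> = (\<Sum>i\<in>UNIV. \<integral>y. \<bar>(y::real ^ 'd) $ i\<bar> \<partial>gauss \<tau>)"
    using i by simp
  also have "\<dots> \<le> (\<Sum>i\<in>(UNIV::'d set). 6 * exp 2 * sqrt \<tau>)"
    using le by (rule sum_mono)
  also have "\<dots> \<le> heat_const TYPE('d) * sqrt \<tau>"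
    using assms by (simp add: heat_const_def)
  finally show "(\<integral>y. norm (y::real ^ 'd) \<partial>gauss \<tau>) \<le> heat_const TYPE('d) * sqrt \<tau>" .
qed

section \<open>The heat semigroup\<close>

definition heat :: "real \<Rightarrow> (real ^ 'd \<Rightarrow> 'b::{banach, second_countable_topology}) \<Rightarrow> real ^ 'd \<Rightarrow> 'b" where
  "heat \<tau> f x = (\<integral>y. f (x + y) \<partial>gauss \<tau>)"

text \<open>The gradient of \<open>heat \<tau> f\<close>, written without derivatives (Gaussian integration by parts).\<close>

definition heat_grad :: "real \<Rightarrow> (real ^ 'd \<Rightarrow> real) \<Rightarrow> real ^ 'd \<Rightarrow> real ^ 'd" where
  "heat_grad \<tau> f x = (\<integral>y. (f (x + y) / \<tau>) *\<^sub>R y \<partial>gauss \<tau>)"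

lemma gauss_integrable_bounded:
  fixes f :: "real ^ 'd \<Rightarrow> 'b::{banach, second_countable_topology}"
  assumes "0 < \<tau>" and [measurable]: "f \<in> borel_measurable borel" and "\<And>x. norm (f x) \<le> A"
  shows "integrable (gauss \<tau>) f"
proof -
  interpret prob_space "gauss \<tau> :: (real ^ 'd) measure" by (rule prob_space_gauss) fact
  show ?thesis by (rule integrable_const_bound[of _ A]) (use assms in auto)
qed

text \<open>Only measurability of \<open>f\<close> has to be checked by callers, since integrability
  follows from the majorant \<open>w\<close>.\<close>

lemma norm_integral_le:
  fixes f :: "'a \<Rightarrow> 'b::{banach, second_countable_topology}"
  assumes [measurable]: "f \<in> borel_measurable M" and w: "integrable M w"
    and le: "\<And>x. x \<in> space M \<Longrightarrow> norm (f x) \<le> w x"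
  shows "norm (\<integral>x. f x \<partial>M) \<le> (\<integral>x. w x \<partial>M)"
proof -
  have "integrable M f"
    by (rule Bochner_Integration.integrable_bound[OF w])
      (use le order_trans[OF _ abs_ge_self] in auto)
  then have "integrable M (\<lambda>x. norm (f x))" by simp
  then show ?thesis
    by (intro order_trans[OF integral_norm_bound] integral_mono w le)
qed

lemma norm_integral_le_mult:
  fixes f :: "'a \<Rightarrow> 'b::{banach, second_countable_topology}"
  assumes [measurable]: "f \<in> borel_measurable M" and "integrable M w"
    and "\<And>x. norm (f x) \<le> A * w x" and "(\<integral>x. w x \<partial>M) \<le> B" and "0 \<le> A"
  shows "norm (\<integral>x. f x \<partial>M) \<le> A * B"
proof -
  have "norm (\<integral>x. f x \<partial>M) \<le> (\<integral>x. A * w x \<partial>M)"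
    by (rule norm_integral_le) (use assms in auto)
  also have "\<dots> \<le> A * B" using assms by (simp add: mult_left_mono)
  finally show ?thesis .
qed

lemma heat_norm_le:
  fixes f :: "real ^ 'd \<Rightarrow> 'b::{banach, second_countable_topology}"
  assumes "0 < \<tau>" and [measurable]: "f \<in> borel_measurable borel" and A: "\<And>x. norm (f x) \<le> A"
  shows "norm (heat \<tau> f x) \<le> A"
proof -
  interpret prob_space "gauss \<tau> :: (real ^ 'd) measure" by (rule prob_space_gauss) fact
  have "0 \<le> A" using A[of 0] norm_ge_zero[of "f 0"] by linarith
  have "norm (heat \<tau> f x) \<le> A * 1"
    unfolding heat_def
    by (rule norm_integral_le_mult[where w="\<lambda>_. 1"])
      (use A \<open>0 \<le> A\<close> prob_space[unfolded space_gauss] in auto)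
  then show ?thesis by simp
qed

lemma heat_shift:
  fixes f :: "real ^ 'd \<Rightarrow> 'b::{banach, second_countable_topology}"
  assumes "0 < \<tau>" and [measurable]: "f \<in> borel_measurable borel"
  shows "heat \<tau> f (x + d) = (\<integral>y. gauss_tilt \<tau> d y *\<^sub>R f (x + y) \<partial>gauss \<tau>)"
  using integral_gauss_shift[OF assms(1), of "\<lambda>y. f (x + y)" d] by (simp add: heat_def add.assoc)

lemma tilt_scaleR_integrable:
  fixes f :: "real ^ 'd \<Rightarrow> 'b::{banach, second_countable_topology}"
  assumes "0 < \<tau>" and [measurable]: "f \<in> borel_measurable borel" and A: "\<And>x. norm (f x) \<le> A"
  shows "integrable (gauss \<tau>) (\<lambda>y. gauss_tilt \<tau> d y *\<^sub>R f (x + y))"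
proof (rule Bochner_Integration.integrable_bound[OF integrable_mult_right[OF gauss_tilt_integrable[OF assms(1), of d], of A]])
  have "0 \<le> A" using A[of 0] norm_ge_zero[of "f 0"] by linarith
  then show "AE y in gauss \<tau>. norm (gauss_tilt \<tau> d y *\<^sub>R f (x + y)) \<le> norm (A * gauss_tilt \<tau> d y)"
    using A by (auto simp: abs_mult mult.commute intro!: mult_left_mono)
qed measurable

text \<open>The shift is moved from \<open>f\<close> onto the Gaussian weight, so only the sup norm
  of \<open>f\<close> enters.\<close>

lemma heat_lipschitz:
  fixes f :: "real ^ 'd \<Rightarrow> 'b::{banach, second_countable_topology}"
  assumes "0 < \<tau>" and [measurable]: "f \<in> borel_measurable borel" and A: "\<And>x. norm (f x) \<le> A"
  shows "norm (heat \<tau> f (x + d) - heat \<tau> f x) \<le> A * (heat_const TYPE('d) * norm d / sqrt \<tau>)"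
proof -
  interpret prob_space "gauss \<tau> :: (real ^ 'd) measure" by (rule prob_space_gauss) fact
  have "0 \<le> A" using A[of 0] norm_ge_zero[of "f 0"] by linarith
  have "heat \<tau> f (x + d) - heat \<tau> f x = (\<integral>y. (gauss_tilt \<tau> d y - 1) *\<^sub>R f (x + y) \<partial>gauss \<tau>)"
    unfolding heat_shift[OF assms(1,2)] unfolding heat_def
    using tilt_scaleR_integrable[OF assms, of d x] gauss_integrable_bounded[of \<tau> "\<lambda>y. f (x + y)" A] assms
    by (simp add: scaleR_diff_left)
  also have "norm \<dots> \<le> A * (heat_const TYPE('d) * norm d / sqrt \<tau>)"
  proof (rule norm_integral_le_mult)
    show "norm ((gauss_tilt \<tau> d y - 1) *\<^sub>R f (x + y)) \<le> A * \<bar>gauss_tilt \<tau> d y - 1\<bar>" for y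
      using A by (simp add: mult.commute[of A] mult_left_mono)
    have "(\<integral>y. \<bar>gauss_tilt \<tau> d y - 1\<bar> \<partial>gauss \<tau>) \<le> 12 * exp 2 * (norm d / sqrt \<tau>)"
      by (rule gauss_tilt_le) fact
    also have "\<dots> \<le> heat_const TYPE('d) * (norm d / sqrt \<tau>)"
      by (intro mult_right_mono heat_const_ge) (use assms in auto)
    finally show "(\<integral>y. \<bar>gauss_tilt \<tau> d y - 1\<bar> \<partial>gauss \<tau>) \<le> heat_const TYPE('d) * norm d / sqrt \<tau>" by simp
    show "integrable (gauss \<tau>) (\<lambda>y. \<bar>gauss_tilt \<tau> d y - 1\<bar>)"
      using gauss_tilt_integrable[OF assms(1), of d] by simp
  qed (use \<open>0 \<le> A\<close> in auto)
  finally show ?thesis .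
qed

lemma lipschitz_imp_continuous:
  fixes f :: "'a::real_normed_vector \<Rightarrow> 'b::real_normed_vector"
  assumes L: "\<And>x d. norm (f (x + d) - f x) \<le> L * norm d"
  shows "continuous_on UNIV f"
proof -
  \<comment> \<open>A negative \<open>L\<close> is compatible with the hypothesis only if the space
    is trivial.\<close>
  have "L \<ge> 0 \<or> (\<forall>x::'a. x = 0)"
    using L order_trans[OF norm_ge_zero L] by (metis mult_less_0_iff norm_le_zero_iff not_less)
  then show ?thesis
  proof
    assume "L \<ge> 0"
    then have "L-lipschitz_on UNIV f"
      using L[of y "x - y" for x y] by (auto simp: lipschitz_on_def dist_norm)
    then show ?thesis by (rule lipschitz_on_continuous_on)
  next
    assume "\<forall>x::'a. x = 0"
    then have "f = (\<lambda>_. f 0)" by (metis)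
    then show ?thesis by (metis continuous_on_const)
  qed
qed

lemma heat_continuous:
  fixes f :: "real ^ 'd \<Rightarrow> 'b::{banach, second_countable_topology}"
  assumes "0 < \<tau>" "f \<in> borel_measurable borel" "\<And>x. norm (f x) \<le> A"
  shows "continuous_on UNIV (heat \<tau> f)"
  by (rule lipschitz_imp_continuous[of _ "A * (heat_const TYPE('d) / sqrt \<tau>)"])
    (use heat_lipschitz[OF assms] in \<open>simp add: mult_ac\<close>)

lemma heat_grad_integrable:
  fixes f :: "real ^ 'd \<Rightarrow> real"
  assumes "0 < \<tau>" and [measurable]: "f \<in> borel_measurable borel" and A: "\<And>x. \<bar>f x\<bar> \<le> A"
  shows "integrable (gauss \<tau>) (\<lambda>y. (f (x + y) / \<tau>) *\<^sub>R y)"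
proof (rule Bochner_Integration.integrable_bound[OF integrable_mult_right[OF gauss_norm_integrable[OF assms(1)], of "A / \<tau>"]])
  have "0 \<le> A" using A[of 0] by linarith
  then show "AE y in gauss \<tau>. norm ((f (x + y) / \<tau>) *\<^sub>R y) \<le> norm (A / \<tau> * norm y)"
    using A assms(1) by (auto simp: abs_mult abs_div intro!: divide_right_mono mult_right_mono)
qed measurable

lemma heat_grad_norm_le:
  fixes f :: "real ^ 'd \<Rightarrow> real"
  assumes "0 < \<tau>" and [measurable]: "f \<in> borel_measurable borel" and A: "\<And>x. \<bar>f x\<bar> \<le> A"
  shows "norm (heat_grad \<tau> f x) \<le> A * heat_const TYPE('d) / sqrt \<tau>"
proof -
  have "0 \<le> A" using A[of 0] by linarith
  have "norm (heat_grad \<tau> f x) \<le> A / \<tau> * (heat_const TYPE('d) * sqrt \<tau>)"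
    unfolding heat_grad_def
  proof (rule norm_integral_le_mult[OF _ gauss_norm_integrable[OF assms(1)] _ gauss_norm_le[OF assms(1)]])
    show "norm ((f (x + y) / \<tau>) *\<^sub>R y) \<le> A / \<tau> * norm y" for y
      using A assms(1) by (auto simp: abs_mult abs_div intro!: divide_right_mono mult_right_mono)
  qed (use \<open>0 \<le> A\<close> assms(1) in auto)
  also have "\<dots> = A * heat_const TYPE('d) / sqrt \<tau>"
    using assms(1) by (simp add: field_simps)
  finally show ?thesis .
qed

text \<open>This is what makes \<open>heat_grad\<close> the gradient of \<open>heat\<close>:
  \<open>(y \<bullet> d) / \<tau>\<close> is the first-order part of the shift weight, and the
  remainder of the weight is small in \<open>L\<^sup>1\<close>.\<close>

lemma heat_taylor:
  fixes f :: "real ^ 'd \<Rightarrow> real"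
  assumes "0 < \<tau>" and [measurable]: "f \<in> borel_measurable borel" and A: "\<And>x. \<bar>f x\<bar> \<le> A"
  shows "\<bar>heat \<tau> f (x + d) - heat \<tau> f x - heat_grad \<tau> f x \<bullet> d\<bar> \<le> A * (heat_const TYPE('d) * (norm d)\<^sup>2 / \<tau>)"
proof -
  interpret prob_space "gauss \<tau> :: (real ^ 'd) measure" by (rule prob_space_gauss) fact
  have "0 \<le> A" using A[of 0] by linarith
  note A' = A[folded real_norm_def]
  have g: "heat_grad \<tau> f x \<bullet> d = (\<integral>y. ((f (x + y) / \<tau>) *\<^sub>R y) \<bullet> d \<partial>gauss \<tau>)"
    unfolding heat_grad_def by (rule integral_inner_left[symmetric]) (use heat_grad_integrable[OF assms] in auto)
  have "heat \<tau> f (x + d) - heat \<tau> f x - heat_grad \<tau> f x \<bullet> d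
      = (\<integral>y. gauss_tilt \<tau> d y *\<^sub>R f (x + y) - f (x + y) - ((f (x + y) / \<tau>) *\<^sub>R y) \<bullet> d \<partial>gauss \<tau>)"
    unfolding heat_shift[OF assms(1,2)] g unfolding heat_def
    using tilt_scaleR_integrable[OF assms(1,2) A', of d x] gauss_integrable_bounded[of \<tau> "\<lambda>y. f (x + y)" A]
      integrable_inner_left[OF heat_grad_integrable[OF assms, of x], of d] assms by simp
  also have "norm \<dots> \<le> A * (heat_const TYPE('d) * (norm d)\<^sup>2 / \<tau>)"
  proof (rule norm_integral_le_mult)
    show "norm (gauss_tilt \<tau> d y *\<^sub>R f (x + y) - f (x + y) - ((f (x + y) / \<tau>) *\<^sub>R y) \<bullet> d)
        \<le> A * \<bar>gauss_tilt \<tau> d y - 1 - (y \<bullet> d) / \<tau>\<bar>" for y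
    proof -
      have "gauss_tilt \<tau> d y *\<^sub>R f (x + y) - f (x + y) - ((f (x + y) / \<tau>) *\<^sub>R y) \<bullet> d
          = f (x + y) * (gauss_tilt \<tau> d y - 1 - (y \<bullet> d) / \<tau>)"
        by (simp add: algebra_simps)
      then show ?thesis
        using A by (simp add: abs_mult mult_right_mono)
    qed
    have "(\<integral>y. \<bar>gauss_tilt \<tau> d y - 1 - (y \<bullet> d) / \<tau>\<bar> \<partial>gauss \<tau>) \<le> 6 * exp 2 * ((norm d)\<^sup>2 / \<tau>)"
      by (rule gauss_taylor_le) fact
    also have "\<dots> \<le> heat_const TYPE('d) * ((norm d)\<^sup>2 / \<tau>)"
      using heat_const_ge[where 'd='d] assms(1) exp_gt_zero[of 2] by (intro mult_right_mono) (auto intro: order_trans[rotated])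
    finally show "(\<integral>y. \<bar>gauss_tilt \<tau> d y - 1 - (y \<bullet> d) / \<tau>\<bar> \<partial>gauss \<tau>) \<le> heat_const TYPE('d) * (norm d)\<^sup>2 / \<tau>" by simp
    show "integrable (gauss \<tau>) (\<lambda>y. \<bar>gauss_tilt \<tau> d y - 1 - (y \<bullet> d) / \<tau>\<bar>)"
      using gauss_tilt_integrable[OF assms(1), of d] gauss_linear_integrable[OF assms(1), of d] by simp
  qed (use \<open>0 \<le> A\<close> in auto)
  finally show ?thesis by simp
qed

lemma heat_semigroup:
  fixes f :: "real ^ 'd \<Rightarrow> 'b::{banach, second_countable_topology}"
  assumes "0 < \<sigma>" "0 < \<tau>" and [measurable]: "f \<in> borel_measurable borel" and A: "\<And>x. norm (f x) \<le> A"
  shows "heat (\<sigma> + \<tau>) f x = heat \<sigma> (heat \<tau> f) x"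
proof -
  interpret \<sigma>: prob_space "gauss \<sigma> :: (real ^ 'd) measure" by (rule prob_space_gauss) fact
  interpret \<tau>: prob_space "gauss \<tau> :: (real ^ 'd) measure" by (rule prob_space_gauss) fact
  interpret P: pair_prob_space "gauss \<sigma> :: (real ^ 'd) measure" "gauss \<tau> :: (real ^ 'd) measure" ..
  have "heat (\<sigma> + \<tau>) f x = (\<integral>p. f (x + (fst p + snd p)) \<partial>(gauss \<sigma> \<Otimes>\<^sub>M gauss \<tau>))"
    unfolding heat_def gauss_convolution[OF assms(1,2), symmetric]
    by (subst integral_distr) (auto simp: split_beta)
  also have "\<dots> = (\<integral>y. \<integral>z. f (x + (y + z)) \<partial>gauss \<tau> \<partial>gauss \<sigma>)"
    by (subst P.integral_fst'[symmetric]) (auto intro!: P.integrable_const_bound[of _ A] simp: A)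
  finally show ?thesis
    by (simp add: heat_def add.assoc)
qed

lemma heat_grad_measurable:
  fixes f :: "real ^ 'd \<Rightarrow> real"
  assumes "0 < \<tau>" and [measurable]: "f \<in> borel_measurable borel"
  shows "heat_grad \<tau> f \<in> borel_measurable borel"
proof -
  interpret prob_space "gauss \<tau> :: (real ^ 'd) measure" by (rule prob_space_gauss) fact
  show ?thesis unfolding heat_grad_def[abs_def] by measurable
qed

lemma inner_quadratic_imp_eq:
  fixes u w :: "'a::real_inner"
  assumes "\<And>d. \<bar>(u - w) \<bullet> d\<bar> \<le> C * (norm d)\<^sup>2"
  shows "u = w"
proof (rule ccontr)
  assume "u \<noteq> w"
  then have p: "(u - w) \<bullet> (u - w) > 0" by simp
  \<comment> \<open>The scale is chosen so that \<open>C * s < 1\<close>; then testing with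
    \<open>s *\<^sub>R (u - w)\<close> makes the quadratic bound smaller than the linear
    term.\<close>
  define s where "s = 1 / (\<bar>C\<bar> + 1)"
  have s: "s > 0" by (simp add: s_def)
  have "s * ((u - w) \<bullet> (u - w)) \<le> C * (s\<^sup>2 * ((u - w) \<bullet> (u - w)))"
    using assms[of "s *\<^sub>R (u - w)"] s p by (simp add: power_mult_distrib power2_norm_eq_inner)
  then have "s * ((u - w) \<bullet> (u - w)) \<le> s * ((C * s) * ((u - w) \<bullet> (u - w)))"
    by (simp add: power2_eq_square mult_ac)
  then have "1 \<le> C * s"
    using s p by simp
  moreover have "C * s < 1"
    by (auto simp: s_def field_simps)
  ultimately show False by simp
qed

text \<open>Both sides are first-order coefficients of the same function
  \<open>heat (\<sigma> + \<tau>) f\<close> at \<open>x\<close>: the left one by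
  \<open>heat_taylor\<close> itself, the right one by integrating the expansion of
  \<open>heat \<tau> f\<close> against \<open>gauss \<sigma>\<close>. Two such coefficients with
  quadratic remainders agree.\<close>

lemma heat_grad_semigroup:
  fixes f :: "real ^ 'd \<Rightarrow> real"
  assumes "0 < \<sigma>" "0 < \<tau>" and f[measurable]: "f \<in> borel_measurable borel" and A: "\<And>x. \<bar>f x\<bar> \<le> A"
  shows "heat_grad (\<sigma> + \<tau>) f x = heat \<sigma> (heat_grad \<tau> f) x"
proof (rule inner_quadratic_imp_eq)
  interpret prob_space "gauss \<sigma> :: (real ^ 'd) measure" by (rule prob_space_gauss) fact
  note A' = A[folded real_norm_def]
  let ?c = "A * heat_const TYPE('d)"
  fix d :: "real ^ 'd"
  note [measurable] = heat_grad_measurable[OF assms(2,3)]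
    borel_measurable_continuous_onI[OF heat_continuous[OF assms(2,3) A']]
  have h: "heat (\<sigma> + \<tau>) f = heat \<sigma> (heat \<tau> f)"
    using heat_semigroup[OF assms(1,2,3) A'] by auto
  have 1: "\<bar>heat (\<sigma> + \<tau>) f (x + d) - heat (\<sigma> + \<tau>) f x - heat_grad (\<sigma> + \<tau>) f x \<bullet> d\<bar> \<le> A * (heat_const TYPE('d) * (norm d)\<^sup>2 / (\<sigma> + \<tau>))"
    by (rule heat_taylor) (use assms in auto)
  have i1: "integrable (gauss \<sigma>) (\<lambda>y. heat \<tau> f (x + d + y))" "integrable (gauss \<sigma>) (\<lambda>y. heat \<tau> f (x + y))"
    by (auto intro!: gauss_integrable_bounded[of \<sigma> _ A] assms heat_norm_le[OF assms(2,3) A', simplified])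
  have i2: "integrable (gauss \<sigma>) (\<lambda>y. heat_grad \<tau> f (x + y))"
    by (rule gauss_integrable_bounded[OF assms(1) _ heat_grad_norm_le[OF assms(2,3) A]]) measurable
  have "heat (\<sigma> + \<tau>) f (x + d) - heat (\<sigma> + \<tau>) f x - heat \<sigma> (heat_grad \<tau> f) x \<bullet> d
      = (\<integral>y. heat \<tau> f (x + y + d) - heat \<tau> f (x + y) - heat_grad \<tau> f (x + y) \<bullet> d \<partial>gauss \<sigma>)"
    unfolding h using i1 i2 by (simp add: heat_def[of \<sigma>] add_ac)
  also have "norm \<dots> \<le> A * (heat_const TYPE('d) * (norm d)\<^sup>2 / \<tau>) * 1"
    by (rule norm_integral_le_mult[where w="\<lambda>_. 1"])
      (use heat_taylor[OF assms(2,3) A] heat_const_pos[where 'd='d] A[of 0] assms(2) prob_space[unfolded space_gauss] in auto)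
  finally have 2: "\<bar>heat (\<sigma> + \<tau>) f (x + d) - heat (\<sigma> + \<tau>) f x - heat \<sigma> (heat_grad \<tau> f) x \<bullet> d\<bar>
      \<le> A * (heat_const TYPE('d) * (norm d)\<^sup>2 / \<tau>)" by simp
  have "(heat_grad (\<sigma> + \<tau>) f x - heat \<sigma> (heat_grad \<tau> f) x) \<bullet> d
      = (heat (\<sigma> + \<tau>) f (x + d) - heat (\<sigma> + \<tau>) f x - heat \<sigma> (heat_grad \<tau> f) x \<bullet> d)
      - (heat (\<sigma> + \<tau>) f (x + d) - heat (\<sigma> + \<tau>) f x - heat_grad (\<sigma> + \<tau>) f x \<bullet> d)"
    by (simp add: inner_diff_left)
  also have "\<bar>\<dots>\<bar> \<le> A * (heat_const TYPE('d) * (norm d)\<^sup>2 / \<tau>) + A * (heat_const TYPE('d) * (norm d)\<^sup>2 / (\<sigma> + \<tau>))"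
    using 1 2 by linarith
  also have "\<dots> = (?c / \<tau> + ?c / (\<sigma> + \<tau>)) * (norm d)\<^sup>2"
    by (simp add: algebra_simps)
  finally show "\<bar>(heat_grad (\<sigma> + \<tau>) f x - heat \<sigma> (heat_grad \<tau> f) x) \<bullet> d\<bar> \<le> (?c / \<tau> + ?c / (\<sigma> + \<tau>)) * (norm d)\<^sup>2" .
qed

text \<open>The time is halved: one half bounds the gradient, the other makes it Lipschitz, and each
  costs a factor \<open>1 / sqrt (\<tau> / 2)\<close>.\<close>

lemma heat_grad_lipschitz:
  fixes f :: "real ^ 'd \<Rightarrow> real"
  assumes "0 < \<tau>" and f: "f \<in> borel_measurable borel" and A: "\<And>x. \<bar>f x\<bar> \<le> A"
  shows "norm (heat_grad \<tau> f (x + d) - heat_grad \<tau> f x) \<le> A * (2 * (heat_const TYPE('d))\<^sup>2 * norm d / \<tau>)"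
proof -
  have t: "0 < \<tau> / 2" using assms by simp
  have "norm (heat (\<tau> / 2) (heat_grad (\<tau> / 2) f) (x + d) - heat (\<tau> / 2) (heat_grad (\<tau> / 2) f) x)
      \<le> (A * heat_const TYPE('d) / sqrt (\<tau> / 2)) * (heat_const TYPE('d) * norm d / sqrt (\<tau> / 2))"
    by (rule heat_lipschitz[OF t heat_grad_measurable[OF t f] heat_grad_norm_le[OF t f A]])
  also have "\<dots> = A * ((heat_const TYPE('d))\<^sup>2 * norm d / (sqrt (\<tau> / 2) * sqrt (\<tau> / 2)))"
    by (simp add: power2_eq_square)
  also have "sqrt (\<tau> / 2) * sqrt (\<tau> / 2) = \<tau> / 2"
    using t by (intro real_sqrt_mult_self[THEN trans]) simp
  finally show ?thesis
    using heat_grad_semigroup[OF t t f A] by (simp add: mult_ac)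
qed

lemma heat_grad_continuous:
  fixes f :: "real ^ 'd \<Rightarrow> real"
  assumes "0 < \<tau>" "f \<in> borel_measurable borel" "\<And>x. \<bar>f x\<bar> \<le> A"
  shows "continuous_on UNIV (heat_grad \<tau> f)"
  by (rule lipschitz_imp_continuous[of _ "A * (2 * (heat_const TYPE('d))\<^sup>2 / \<tau>)"])
    (use heat_grad_lipschitz[OF assms] in \<open>simp add: mult_ac\<close>)

text \<open>The affine modulus of continuity serves two purposes: \<open>\<epsilon> = 0\<close> for
  Lipschitz functions, and a small \<epsilon> with a large slope for functions that are only bounded
  and continuous.\<close>

lemma heat_diff_le:
  fixes f :: "real ^ 'd \<Rightarrow> 'b::{banach, second_countable_topology}"
  assumes "0 < \<tau>" and f: "f \<in> borel_measurable borel" and A: "\<And>x. norm (f x) \<le> A"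
    and L: "\<And>y. norm (f (x + y) - f x) \<le> \<epsilon> + L * norm y" and "0 \<le> L"
  shows "norm (heat \<tau> f x - f x) \<le> \<epsilon> + L * (heat_const TYPE('d) * sqrt \<tau>)"
proof -
  interpret prob_space "gauss \<tau> :: (real ^ 'd) measure" by (rule prob_space_gauss) fact
  have [measurable]: "f \<in> borel_measurable borel" by fact
  have i: "integrable (gauss \<tau>) (\<lambda>y. f (x + y))"
    by (rule gauss_integrable_bounded[of \<tau> _ A]) (use assms in auto)
  have "heat \<tau> f x - f x = (\<integral>y. f (x + y) - f x \<partial>gauss \<tau>)"
    using i by (simp add: heat_def prob_space[unfolded space_gauss])
  also have "norm \<dots> \<le> (\<integral>y. \<epsilon> + L * norm (y::real ^ 'd) \<partial>gauss \<tau>)"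
    by (rule norm_integral_le) (use i L gauss_norm_integrable[OF assms(1), where 'd='d] in auto)
  also have "\<dots> = \<epsilon> + L * (\<integral>y. norm (y::real ^ 'd) \<partial>gauss \<tau>)"
    using gauss_norm_integrable[OF assms(1), where 'd='d] by (simp add: prob_space[unfolded space_gauss])
  also have "\<dots> \<le> \<epsilon> + L * (heat_const TYPE('d) * sqrt \<tau>)"
    using gauss_norm_le[OF assms(1), where 'd='d] \<open>0 \<le> L\<close> by (intro add_left_mono mult_left_mono)
  finally show ?thesis .
qed

lemma heat_tendsto:
  fixes f :: "real ^ 'd \<Rightarrow> 'b::{banach, second_countable_topology}"
  assumes c: "continuous_on UNIV f" and A: "\<And>x. norm (f x) \<le> A"
  shows "((\<lambda>\<tau>. heat \<tau> f x) \<longlongrightarrow> f x) (at_right 0)"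
proof (rule tendstoI)
  fix e :: real assume "0 < e"
  have f: "f \<in> borel_measurable borel" by (rule borel_measurable_continuous_onI[OF c])
  have "A \<ge> 0" using A[of 0] norm_ge_zero[of "f 0"] by linarith
  obtain \<delta> where \<delta>: "\<delta> > 0" "\<And>y. dist y x < \<delta> \<Longrightarrow> dist (f y) (f x) < e / 2"
    using c \<open>0 < e\<close> unfolding continuous_on_iff by (metis UNIV_I half_gt_zero)
  \<comment> \<open>At distance at least \<delta> the trivial bound \<open>2 * A\<close> is absorbed
    by the slope \<open>2 * A / \<delta>\<close>.\<close>
  have L: "norm (f (x + y) - f x) \<le> e / 2 + 2 * A / \<delta> * norm y" for y
  proof (cases "norm y < \<delta>")
    case True
    then have "norm (f (x + y) - f x) < e / 2" using \<delta>(2)[of "x + y"] by (simp add: dist_norm)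
    then show ?thesis using \<open>A \<ge> 0\<close> \<delta> by (smt (verit) divide_nonneg_nonneg mult_nonneg_nonneg norm_ge_zero)
  next
    case False
    have "norm (f (x + y) - f x) \<le> A + A"
      by (rule order_trans[OF norm_triangle_ineq4 add_mono[OF A A]])
    also have "\<dots> \<le> 2 * A / \<delta> * norm y"
      using False \<delta>(1) \<open>A \<ge> 0\<close> by (simp add: field_simps mult_left_mono)
    finally show ?thesis using \<open>0 < e\<close> by linarith
  qed
  have "((\<lambda>\<tau>. e / 2 + 2 * A / \<delta> * (heat_const TYPE('d) * sqrt \<tau>)) \<longlongrightarrow> e / 2 + 2 * A / \<delta> * (heat_const TYPE('d) * sqrt 0)) (at_right 0)"
    by (intro tendsto_intros)
  then have "\<forall>\<^sub>F \<tau> in at_right 0. e / 2 + 2 * A / \<delta> * (heat_const TYPE('d) * sqrt \<tau>) < e"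
    by (rule order_tendstoD(2)) (use \<open>0 < e\<close> in auto)
  moreover have "\<forall>\<^sub>F \<tau> in at_right (0::real). 0 < \<tau>"
    by (rule eventually_at_right_less)
  ultimately show "\<forall>\<^sub>F \<tau> in at_right 0. dist (heat \<tau> f x) (f x) < e"
  proof eventually_elim
    case (elim \<tau>)
    have "norm (heat \<tau> f x - f x) \<le> e / 2 + 2 * A / \<delta> * (heat_const TYPE('d) * sqrt \<tau>)"
      by (rule heat_diff_le[OF elim(2) f A L]) (use \<open>A \<ge> 0\<close> \<delta> in auto)
    then show ?case using elim by (simp add: dist_norm)
  qed
qed

lemma filterlim_inverse_Suc_at_right: "filterlim (\<lambda>n. 1 / real (Suc n)) (at_right 0) sequentially"
  unfolding filterlim_at using LIMSEQ_Suc[OF lim_1_over_n] by (auto simp: eventually_sequentially)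

section \<open>A Duhamel formula for Brownian motion with bounded drift\<close>

text \<open>The measure \<open>gauss \<tau>\<close> varies with \<tau>. Rewriting the integral over
  \<open>lborel\<close> puts this dependence into the integrand, where it is jointly
  measurable.\<close>

lemma heat_grad_measurable2:
  fixes f :: "real ^ 'd \<Rightarrow> real"
  assumes [measurable]: "f \<in> borel_measurable borel"
  shows "(\<lambda>(\<tau>, x). heat_grad \<tau> f x) \<in> borel_measurable (borel \<Otimes>\<^sub>M borel)"
proof -
  have "(\<lambda>(\<tau>, x). heat_grad \<tau> f x)
      = (\<lambda>(\<tau>, x). \<integral>y. gauss_density \<tau> y *\<^sub>R ((f (x + y) / \<tau>) *\<^sub>R y) \<partial>lborel)"
    unfolding heat_grad_def by (intro ext) (simp add: integral_gauss split_beta)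
  also have "\<dots> \<in> borel_measurable (borel \<Otimes>\<^sub>M borel)"
    by measurable
  finally show ?thesis .
qed

section \<open>Integrals over time intervals\<close>

lemma integrable_indicator_Icc:
  fixes f :: "real \<Rightarrow> 'b::{banach, second_countable_topology}"
  assumes "f \<in> borel_measurable borel" "\<And>q. q \<in> {a..b} \<Longrightarrow> norm (f q) \<le> C"
  shows "integrable lborel (\<lambda>q. indicator {a..b} q *\<^sub>R f q)"
  by (rule integrableI_bounded_set_indicator[of _ _ _ C]) (use assms in \<open>auto simp: emeasure_lborel_Icc_eq\<close>)

lemma integral_indicator_Icc_split:
  fixes f :: "real \<Rightarrow> 'b::{banach, second_countable_topology}"
  assumes f: "f \<in> borel_measurable borel" "\<And>q. q \<in> {a..c} \<Longrightarrow> norm (f q) \<le> C" and "a \<le> b" "b \<le> c"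
  shows "(\<integral>q. indicator {a..c} q *\<^sub>R f q \<partial>lborel)
    = (\<integral>q. indicator {a..b} q *\<^sub>R f q \<partial>lborel) + (\<integral>q. indicator {b..c} q *\<^sub>R f q \<partial>lborel)"
proof -
  have [measurable]: "f \<in> borel_measurable borel" by fact
  have i: "integrable lborel (\<lambda>q. indicator {a..b} q *\<^sub>R f q)" "integrable lborel (\<lambda>q. indicator {b..c} q *\<^sub>R f q)"
    using assms by (auto intro!: integrable_indicator_Icc[of _ _ _ C])
  have "(\<integral>q. indicator {a..c} q *\<^sub>R f q \<partial>lborel)
      = (\<integral>q. indicator {a..b} q *\<^sub>R f q + indicator {b..c} q *\<^sub>R f q \<partial>lborel)"
  proof (rule integral_cong_AE)
    show "AE q in lborel. indicator {a..c} q *\<^sub>R f q = indicator {a..b} q *\<^sub>R f q + indicator {b..c} q *\<^sub>R f q"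
      using AE_lborel_singleton[of b] by eventually_elim (use assms in \<open>auto simp: indicator_def\<close>)
  qed measurable
  then show ?thesis using i by simp
qed

lemma norm_integral_indicator_Icc_le:
  fixes f :: "real \<Rightarrow> 'b::{banach, second_countable_topology}"
  assumes [measurable]: "f \<in> borel_measurable borel" and "AE q in lborel. q \<in> {a..b} \<longrightarrow> norm (f q) \<le> C" "a \<le> b"
  shows "norm (\<integral>q. indicator {a..b} q *\<^sub>R f q \<partial>lborel) \<le> C * (b - a)"
proof -
  have i: "integrable lborel (\<lambda>q. indicator {a..b} q *\<^sub>R f q)"
    by (rule integrableI_bounded_set_indicator[of _ _ _ C]) (use assms in \<open>auto simp: emeasure_lborel_Icc_eq\<close>)
  have "norm (\<integral>q. indicator {a..b} q *\<^sub>R f q \<partial>lborel) \<le> (\<integral>q. norm (indicator {a..b} q *\<^sub>R f q) \<partial>lborel)"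
    by (rule integral_norm_bound)
  also have "\<dots> \<le> (\<integral>q. indicator {a..b} q * C \<partial>lborel)"
  proof (rule integral_mono_AE)
    show "AE q in lborel. norm (indicator {a..b} q *\<^sub>R f q) \<le> indicator {a..b} q * C"
      using assms(2) by eventually_elim (auto simp: indicator_def)
  qed (rule integrable_norm[OF i], auto intro!: integrable_real_indicator simp: emeasure_lborel_Icc_eq)
  also have "\<dots> = C * (b - a)" using assms(3) by (simp add: measure_lborel_Icc)
  finally show ?thesis .
qed

lemma norm_inner_le:
  fixes x y :: "'a::real_inner"
  assumes "norm x \<le> a" "norm y \<le> b"
  shows "norm (x \<bullet> y) \<le> a * b"
proof -
  have "norm x * norm y \<le> a * b"
    using assms order_trans[OF norm_ge_zero assms(1)] by (intro mult_mono) auto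
  then show ?thesis
    using Cauchy_Schwarz_ineq2[of x y] by simp
qed

lemma zero_derivative_if_superlinear:
  fixes H :: "real \<Rightarrow> real"
  assumes "s \<le> t" "\<And>r r'. s \<le> r \<Longrightarrow> r < r' \<Longrightarrow> r' \<le> t \<Longrightarrow> \<bar>H r' - H r\<bar> \<le> C * ((r' - r) * sqrt (r' - r))"
  shows "H t = H s"
proof -
  have b: "\<bar>H y - H x\<bar> \<le> C * (\<bar>y - x\<bar> * sqrt \<bar>y - x\<bar>)" if "x \<in> {s..t}" "y \<in> {s..t}" for x y
    using assms(2)[of x y] assms(2)[of y x] that by (cases x y rule: linorder_cases) (auto simp: abs_minus_commute)
  have "(H has_field_derivative 0) (at x within {s..t})" if x: "x \<in> {s..t}" for x
    unfolding has_field_derivative_iff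
  proof (rule Lim_null_comparison)
    show "\<forall>\<^sub>F y in at x within {s..t}. norm ((H y - H x) / (y - x)) \<le> C * sqrt \<bar>y - x\<bar>"
      unfolding eventually_at_filter
    proof (rule always_eventually, intro allI impI)
      fix y assume "y \<noteq> x" "y \<in> {s..t}"
      with b[OF x, of y] show "norm ((H y - H x) / (y - x)) \<le> C * sqrt \<bar>y - x\<bar>"
        by (simp add: abs_divide divide_le_eq mult_ac)
    qed
    have "((\<lambda>y. C * sqrt \<bar>y - x\<bar>) \<longlongrightarrow> C * sqrt \<bar>x - x\<bar>) (at x within {s..t})"
      by (intro tendsto_intros)
    then show "((\<lambda>y. C * sqrt \<bar>y - x\<bar>) \<longlongrightarrow> 0) (at x within {s..t})" by simp
  qed
  then have "\<exists>c. \<forall>x\<in>{s..t}. H x = c"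
    by (intro has_field_derivative_zero_constant) auto
  then show ?thesis using assms(1) by (metis atLeastAtMost_iff order_refl)
qed

text \<open>The drift is an arbitrary bounded process here; the mean-field structure comes in only
  after Duhamel's formula. The filtration is reduced to the independence of \<open>X s\<close> from
  later increments of \<open>W\<close>, and the bound on \<open>V\<close> holds everywhere, which
  keeps exceptional sets out of the Fubini arguments.\<close>

locale drifted_brownian = prob_space M for M :: "'w measure" +
  fixes X W V :: "real \<Rightarrow> 'w \<Rightarrow> real ^ 'd" and K :: real
  assumes X_measurable2 [measurable]: "(\<lambda>(q, w). X q w) \<in> borel_measurable (borel \<Otimes>\<^sub>M M)"
    and W_measurable: "\<And>t. 0 \<le> t \<Longrightarrow> W t \<in> borel_measurable M"
    and W_increment: "\<And>s t. 0 \<le> s \<Longrightarrow> s < t \<Longrightarrow> distr M borel (\<lambda>w. W t w - W s w) = gauss (t - s)"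
    and W_indep: "\<And>s t. 0 \<le> s \<Longrightarrow> s < t \<Longrightarrow> indep_var borel (X s) borel (\<lambda>w. W t w - W s w)"
    and V_measurable2 [measurable]: "(\<lambda>(q, w). V q w) \<in> borel_measurable (borel \<Otimes>\<^sub>M M)"
    and V_bound: "\<And>q w. norm (V q w) \<le> K"
    and X_eq: "AE w in M. \<forall>t\<ge>0. X t w = X 0 w + (\<integral>q. indicator {0..t} q *\<^sub>R V q w \<partial>lborel) + W t w"
begin

lemma K_nonneg: "0 \<le> K"
  using V_bound order_trans[OF norm_ge_zero] by blast

lemma X_measurable [measurable]: "X q \<in> borel_measurable M"
  using measurable_compose[OF measurable_Pair1' X_measurable2, of q] by simp

lemma V_measurable [measurable]: "V q \<in> borel_measurable M"
  using measurable_compose[OF measurable_Pair1' V_measurable2, of q] by simp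

lemma V_measurable_time: "w \<in> space M \<Longrightarrow> (\<lambda>q. V q w) \<in> borel_measurable borel"
  using measurable_compose[OF measurable_Pair2' V_measurable2, of w] by simp

lemma X_increment:
  assumes "0 \<le> s" "s \<le> t"
  shows "AE w in M. X t w = X s w + (\<integral>q. indicator {s..t} q *\<^sub>R V q w \<partial>lborel) + (W t w - W s w)"
  using X_eq AE_space
proof eventually_elim
  case (elim w)
  have "(\<integral>q. indicator {0..t} q *\<^sub>R V q w \<partial>lborel)
      = (\<integral>q. indicator {0..s} q *\<^sub>R V q w \<partial>lborel) + (\<integral>q. indicator {s..t} q *\<^sub>R V q w \<partial>lborel)"
    by (rule integral_indicator_Icc_split[of _ _ _ K]) (use V_measurable_time elim V_bound assms in auto)
  then show ?case
    using elim(1)[rule_format, of t] elim(1)[rule_format, of s] assms by simp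
qed

lemma drift_norm_le:
  assumes "s \<le> t" "w \<in> space M"
  shows "norm (\<integral>q. indicator {s..t} q *\<^sub>R V q w \<partial>lborel) \<le> K * (t - s)"
  by (rule norm_integral_indicator_Icc_le) (use assms V_measurable_time V_bound in auto)

lemma drift_measurable [measurable]:
  "(\<lambda>w. \<integral>q. indicator {s..t} q *\<^sub>R V q w \<partial>lborel) \<in> borel_measurable M"
proof -
  have [measurable]: "(\<lambda>(w, q). V q w) \<in> borel_measurable (M \<Otimes>\<^sub>M lborel)"
    using measurable_compose[OF measurable_pair_swap' V_measurable2] by (simp add: split_beta)
  show ?thesis by measurable
qed

lemma integrable_bounded:
  fixes g :: "'w \<Rightarrow> 'b::{banach, second_countable_topology}"
  assumes "g \<in> borel_measurable M" "\<And>w. w \<in> space M \<Longrightarrow> norm (g w) \<le> A"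
  shows "integrable M g"
  by (rule integrable_const_bound[of _ A]) (use assms in auto)

text \<open>By independence the pair of \<open>X s\<close> and the increment has a product law, and
  integrating out the Gaussian factor produces the heat semigroup.\<close>

lemma expectation_increment:
  fixes f :: "real ^ 'd \<Rightarrow> real"
  assumes "0 \<le> s" "s < t" and [measurable]: "f \<in> borel_measurable borel" and A: "\<And>x. \<bar>f x\<bar> \<le> A"
  shows "(\<integral>w. f (X s w + (W t w - W s w)) \<partial>M) = (\<integral>w. heat (t - s) f (X s w) \<partial>M)"
proof -
  note [measurable] = W_measurable[OF assms(1)] W_measurable[of t]
  have t: "0 \<le> t" using assms by simp
  have [measurable]: "(\<lambda>w. W t w - W s w) \<in> borel_measurable M"
    using t by measurable
  interpret g: prob_space "gauss (t - s) :: (real ^ 'd) measure"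
    using assms by (intro prob_space_gauss) simp
  interpret d: prob_space "distr M borel (X s)" by (rule prob_space_distr) measurable
  interpret P: pair_prob_space "distr M borel (X s)" "gauss (t - s) :: (real ^ 'd) measure" ..
  have "(\<integral>w. f (X s w + (W t w - W s w)) \<partial>M)
      = (\<integral>p. f (fst p + snd p) \<partial>distr M (borel \<Otimes>\<^sub>M borel) (\<lambda>w. (X s w, W t w - W s w)))"
    by (subst integral_distr) auto
  also have "distr M (borel \<Otimes>\<^sub>M borel) (\<lambda>w. (X s w, W t w - W s w)) = distr M borel (X s) \<Otimes>\<^sub>M gauss (t - s)"
    using W_indep[OF assms(1,2)] W_increment[OF assms(1,2)] by (simp add: indep_var_distribution_eq)
  also have "(\<integral>p. f (fst p + snd p) \<partial>(distr M borel (X s) \<Otimes>\<^sub>M gauss (t - s)))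
      = (\<integral>x. \<integral>y. f (x + y) \<partial>gauss (t - s) \<partial>distr M borel (X s))"
    by (subst P.integral_fst'[symmetric]) (auto intro!: P.integrable_const_bound[of _ A] simp: A)
  also have "\<dots> = (\<integral>w. heat (t - s) f (X s w) \<partial>M)"
    unfolding heat_def by (subst integral_distr) auto
  finally show ?thesis .
qed

text \<open>The value that Ito's formula predicts for the derivative in \<open>q\<close> of the
  expectation of \<open>heat (T - q) f (X q)\<close>: the second-order term cancels against the heat
  equation and the martingale part has mean zero.\<close>

definition flux :: "real \<Rightarrow> (real ^ 'd \<Rightarrow> real) \<Rightarrow> real \<Rightarrow> real" where
  "flux T f q = (\<integral>w. V q w \<bullet> heat_grad (T - q) f (X q w) \<partial>M)"

lemma flux_measurable [measurable]:
  assumes [measurable]: "f \<in> borel_measurable borel"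
  shows "flux T f \<in> borel_measurable borel"
proof -
  note [measurable] = heat_grad_measurable2[OF assms]
  have [measurable]: "(\<lambda>(q, w). heat_grad (T - q) f (X q w)) \<in> borel_measurable (borel \<Otimes>\<^sub>M M)"
    using measurable_compose[of "\<lambda>(q, w). (T - q, X q w)" "borel \<Otimes>\<^sub>M M" "borel \<Otimes>\<^sub>M borel", OF _ heat_grad_measurable2[OF assms]]
    by (simp add: split_beta)
  show ?thesis unfolding flux_def[abs_def] by measurable
qed

lemma flux_bound:
  assumes "q < T" and [measurable]: "f \<in> borel_measurable borel" and A: "\<And>x. \<bar>f x\<bar> \<le> A"
  shows "\<bar>flux T f q\<bar> \<le> K * (A * heat_const TYPE('d) / sqrt (T - q))"
proof -
  have t: "0 < T - q" using assms by simp
  note [measurable] = heat_grad_measurable[OF t assms(2)]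
  have "norm (\<integral>w. V q w \<bullet> heat_grad (T - q) f (X q w) \<partial>M) \<le> (\<integral>w. K * (A * heat_const TYPE('d) / sqrt (T - q)) \<partial>M)"
  proof (rule norm_integral_le)
    show "norm (V q w \<bullet> heat_grad (T - q) f (X q w)) \<le> K * (A * heat_const TYPE('d) / sqrt (T - q))" for w
      by (rule norm_inner_le[OF V_bound heat_grad_norm_le[OF t assms(2) A]])
  qed auto
  then show ?thesis by (simp add: flux_def prob_space)
qed

text \<open>Keeping \<open>T\<close> strictly beyond \<open>t\<close> makes the gradient bounded on
  the whole interval. The limit towards \<open>t\<close> is taken only in
  \<open>dual_regular_Suc\<close>.\<close>

lemma flux_bound_Icc:
  assumes "q \<in> {s..t}" "t < T" and f: "f \<in> borel_measurable borel" and A: "\<And>x. \<bar>f x\<bar> \<le> A"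
  shows "norm (flux T f q) \<le> K * (A * heat_const TYPE('d) / sqrt (T - t))"
proof -
  have "0 \<le> A * heat_const TYPE('d)"
    using order_trans[OF abs_ge_zero A[of 0]] heat_const_pos[where 'd='d] by simp
  then have "K * (A * heat_const TYPE('d) / sqrt (T - q)) \<le> K * (A * heat_const TYPE('d) / sqrt (T - t))"
    using assms(1,2) K_nonneg by (intro mult_left_mono divide_left_mono) auto
  then show ?thesis
    using flux_bound[of q T f A] assms by auto
qed

text \<open>From \<open>X r\<close> the position moves by the Brownian increment to \<open>Y\<close>
  and by the drift displacement \<open>D\<close> to \<open>X r'\<close>. The Brownian move is exact
  by the semigroup property. The drift move is expanded at \<open>Y\<close>: its remainder is of
  order \<open>\<delta>\<^sup>2\<close>, and replacing the first-order term by the flux costs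
  \<open>sqrt \<delta>\<close> at each time, hence \<open>\<delta> powr (3 / 2)\<close> after
  integration.\<close>

lemma duhamel_step:
  assumes "0 \<le> r" "r < r'" "r' < T"
    and f: "f \<in> borel_measurable borel" and A: "\<And>x. \<bar>f x\<bar> \<le> A"
  defines "\<tau> \<equiv> T - r'" and "\<delta> \<equiv> r' - r"
  defines "\<kappa> \<equiv> heat_const TYPE('d)"
  defines "L \<equiv> A * (2 * \<kappa>\<^sup>2 / \<tau>)"
  shows "\<bar>(\<integral>w. heat (T - r') f (X r' w) \<partial>M) - (\<integral>w. heat (T - r) f (X r w) \<partial>M)
      - (\<integral>q. indicator {r..r'} q *\<^sub>R flux T f q \<partial>lborel)\<bar>
    \<le> A * (\<kappa> * (K * \<delta>)\<^sup>2 / \<tau>) + K * (L * (K * \<delta> + \<kappa> * sqrt \<delta>) + L * (\<kappa> * sqrt \<delta>)) * \<delta>"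
proof -
  have pos: "0 < \<tau>" "0 < \<delta>" "0 \<le> r'" "0 \<le> A" "0 < \<kappa>"
    using assms(1-3) order_trans[OF abs_ge_zero A[of 0]] heat_const_pos[where 'd='d]
    by (auto simp: \<tau>_def \<delta>_def \<kappa>_def)
  have L0: "0 \<le> L" using pos by (simp add: L_def)
  note A' = A[folded real_norm_def]
  note [measurable] = f W_measurable[OF assms(1)] W_measurable[OF pos(3)]
    heat_grad_measurable[OF pos(1) f] borel_measurable_continuous_onI[OF heat_continuous[OF pos(1) f A']]
  define Y where "Y w = X r w + (W r' w - W r w)" for w
  define D where "D w = (\<integral>q. indicator {r..r'} q *\<^sub>R V q w \<partial>lborel)" for w
  define g where "g = heat_grad \<tau> f"
  have [measurable]: "Y \<in> borel_measurable M" "D \<in> borel_measurable M" "g \<in> borel_measurable borel"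
    unfolding Y_def[abs_def] D_def[abs_def] g_def by measurable
  have gL: "norm (g (x + d) - g x) \<le> L * norm d" for x d
    using heat_grad_lipschitz[OF pos(1) f A, of x d] by (simp add: g_def L_def \<kappa>_def mult_ac)
  have gB: "norm (g x) \<le> A * \<kappa> / sqrt \<tau>" for x
    using heat_grad_norm_le[OF pos(1) f A, of x] by (simp add: g_def \<kappa>_def)
  have D: "norm (D w) \<le> K * \<delta>" if "w \<in> space M" for w
    using drift_norm_le[of r r' w] that assms by (simp add: D_def \<delta>_def)

  have start: "(\<integral>w. heat (T - r) f (X r w) \<partial>M) = (\<integral>w. heat \<tau> f (Y w) \<partial>M)"
  proof -
    have "(\<integral>w. heat \<tau> f (Y w) \<partial>M) = (\<integral>w. heat (r' - r) (heat \<tau> f) (X r w) \<partial>M)"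
      unfolding Y_def by (rule expectation_increment[where A=A])
        (use assms(1,2) heat_norm_le[OF pos(1) f A'] in auto)
    also have "heat (r' - r) (heat \<tau> f) = heat (r' - r + \<tau>) f"
      using pos assms by (intro ext heat_semigroup[symmetric] f A') (auto simp: \<delta>_def)
    finally show ?thesis by (simp add: \<tau>_def)
  qed
  have "(\<integral>w. heat (T - r') f (X r' w) \<partial>M) = (\<integral>w. heat \<tau> f (Y w + D w) \<partial>M)"
    unfolding \<tau>_def[symmetric]
  proof (rule integral_cong_AE)
    show "AE w in M. heat \<tau> f (X r' w) = heat \<tau> f (Y w + D w)"
      using X_increment[of r r'] assms(1,2) by (auto simp: Y_def D_def add_ac)
  qed measurable

  have iu: "integrable M (\<lambda>w. heat \<tau> f (Z w))" if "Z \<in> borel_measurable M" for Z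
    by (rule integrable_bounded[of _ A]) (use that heat_norm_le[OF pos(1) f A'] in auto)
  have ig: "integrable M (\<lambda>w. g (Y w) \<bullet> D w)"
    by (rule integrable_bounded[OF _ norm_inner_le[OF gB D]]) measurable
  have "\<bar>(\<integral>w. heat \<tau> f (Y w + D w) \<partial>M) - (\<integral>w. heat \<tau> f (Y w) \<partial>M) - (\<integral>w. g (Y w) \<bullet> D w \<partial>M)\<bar>
      = norm (\<integral>w. heat \<tau> f (Y w + D w) - heat \<tau> f (Y w) - g (Y w) \<bullet> D w \<partial>M)"
    using iu ig by simp
  also have "\<dots> \<le> (\<integral>w. A * (\<kappa> * (K * \<delta>)\<^sup>2 / \<tau>) \<partial>M)"
  proof (rule norm_integral_le)
    fix w assume w: "w \<in> space M"
    have "norm (heat \<tau> f (Y w + D w) - heat \<tau> f (Y w) - g (Y w) \<bullet> D w) \<le> A * (\<kappa> * (norm (D w))\<^sup>2 / \<tau>)"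
      using heat_taylor[OF pos(1) f A, of "Y w" "D w"] by (simp add: g_def \<kappa>_def)
    also have "\<dots> \<le> A * (\<kappa> * (K * \<delta>)\<^sup>2 / \<tau>)"
      using pos D[OF w] by (intro mult_left_mono divide_right_mono power_mono) auto
    finally show "norm (heat \<tau> f (Y w + D w) - heat \<tau> f (Y w) - g (Y w) \<bullet> D w) \<le> A * (\<kappa> * (K * \<delta>)\<^sup>2 / \<tau>)" .
  qed auto
  finally have taylor: "\<bar>(\<integral>w. heat \<tau> f (Y w + D w) \<partial>M) - (\<integral>w. heat \<tau> f (Y w) \<partial>M) - (\<integral>w. g (Y w) \<bullet> D w \<partial>M)\<bar>
      \<le> A * (\<kappa> * (K * \<delta>)\<^sup>2 / \<tau>)" by (simp add: prob_space)

  define I where "I q = (\<integral>w. g (Y w) \<bullet> V q w \<partial>M)" for q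
  have I_meas[measurable]: "I \<in> borel_measurable borel"
    unfolding I_def[abs_def] by measurable
  have bnd: "norm (g (Y w) \<bullet> V q w) \<le> A * \<kappa> / sqrt \<tau> * K" for q w
    by (rule norm_inner_le[OF gB V_bound])
  have I_bound: "norm (I q) \<le> A * \<kappa> / sqrt \<tau> * K" for q
  proof -
    have "norm (I q) \<le> (\<integral>w. A * \<kappa> / sqrt \<tau> * K \<partial>M)"
      unfolding I_def by (rule norm_integral_le) (use bnd in auto)
    then show ?thesis by (simp add: prob_space)
  qed
  have fubini: "(\<integral>w. g (Y w) \<bullet> D w \<partial>M) = (\<integral>q. indicator {r..r'} q *\<^sub>R I q \<partial>lborel)"
  proof -
    interpret P: pair_sigma_finite lborel M ..
    have "integrable (lborel \<Otimes>\<^sub>M M) (\<lambda>p. indicator ({r..r'} \<times> space M) p *\<^sub>R (g (Y (snd p)) \<bullet> V (fst p) (snd p)))"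
    proof (rule integrableI_bounded_set_indicator)
      show "emeasure (lborel \<Otimes>\<^sub>M M) ({r..r'} \<times> space M) < \<infinity>"
        by (simp add: emeasure_pair_measure_Times emeasure_lborel_Icc_eq emeasure_space_1)
    qed (use bnd in auto)
    then have "integrable (lborel \<Otimes>\<^sub>M M) (\<lambda>(q, w). indicator {r..r'} q *\<^sub>R (g (Y w) \<bullet> V q w))"
      by (rule Bochner_Integration.integrable_cong[THEN iffD1, rotated -1])
        (auto simp: space_pair_measure indicator_def)
    from P.Fubini_integral[OF this]
    have swap: "(\<integral>w. \<integral>q. indicator {r..r'} q *\<^sub>R (g (Y w) \<bullet> V q w) \<partial>lborel \<partial>M)
        = (\<integral>q. \<integral>w. indicator {r..r'} q *\<^sub>R (g (Y w) \<bullet> V q w) \<partial>M \<partial>lborel)" by simp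
    have right: "(\<integral>q. \<integral>w. indicator {r..r'} q *\<^sub>R (g (Y w) \<bullet> V q w) \<partial>M \<partial>lborel) = (\<integral>q. indicator {r..r'} q *\<^sub>R I q \<partial>lborel)"
      unfolding I_def by simp
    have "(\<integral>w. \<integral>q. indicator {r..r'} q *\<^sub>R (g (Y w) \<bullet> V q w) \<partial>lborel \<partial>M) = (\<integral>w. g (Y w) \<bullet> D w \<partial>M)"
    proof (rule Bochner_Integration.integral_cong)
      fix w assume "w \<in> space M"
      then have "integrable lborel (\<lambda>q. indicator {r..r'} q *\<^sub>R V q w)"
        using V_measurable_time V_bound by (intro integrable_indicator_Icc[of _ _ _ K]) auto
      then show "(\<integral>q. indicator {r..r'} q *\<^sub>R (g (Y w) \<bullet> V q w) \<partial>lborel) = g (Y w) \<bullet> D w"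
        unfolding D_def by (subst integral_inner_right[symmetric]) auto
    qed simp
    then show ?thesis using swap right by simp
  qed

  \<comment> \<open>Two replacements lead from \<open>I q\<close> to the flux: \<open>Y\<close> by
    \<open>X q\<close>, which differ by a drift of size at most \<open>K * \<delta>\<close> and the
    Brownian increment from \<open>q\<close> to \<open>r'\<close>, and \<open>g\<close> by
    \<open>heat (r' - q) g\<close>. Both cost the Lipschitz constant \<open>L\<close> of
    \<open>g\<close>. The comparison is pathwise, as \<open>V q\<close> and \<open>Y\<close> may be
    correlated.\<close>
  have close: "\<bar>I q - flux T f q\<bar> \<le> K * (L * (K * \<delta> + \<kappa> * sqrt \<delta>) + L * (\<kappa> * sqrt \<delta>))"
    if q: "r < q" "q < r'" for q
  proof -
    have q0: "0 \<le> q" "0 < r' - q" "r' - q \<le> \<delta>" "q - r \<le> \<delta>" using q assms(1) by (auto simp: \<delta>_def)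
    note [measurable] = W_measurable[OF q0(1)]
    have hg: "heat_grad (T - q) f x = heat (r' - q) g x" for x
      using heat_grad_semigroup[OF q0(2) pos(1) f A, of x] by (simp add: \<tau>_def g_def)
    have [measurable]: "heat (r' - q) g \<in> borel_measurable borel"
      by (rule borel_measurable_continuous_onI[OF heat_continuous[OF q0(2) _ gB]]) measurable
    have hd: "norm (heat (r' - q) g x - g x) \<le> L * (\<kappa> * sqrt \<delta>)" for x
    proof -
      have "norm (heat (r' - q) g x - g x) \<le> 0 + L * (\<kappa> * sqrt (r' - q))"
        unfolding \<kappa>_def by (rule heat_diff_le[OF q0(2) _ gB]) (use gL L0 in auto)
      also have "\<dots> \<le> L * (\<kappa> * sqrt \<delta>)"
        using L0 pos q0 by (auto intro!: mult_left_mono)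
      finally show ?thesis .
    qed
    have iW: "integrable M (\<lambda>w. norm (W r' w - W q w))"
      and eW: "(\<integral>w. norm (W r' w - W q w) \<partial>M) \<le> \<kappa> * sqrt \<delta>"
    proof -
      have "integrable (distr M borel (\<lambda>w. W r' w - W q w)) norm"
        using W_increment[OF q0(1) q(2)] gauss_norm_integrable[OF q0(2), where 'd='d] by simp
      then show "integrable M (\<lambda>w. norm (W r' w - W q w))"
        by (subst (asm) integrable_distr_eq) auto
      have "(\<integral>w. norm (W r' w - W q w) \<partial>M) = (\<integral>y. norm y \<partial>distr M borel (\<lambda>w. W r' w - W q w))"
        by (subst integral_distr) auto
      also have "\<dots> \<le> \<kappa> * sqrt (r' - q)"
        using W_increment[OF q0(1) q(2)] gauss_norm_le[OF q0(2), where 'd='d] by (simp add: \<kappa>_def)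
      also have "\<dots> \<le> \<kappa> * sqrt \<delta>" using pos q0 by (auto intro!: mult_left_mono)
      finally show "(\<integral>w. norm (W r' w - W q w) \<partial>M) \<le> \<kappa> * sqrt \<delta>" .
    qed
    have iV: "integrable M (\<lambda>w. V q w \<bullet> heat (r' - q) g (X q w))"
      by (rule integrable_bounded[OF _ norm_inner_le[OF V_bound heat_norm_le[OF q0(2) _ gB]]]) measurable
    have ig': "integrable M (\<lambda>w. g (Y w) \<bullet> V q w)"
      by (rule integrable_bounded[OF _ bnd]) measurable
    have "I q - flux T f q = (\<integral>w. g (Y w) \<bullet> V q w - V q w \<bullet> heat (r' - q) g (X q w) \<partial>M)"
      unfolding I_def flux_def hg using iV ig' by simp
    also have "norm \<dots> \<le> (\<integral>w. norm (g (Y w) \<bullet> V q w - V q w \<bullet> heat (r' - q) g (X q w)) \<partial>M)"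
      by (rule integral_norm_bound)
    also have "\<dots> \<le> (\<integral>w. K * (L * (K * \<delta> + norm (W r' w - W q w)) + L * (\<kappa> * sqrt \<delta>)) \<partial>M)"
    proof (rule integral_mono_AE)
      show "AE w in M. norm (g (Y w) \<bullet> V q w - V q w \<bullet> heat (r' - q) g (X q w))
          \<le> K * (L * (K * \<delta> + norm (W r' w - W q w)) + L * (\<kappa> * sqrt \<delta>))"
        using X_increment[OF assms(1) less_imp_le[OF q(1)]] AE_space
      proof eventually_elim
        case (elim w)
        let ?B = "\<integral>q'. indicator {r..q} q' *\<^sub>R V q' w \<partial>lborel"
        have "norm ?B \<le> K * (q - r)" using drift_norm_le[of r q w] elim q by simp
        also have "\<dots> \<le> K * \<delta>" using q0 K_nonneg by (simp add: mult_left_mono)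
        finally have B: "norm ?B \<le> K * \<delta>" .
        have "Y w = X q w + ((W r' w - W q w) - ?B)"
          using elim(1) by (simp add: Y_def)
        then have "norm (g (Y w) - g (X q w)) \<le> L * norm ((W r' w - W q w) - ?B)"
          using gL[of "X q w" "(W r' w - W q w) - ?B"] by simp
        also have "\<dots> \<le> L * (K * \<delta> + norm (W r' w - W q w))"
          using norm_triangle_ineq4[of "W r' w - W q w" ?B] B L0 by (intro mult_left_mono) auto
        finally have "norm (g (Y w) - heat (r' - q) g (X q w))
            \<le> L * (K * \<delta> + norm (W r' w - W q w)) + L * (\<kappa> * sqrt \<delta>)"
          using norm_triangle_ineq[of "g (Y w) - g (X q w)" "g (X q w) - heat (r' - q) g (X q w)"] hd[of "X q w"]
          by (simp add: norm_minus_commute)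
        then have "norm (V q w) * norm (g (Y w) - heat (r' - q) g (X q w))
            \<le> K * (L * (K * \<delta> + norm (W r' w - W q w)) + L * (\<kappa> * sqrt \<delta>))"
          using V_bound K_nonneg by (intro mult_mono) auto
        moreover have "g (Y w) \<bullet> V q w - V q w \<bullet> heat (r' - q) g (X q w) = V q w \<bullet> (g (Y w) - heat (r' - q) g (X q w))"
          by (simp add: inner_diff_right inner_commute)
        ultimately show ?case
          using Cauchy_Schwarz_ineq2[of "V q w" "g (Y w) - heat (r' - q) g (X q w)"] by simp
      qed
    qed (use iV ig' iW in auto)
    also have "\<dots> = K * (L * (K * \<delta> + (\<integral>w. norm (W r' w - W q w) \<partial>M)) + L * (\<kappa> * sqrt \<delta>))"
      using iW by (simp add: prob_space)
    also have "\<dots> \<le> K * (L * (K * \<delta> + \<kappa> * sqrt \<delta>) + L * (\<kappa> * sqrt \<delta>))"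
      using eW K_nonneg L0 by (intro mult_left_mono add_right_mono add_left_mono) auto
    finally show ?thesis by simp
  qed

  have i1: "integrable lborel (\<lambda>q. indicator {r..r'} q *\<^sub>R flux T f q)"
    by (rule integrable_indicator_Icc[OF _ flux_bound_Icc[OF _ assms(3) f A]]) (auto simp: f)
  have i2: "integrable lborel (\<lambda>q. indicator {r..r'} q *\<^sub>R I q)"
    by (rule integrable_indicator_Icc[OF _ I_bound]) auto
  have "(\<integral>q. indicator {r..r'} q *\<^sub>R I q \<partial>lborel) - (\<integral>q. indicator {r..r'} q *\<^sub>R flux T f q \<partial>lborel)
      = (\<integral>q. indicator {r..r'} q *\<^sub>R (I q - flux T f q) \<partial>lborel)"
    using i1 i2 by (simp add: right_diff_distrib)
  also have "norm \<dots> \<le> K * (L * (K * \<delta> + \<kappa> * sqrt \<delta>) + L * (\<kappa> * sqrt \<delta>)) * (r' - r)"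
  proof (rule norm_integral_indicator_Icc_le)
    show "AE q in lborel. q \<in> {r..r'} \<longrightarrow> norm (I q - flux T f q) \<le> K * (L * (K * \<delta> + \<kappa> * sqrt \<delta>) + L * (\<kappa> * sqrt \<delta>))"
      using AE_lborel_singleton[of r] AE_lborel_singleton[of r']
      by eventually_elim (use close in auto)
  qed (use assms(2) f in auto)
  finally have "\<bar>(\<integral>q. indicator {r..r'} q *\<^sub>R I q \<partial>lborel) - (\<integral>q. indicator {r..r'} q *\<^sub>R flux T f q \<partial>lborel)\<bar>
      \<le> K * (L * (K * \<delta> + \<kappa> * sqrt \<delta>) + L * (\<kappa> * sqrt \<delta>)) * \<delta>"
    by (simp add: \<delta>_def)
  then show ?thesis
    using taylor \<open>(\<integral>w. heat (T - r') f (X r' w) \<partial>M) = _\<close> start fubini by linarith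
qed

theorem duhamel:
  assumes "0 \<le> s" "s \<le> t" "t < T"
    and f: "f \<in> borel_measurable borel" and A: "\<And>x. \<bar>f x\<bar> \<le> A"
  shows "(\<integral>w. heat (T - t) f (X t w) \<partial>M)
    = (\<integral>w. heat (T - s) f (X s w) \<partial>M) + (\<integral>q. indicator {s..t} q *\<^sub>R flux T f q \<partial>lborel)"
proof -
  define \<kappa> where "\<kappa> = heat_const TYPE('d)"
  define H where "H r = (\<integral>w. heat (T - r) f (X r w) \<partial>M) - (\<integral>q. indicator {s..r} q *\<^sub>R flux T f q \<partial>lborel)" for r
  define L where "L = A * (2 * \<kappa>\<^sup>2 / (T - t))"
  \<comment> \<open>From \<open>duhamel_step\<close>, with \<open>T - r'\<close> replaced by its
    lower bound \<open>T - t\<close>. Where a power of \<delta> is to spare, one factor \<delta> is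
    replaced by \<open>sqrt t * sqrt \<delta>\<close>.\<close>
  define C where "C = A * (\<kappa> * K\<^sup>2 / (T - t)) * sqrt t + K * (L * (K * sqrt t + \<kappa>) + L * \<kappa>)"
  have pos: "0 < T - t" "0 \<le> A" "0 < \<kappa>" "0 \<le> K"
    using assms(3) order_trans[OF abs_ge_zero A[of 0]] heat_const_pos[where 'd='d] K_nonneg
    by (auto simp: \<kappa>_def)
  have "H t = H s"
  proof (rule zero_derivative_if_superlinear[OF assms(2)])
    fix r r' assume r: "s \<le> r" "r < r'" "r' \<le> t"
    define \<delta> where "\<delta> = r' - r"
    have \<delta>: "0 < \<delta>" "\<delta> \<le> t" using r assms(1) by (auto simp: \<delta>_def)
    have "(\<integral>q. indicator {s..r'} q *\<^sub>R flux T f q \<partial>lborel)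
        = (\<integral>q. indicator {s..r} q *\<^sub>R flux T f q \<partial>lborel) + (\<integral>q. indicator {r..r'} q *\<^sub>R flux T f q \<partial>lborel)"
      by (rule integral_indicator_Icc_split[OF _ flux_bound_Icc[OF _ _ f A]]) (use r f assms(3) in auto)
    then have "\<bar>H r' - H r\<bar> = \<bar>(\<integral>w. heat (T - r') f (X r' w) \<partial>M) - (\<integral>w. heat (T - r) f (X r w) \<partial>M)
      - (\<integral>q. indicator {r..r'} q *\<^sub>R flux T f q \<partial>lborel)\<bar>"
      by (simp add: H_def)
    also have "\<dots> \<le> A * (\<kappa> * (K * \<delta>)\<^sup>2 / (T - r'))
        + K * (A * (2 * \<kappa>\<^sup>2 / (T - r')) * (K * \<delta> + \<kappa> * sqrt \<delta>) + A * (2 * \<kappa>\<^sup>2 / (T - r')) * (\<kappa> * sqrt \<delta>)) * \<delta>"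
      unfolding \<kappa>_def \<delta>_def by (rule duhamel_step) (use r assms f A in auto)
    also have "\<dots> \<le> A * (\<kappa> * (K * \<delta>)\<^sup>2 / (T - t)) + K * (L * (K * \<delta> + \<kappa> * sqrt \<delta>) + L * (\<kappa> * sqrt \<delta>)) * \<delta>"
    proof -
      let ?L = "A * (2 * \<kappa>\<^sup>2 / (T - r'))" and ?u = "K * \<delta> + \<kappa> * sqrt \<delta>" and ?v = "\<kappa> * sqrt \<delta>"
      have 1: "A * (\<kappa> * (K * \<delta>)\<^sup>2 / (T - r')) \<le> A * (\<kappa> * (K * \<delta>)\<^sup>2 / (T - t))"
        by (rule mult_left_mono[OF divide_left_mono]) (use pos r in auto)
      have "?L \<le> L"
        unfolding L_def by (rule mult_left_mono[OF divide_left_mono]) (use pos r in auto)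
      moreover have "0 \<le> ?u" "0 \<le> ?v" using pos \<delta> by auto
      ultimately have "?L * ?u + ?L * ?v \<le> L * ?u + L * ?v"
        by (intro add_mono mult_right_mono)
      then have "K * (?L * ?u + ?L * ?v) * \<delta> \<le> K * (L * ?u + L * ?v) * \<delta>"
        using pos \<delta> by (intro mult_right_mono[OF mult_left_mono]) auto
      with 1 show ?thesis by linarith
    qed
    also have "\<dots> \<le> C * (\<delta> * sqrt \<delta>)"
    proof -
      have s: "sqrt \<delta> * sqrt \<delta> = \<delta>" "sqrt \<delta> \<le> sqrt t" "0 \<le> sqrt \<delta>" using \<delta> by auto
      have le: "\<delta> \<le> sqrt t * sqrt \<delta>" using mult_right_mono[OF s(2,3)] s(1) by simp
      have L: "0 \<le> L" using pos by (simp add: L_def)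
      have "A * (\<kappa> * (K * \<delta>)\<^sup>2 / (T - t)) = A * (\<kappa> * K\<^sup>2 / (T - t)) * \<delta> * \<delta>"
        by (simp add: power2_eq_square)
      also have "\<dots> \<le> A * (\<kappa> * K\<^sup>2 / (T - t)) * (sqrt t * sqrt \<delta>) * \<delta>"
        using pos \<delta> le by (intro mult_right_mono mult_left_mono) auto
      finally have a: "A * (\<kappa> * (K * \<delta>)\<^sup>2 / (T - t)) \<le> A * (\<kappa> * K\<^sup>2 / (T - t)) * (sqrt t * sqrt \<delta>) * \<delta>" .
      have "K * (L * (K * \<delta> + \<kappa> * sqrt \<delta>) + L * (\<kappa> * sqrt \<delta>)) * \<delta>
          \<le> K * (L * (K * (sqrt t * sqrt \<delta>) + \<kappa> * sqrt \<delta>) + L * (\<kappa> * sqrt \<delta>)) * \<delta>"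
        using pos \<delta> le L by (intro mult_right_mono mult_left_mono add_right_mono) auto
      also have "\<dots> = K * (L * (K * sqrt t + \<kappa>) + L * \<kappa>) * (\<delta> * sqrt \<delta>)"
        by (simp add: algebra_simps)
      finally show ?thesis using a by (simp add: C_def algebra_simps)
    qed
    finally show "\<bar>H r' - H r\<bar> \<le> C * ((r' - r) * sqrt (r' - r))" by (simp add: \<delta>_def)
  qed
  moreover have "(\<integral>q. indicator {s..s} q *\<^sub>R flux T f q \<partial>lborel) = 0"
    using AE_lborel_singleton[of s] by (intro integral_eq_zero_AE) auto
  ultimately show ?thesis by (simp add: H_def)
qed

end

section \<open>Iterated differences\<close>

definition fdiff :: "'a::real_normed_vector \<Rightarrow> ('a \<Rightarrow> 'b::real_normed_vector) \<Rightarrow> 'a \<Rightarrow> 'b" where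
  "fdiff h f = (\<lambda>x. f (x + h) - f x)"

lemma fdiff_apply: "fdiff h f x = f (x + h) - f x"
  by (simp add: fdiff_def)

lemma funpow_Suc_fdiff: "(fdiff h ^^ Suc m) f = (fdiff h ^^ m) (fdiff h f)"
  by (simp add: funpow_swap1)

lemma norm_fdiff_le:
  assumes "\<And>x. norm (f x) \<le> A"
  shows "norm ((fdiff h ^^ m) f x) \<le> 2 ^ m * A"
  using assms
proof (induction m arbitrary: f A)
  case (Suc m)
  have "norm (fdiff h f x) \<le> 2 * A" for x
    using norm_triangle_ineq4[of "f (x + h)" "f x"] Suc.prems[of x] Suc.prems[of "x + h"]
    by (simp add: fdiff_apply)
  from Suc.IH[OF this] show ?case
    by (simp add: funpow_Suc_fdiff mult_ac del: funpow.simps)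
qed simp

lemma continuous_fdiff:
  assumes "continuous_on UNIV f"
  shows "continuous_on UNIV ((fdiff h ^^ m) f)"
  using assms
proof (induction m arbitrary: f)
  case (Suc m)
  have "continuous_on UNIV (fdiff h f)"
    unfolding fdiff_def
    by (intro continuous_intros continuous_on_compose2[OF Suc.prems] Suc.prems) auto
  from Suc.IH[OF this] show ?case
    by (simp add: funpow_Suc_fdiff del: funpow.simps)
qed simp

lemma fdiff_translate: "(fdiff h ^^ m) (\<lambda>x. f (x + c)) = (\<lambda>x. (fdiff h ^^ m) f (x + c))"
  by (induction m) (auto simp: fdiff_apply add_ac)

text \<open>The origin of the steps \<open>- h\<close> below: a difference with step
  \<open>h\<close> in the integration variable of a convolution is a difference with step
  \<open>- h\<close> of the reflected factor.\<close>

lemma fdiff_reflect: "(fdiff h ^^ m) (\<lambda>y. f (x - y)) = (\<lambda>y. (fdiff (- h) ^^ m) f (x - y))"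
  by (induction m) (auto simp: fdiff_apply algebra_simps)

lemma fdiff_inner_const: "(fdiff h ^^ m) (\<lambda>y. v \<bullet> f y) = (\<lambda>y. v \<bullet> (fdiff h ^^ m) f y)"
  by (induction m) (auto simp: fdiff_apply inner_diff_right)

lemma fdiff_add: "(fdiff h ^^ m) (\<lambda>y. f y + g y) = (\<lambda>y. (fdiff h ^^ m) f y + (fdiff h ^^ m) g y)"
  by (induction m) (auto simp: fdiff_apply)

text \<open>Discrete integration by parts: the difference on \<open>g\<close> becomes a difference
  of a whole product, to be absorbed by the law, and a difference of \<open>B\<close>. The extra
  shift of \<open>B\<close> leaves all sup bounds unchanged.\<close>

lemma inner_fdiff:
  "(\<lambda>x. B x \<bullet> fdiff h g x) = (\<lambda>x. fdiff h (\<lambda>x. B (x + - h) \<bullet> g x) x + fdiff (- h) B x \<bullet> g x)"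
  by (auto simp: fdiff_apply algebra_simps inner_diff_left inner_diff_right)

lemma heat_fdiff:
  fixes f :: "real ^ 'd \<Rightarrow> 'b::{banach, second_countable_topology}"
  assumes "0 < \<tau>" and c: "continuous_on UNIV f" and A: "\<And>x. norm (f x) \<le> A"
  shows "heat \<tau> ((fdiff h ^^ m) f) = (fdiff h ^^ m) (heat \<tau> f)"
proof (induction m)
  case (Suc m)
  define F where "F = (fdiff h ^^ m) f"
  have F: "continuous_on UNIV F" "\<And>x. norm (F x) \<le> 2 ^ m * A"
    using continuous_fdiff[OF c] norm_fdiff_le[of f A] A by (auto simp: F_def)
  have [measurable]: "F \<in> borel_measurable borel"
    by (rule borel_measurable_continuous_onI) fact
  have i: "integrable (gauss \<tau>) (\<lambda>y. F (x + y))" for x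
    by (rule gauss_integrable_bounded[OF assms(1) _ F(2)]) measurable
  have "heat \<tau> (fdiff h F) = fdiff h (heat \<tau> F)"
  proof
    fix x
    show "heat \<tau> (fdiff h F) x = fdiff h (heat \<tau> F) x"
      using i[of x] i[of "x + h"] by (simp add: heat_def fdiff_apply add_ac)
  qed
  then show ?case using Suc by (simp add: F_def)
qed simp

lemma heat_grad_fdiff:
  fixes f :: "real ^ 'd \<Rightarrow> real"
  assumes "0 < \<tau>" and c: "continuous_on UNIV f" and A: "\<And>x. \<bar>f x\<bar> \<le> A"
  shows "heat_grad \<tau> ((fdiff h ^^ m) f) = (fdiff h ^^ m) (heat_grad \<tau> f)"
proof (induction m)
  case (Suc m)
  define F where "F = (fdiff h ^^ m) f"
  have F: "continuous_on UNIV F" "\<And>x. \<bar>F x\<bar> \<le> 2 ^ m * A"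
    using continuous_fdiff[OF c] norm_fdiff_le[of f A] A by (auto simp: F_def)
  have i: "integrable (gauss \<tau>) (\<lambda>y. (F (x + y) / \<tau>) *\<^sub>R y)" for x
    by (rule heat_grad_integrable[OF assms(1) borel_measurable_continuous_onI[OF F(1)] F(2)])
  have "heat_grad \<tau> (fdiff h F) = fdiff h (heat_grad \<tau> F)"
  proof
    fix x
    show "heat_grad \<tau> (fdiff h F) x = fdiff h (heat_grad \<tau> F) x"
      using i[of x] i[of "x + h"]
      by (simp add: heat_grad_def fdiff_apply add_ac diff_divide_distrib scaleR_diff_left)
  qed
  then show ?case using Suc by (simp add: F_def)
qed simp

text \<open>The square of the norm is at most the product of two bounds: the triangle inequality
  gives order \<open>1 / sqrt \<tau>\<close>, the Lipschitz estimate gives order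
  \<open>norm h / \<tau>\<close>.\<close>

lemma fdiff_heat_grad_le:
  fixes f :: "real ^ 'd \<Rightarrow> real"
  assumes "0 < \<tau>" and f: "f \<in> borel_measurable borel" and A: "\<And>x. \<bar>f x\<bar> \<le> A"
  shows "norm (fdiff h (heat_grad \<tau> f) x)
    \<le> 2 * A * (heat_const TYPE('d))\<^sup>2 * (sqrt (norm h) * \<tau> powr (- 3 / 4))"
proof -
  define \<kappa> where "\<kappa> = heat_const TYPE('d)"
  define n where "n = norm (fdiff h (heat_grad \<tau> f) x)"
  \<comment> \<open>This allows \<open>\<kappa>\<^sup>2\<close> in place of \<kappa>, so that the
    two bounds share one constant.\<close>
  have \<kappa>: "1 \<le> \<kappa>"
  proof -
    have "(1::real) \<le> exp 2" by simp
    then show ?thesis unfolding \<kappa>_def using heat_const_ge[where 'd='d] by linarith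
  qed
  have "0 \<le> A" using A[of 0] by linarith
  have "n \<le> A * \<kappa> / sqrt \<tau> + A * \<kappa> / sqrt \<tau>"
    unfolding n_def \<kappa>_def fdiff_apply
    by (rule order_trans[OF norm_triangle_ineq4 add_mono]) (rule heat_grad_norm_le[OF assms])+
  also have "\<dots> \<le> 2 * A * \<kappa>\<^sup>2 / sqrt \<tau>"
    using \<kappa> \<open>0 \<le> A\<close> assms(1) by (auto simp: power2_eq_square intro!: divide_right_mono mult_left_mono)
  finally have 1: "n \<le> 2 * A * \<kappa>\<^sup>2 / sqrt \<tau>" .
  have 2: "n \<le> 2 * A * \<kappa>\<^sup>2 * norm h / \<tau>"
    using heat_grad_lipschitz[OF assms, of x h] by (simp add: n_def fdiff_apply \<kappa>_def mult_ac)
  have n0: "0 \<le> n" by (simp add: n_def)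
  have "n\<^sup>2 \<le> (2 * A * \<kappa>\<^sup>2 / sqrt \<tau>) * (2 * A * \<kappa>\<^sup>2 * norm h / \<tau>)"
    unfolding power2_eq_square[of n] using 1 2 n0 by (intro mult_mono) auto
  also have "\<dots> = (2 * A * \<kappa>\<^sup>2 * (sqrt (norm h) * \<tau> powr (- 3 / 4)))\<^sup>2"
  proof -
    have "(\<tau> powr (- 3 / 4))\<^sup>2 = \<tau> powr (- (3 / 2))"
      by (simp add: power2_eq_square powr_add[symmetric])
    also have "\<dots> = inverse (\<tau> powr (1 / 2 + 1))"
      by (simp add: powr_minus)
    also have "\<dots> = 1 / (sqrt \<tau> * \<tau>)"
      using assms(1) by (simp only: powr_add powr_half_sqrt[OF less_imp_le[OF assms(1)]]
          powr_one_gt_zero_iff[THEN iffD2, OF less_imp_le[OF assms(1)]] inverse_eq_divide)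
    finally have "(\<tau> powr (- 3 / 4))\<^sup>2 = 1 / (sqrt \<tau> * \<tau>)" .
    then show ?thesis by (simp only: power_mult_distrib) (simp add: power2_eq_square)
  qed
  finally have "n \<le> 2 * A * \<kappa>\<^sup>2 * (sqrt (norm h) * \<tau> powr (- 3 / 4))"
    by (rule power2_le_imp_le) (use \<open>0 \<le> A\<close> in auto)
  then show ?thesis by (simp add: n_def \<kappa>_def)
qed

text \<open>The antiderivative is \<open>- 4 * (T - q) powr (1 / 4)\<close>. The bound does not blow
  up when \<open>T\<close> decreases to \<open>t\<close>, because the singularity has an exponent
  above - 1.\<close>

lemma integral_powr_Icc:
  fixes s t T :: real
  assumes "s \<le> t" "t < T"
  shows "integrable lborel (\<lambda>q. indicator {s..t} q *\<^sub>R (T - q) powr (- 3 / 4))"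
    and "(\<integral>q. indicator {s..t} q *\<^sub>R (T - q) powr (- 3 / 4) \<partial>lborel) \<le> 4 * (T - s) powr (1 / 4)"
proof -
  let ?F = "\<lambda>q. - 4 * (T - q) powr (1 / 4)"
  have "((\<lambda>q. - 4 * (T - q) powr (1 / 4)) has_vector_derivative (T - q) powr (- 3 / 4)) (at q within {s..t})"
    if "s \<le> q" "q \<le> t" for q
    unfolding has_real_derivative_iff_has_vector_derivative[symmetric]
    using that assms by (auto intro!: derivative_eq_intros simp: powr_diff field_simps powr_minus)
  moreover have "continuous_on {s..t} (\<lambda>q. (T - q) powr (- 3 / 4))"
    using assms by (auto intro!: continuous_intros)
  ultimately have "has_bochner_integral lborel (\<lambda>q. indicator {s..t} q *\<^sub>R (T - q) powr (- 3 / 4)) (?F t - ?F s)"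
    by (intro has_bochner_integral_FTC_Icc[OF assms(1)]) auto
  then show "integrable lborel (\<lambda>q. indicator {s..t} q *\<^sub>R (T - q) powr (- 3 / 4))"
    and "(\<integral>q. indicator {s..t} q *\<^sub>R (T - q) powr (- 3 / 4) \<partial>lborel) \<le> 4 * (T - s) powr (1 / 4)"
    by (auto simp: has_bochner_integral_iff)
qed

text \<open>The law of \<open>Y\<close> has \<open>m / 2\<close> bounded derivatives in the direction of \<open>h\<close>, in a dual sense:
  every difference gains a factor \<open>sqrt (norm h)\<close> against the sup norm of the test function.\<close>

definition (in prob_space) dual_regular :: "('a \<Rightarrow> real ^ 'd) \<Rightarrow> nat \<Rightarrow> real \<Rightarrow> real ^ 'd \<Rightarrow> bool" where
  "dual_regular Y m C h \<longleftrightarrow> (\<forall>j\<le>m. \<forall>f A. continuous_on UNIV f \<longrightarrow> (\<forall>x. \<bar>f x\<bar> \<le> A) \<longrightarrow>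
     \<bar>\<integral>w. (fdiff h ^^ j) f (Y w) \<partial>M\<bar> \<le> C * A * sqrt (norm h) ^ j)"

context prob_space
begin

lemma dual_regularD:
  assumes "dual_regular Y m C h" "j \<le> m" "continuous_on UNIV f" "\<And>x. \<bar>f x\<bar> \<le> A"
  shows "\<bar>\<integral>w. (fdiff h ^^ j) f (Y w) \<partial>M\<bar> \<le> C * A * sqrt (norm h) ^ j"
  using assms unfolding dual_regular_def by blast

lemma integrable_comp_bounded:
  fixes f :: "real ^ 'd \<Rightarrow> 'b::{banach, second_countable_topology}"
  assumes "Y \<in> borel_measurable M" "continuous_on UNIV f" "\<And>x. norm (f x) \<le> A"
  shows "integrable M (\<lambda>w. f (Y w))"
  by (rule integrable_const_bound[of _ A])
    (use assms measurable_compose[OF assms(1) borel_measurable_continuous_onI[OF assms(2)]] in auto)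

text \<open>Here \<open>j\<close> counts the differences already moved onto \<open>B\<close>,
  \<open>n\<close> those in front of the product and \<open>m\<close> those still on
  \<open>g\<close>. Each use of \<open>inner_fdiff\<close> takes one difference off \<open>g\<close>
  and yields two terms, one raising \<open>n\<close> and one raising \<open>j\<close>. The total
  \<open>j + n + m\<close>, and with it the power of \<open>sqrt (norm h)\<close>, is preserved; the
  doubling of terms gives \<open>2 ^ m\<close>.\<close>

lemma dual_regular_product:
  fixes g :: "real ^ 'd \<Rightarrow> real ^ 'd"
  assumes reg: "dual_regular Y N C h" and Y: "Y \<in> borel_measurable M"
    and g: "continuous_on UNIV g" "\<And>x. norm (g x) \<le> G"
    and B: "continuous_on UNIV B"
      "\<And>i x. j + i \<le> N \<Longrightarrow> norm ((fdiff (- h) ^^ i) B x) \<le> D * sqrt (norm h) ^ (j + i)"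
    and "n + m \<le> N" "j + m \<le> N"
  shows "\<bar>\<integral>w. (fdiff h ^^ n) (\<lambda>x. B x \<bullet> (fdiff h ^^ m) g x) (Y w) \<partial>M\<bar>
    \<le> 2 ^ m * (C * (D * G)) * sqrt (norm h) ^ (j + n + m)"
  using B assms(7,8)
proof (induction m arbitrary: j n B)
  case 0
  let ?\<eta> = "sqrt (norm h)"
  have Bb: "norm (B x) \<le> D * ?\<eta> ^ j" for x using "0.prems"(2)[of 0] "0.prems"(4) by simp
  have "\<bar>\<integral>w. (fdiff h ^^ n) (\<lambda>x. B x \<bullet> g x) (Y w) \<partial>M\<bar> \<le> C * (D * ?\<eta> ^ j * G) * ?\<eta> ^ n"
    by (rule dual_regularD[OF reg])
      (use "0.prems" g norm_inner_le[OF Bb g(2)] in \<open>auto intro!: continuous_intros\<close>)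
  then show ?case by (simp add: power_add mult_ac)
next
  case (Suc m)
  let ?\<eta> = "sqrt (norm h)" and ?g = "(fdiff h ^^ m) g"
  have gc: "continuous_on UNIV ?g" "\<And>x. norm (?g x) \<le> 2 ^ m * G"
    using continuous_fdiff[OF g(1)] norm_fdiff_le[OF g(2)] by auto
  have Bb: "norm (B x) \<le> D * ?\<eta> ^ j" for x using Suc.prems(2)[of 0] Suc.prems(4) by simp
  have Bs: "continuous_on UNIV (\<lambda>x. B (x + - h))"
    by (rule continuous_on_compose2[OF Suc.prems(1)]) (auto intro!: continuous_intros)
  have Bd: "continuous_on UNIV (fdiff (- h) B)"
    using continuous_fdiff[OF Suc.prems(1), of 1 "- h"] by simp
  define F1 where "F1 = (fdiff h ^^ Suc n) (\<lambda>x. B (x + - h) \<bullet> ?g x)"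
  define F2 where "F2 = (fdiff h ^^ n) (\<lambda>x. fdiff (- h) B x \<bullet> ?g x)"
  have c1: "continuous_on UNIV F1" "continuous_on UNIV F2"
    unfolding F1_def F2_def by (intro continuous_fdiff continuous_intros Bs Bd gc)+
  have Bdb: "norm (fdiff (- h) B x) \<le> D * ?\<eta> ^ (j + 1)" for x
    using Suc.prems(2)[of 1 x] Suc.prems(4) by simp
  have b1: "norm (F1 x) \<le> 2 ^ Suc n * (D * ?\<eta> ^ j * (2 ^ m * G))" for x
    unfolding F1_def by (rule norm_fdiff_le) (rule norm_inner_le[OF Bb gc(2)])
  have b2: "norm (F2 x) \<le> 2 ^ n * (D * ?\<eta> ^ (j + 1) * (2 ^ m * G))" for x
    unfolding F2_def by (rule norm_fdiff_le) (rule norm_inner_le[OF Bdb gc(2)])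
  have "(fdiff h ^^ n) (\<lambda>x. B x \<bullet> (fdiff h ^^ Suc m) g x) = (\<lambda>x. F1 x + F2 x)"
    unfolding F1_def F2_def funpow_Suc_fdiff[of n h] fdiff_add[symmetric]
    by (simp add: inner_fdiff)
  then have "(\<integral>w. (fdiff h ^^ n) (\<lambda>x. B x \<bullet> (fdiff h ^^ Suc m) g x) (Y w) \<partial>M)
      = (\<integral>w. F1 (Y w) \<partial>M) + (\<integral>w. F2 (Y w) \<partial>M)"
    using integrable_comp_bounded[OF Y c1(1) b1] integrable_comp_bounded[OF Y c1(2) b2] by simp
  moreover have "\<bar>\<integral>w. F1 (Y w) \<partial>M\<bar> \<le> 2 ^ m * (C * (D * G)) * ?\<eta> ^ (j + Suc n + m)"
    unfolding F1_def
    by (rule Suc.IH[OF Bs]) (use Suc.prems in \<open>auto simp: fdiff_translate[where f=B and c="- h", simplified]\<close>)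
  moreover have "\<bar>\<integral>w. F2 (Y w) \<partial>M\<bar> \<le> 2 ^ m * (C * (D * G)) * ?\<eta> ^ (Suc j + n + m)"
    unfolding F2_def
  proof (rule Suc.IH[OF Bd])
    fix i x assume "Suc j + i \<le> N"
    then show "norm ((fdiff (- h) ^^ i) (fdiff (- h) B) x) \<le> D * ?\<eta> ^ (Suc j + i)"
      using Suc.prems(2)[of "Suc i" x] by (simp add: funpow_swap1)
  qed (use Suc.prems in auto)
  ultimately show ?case
    by (simp del: funpow.simps)
qed

end

section \<open>Regularity of the law in the dual sense\<close>

text \<open>The representation of the drift is asked for almost every time only; this suffices
  because the flux enters through a time integral. The same \<open>K\<close> bounds \<open>b\<close>
  and \<open>V\<close>.\<close>

locale mean_field_brownian = drifted_brownian M X W V K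
  for M :: "'w measure" and X W V :: "real \<Rightarrow> 'w \<Rightarrow> real ^ 'd" and K :: real +
  fixes b :: "real \<Rightarrow> real ^ 'd \<Rightarrow> real ^ 'd"
  assumes V_eq: "AE q in lborel. 0 \<le> q \<longrightarrow> continuous_on UNIV (b q) \<and> (\<forall>x. norm (b q x) \<le> K) \<and>
    (\<forall>w\<in>space M. V q w = (\<integral>w'. b q (X q w - X q w') \<partial>M))"
begin

definition field :: "real \<Rightarrow> real ^ 'd \<Rightarrow> real ^ 'd" where
  "field q x = (\<integral>w'. b q (x - X q w') \<partial>M)"

lemma field_continuous:
  assumes c: "continuous_on UNIV (b q)" and B: "\<And>x. norm (b q x) \<le> K"
  shows "continuous_on UNIV (field q)"
proof -
  have [measurable]: "b q \<in> borel_measurable borel"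
    by (rule borel_measurable_continuous_onI[OF c])
  have "isCont (field q) x" for x
    unfolding continuous_at_sequentially
  proof (intro allI impI)
    fix u :: "nat \<Rightarrow> real ^ 'd" assume u: "u \<longlonglongrightarrow> x"
    show "(field q \<circ> u) \<longlonglongrightarrow> field q x"
      unfolding comp_def field_def
    proof (rule integral_dominated_convergence[where w="\<lambda>_. K"])
      have "(\<lambda>n. b q (u n - X q w)) \<longlonglongrightarrow> b q (x - X q w)" for w
        using c u by (intro continuous_on_tendsto_compose[OF c]) (auto intro!: tendsto_intros)
      then show "AE w in M. (\<lambda>n. b q (u n - X q w)) \<longlonglongrightarrow> b q (x - X q w)" by simp
    qed (use B in auto)
  qed
  then show ?thesis by (simp add: continuous_at_imp_continuous_on)
qed

lemma field_fdiff:
  assumes c: "continuous_on UNIV (b q)" and B: "\<And>x. norm (b q x) \<le> K"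
  shows "(fdiff k ^^ j) (field q) x = (\<integral>w'. (fdiff k ^^ j) (b q) (x - X q w') \<partial>M)"
proof (induction j arbitrary: x)
  case (Suc j)
  let ?F = "(fdiff k ^^ j) (b q)"
  have F: "continuous_on UNIV ?F" "\<And>x. norm (?F x) \<le> 2 ^ j * K"
    using continuous_fdiff[OF c] norm_fdiff_le[OF B] by auto
  have "integrable M (\<lambda>w. ?F (x - X q w))" for x
    by (rule integrable_comp_bounded[of "X q" "\<lambda>y. ?F (x - y)", OF X_measurable _ F(2)])
      (auto intro!: continuous_on_compose2[OF F(1)] continuous_intros)
  from this[of x] this[of "x + k"] show ?case
    by (simp add: fdiff_apply[of k "(fdiff k ^^ j) (field q)" x] fdiff_apply[of k ?F] Suc.IH algebra_simps)
qed (simp add: field_def)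

text \<open>Differences of the convolution fall on the law, with the bounded function
  \<open>y \<mapsto> b q (x - y)\<close> as test function. Since regularity of the law is stated for
  real test functions, the vector \<open>v\<close> to be bounded is paired with itself, and one
  factor \<open>norm v\<close> is cancelled at the end.\<close>

lemma field_fdiff_le:
  assumes c: "continuous_on UNIV (b q)" and B: "\<And>x. norm (b q x) \<le> K"
    and reg: "dual_regular (X q) N C h" and "j \<le> N"
  shows "norm ((fdiff (- h) ^^ j) (field q) x) \<le> C * K * sqrt (norm h) ^ j"
proof -
  define v where "v = (fdiff (- h) ^^ j) (field q) x"
  let ?F = "(fdiff (- h) ^^ j) (b q)"
  have F: "continuous_on UNIV ?F" "\<And>x. norm (?F x) \<le> 2 ^ j * K"
    using continuous_fdiff[OF c] norm_fdiff_le[OF B] by auto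
  have i: "integrable M (\<lambda>w. ?F (x - X q w))"
    by (rule integrable_comp_bounded[of "X q" "\<lambda>y. ?F (x - y)", OF X_measurable _ F(2)])
      (auto intro!: continuous_on_compose2[OF F(1)] continuous_intros)
  have "v \<bullet> v = (\<integral>w. v \<bullet> ?F (x - X q w) \<partial>M)"
    using i by (subst (2) v_def) (simp add: field_fdiff[OF c B])
  also have "\<dots> = (\<integral>w. (fdiff h ^^ j) (\<lambda>y. v \<bullet> b q (x - y)) (X q w) \<partial>M)"
    by (simp add: fdiff_inner_const fdiff_reflect)
  also have "\<dots> \<le> C * (norm v * K) * sqrt (norm h) ^ j"
  proof -
    have "continuous_on UNIV (\<lambda>y. v \<bullet> b q (x - y))"
      by (auto intro!: continuous_intros continuous_on_compose2[OF c])
    moreover have "\<bar>v \<bullet> b q (x - y)\<bar> \<le> norm v * K" for y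
      using norm_inner_le[OF order_refl B, of v] by simp
    ultimately show ?thesis
      using dual_regularD[OF reg \<open>j \<le> N\<close>, of "\<lambda>y. v \<bullet> b q (x - y)" "norm v * K"] by auto
  qed
  finally have "norm v * norm v \<le> norm v * (C * K * sqrt (norm h) ^ j)"
    by (simp add: power2_norm_eq_inner[symmetric] power2_eq_square mult_ac)
  moreover have "0 \<le> C * K * sqrt (norm h) ^ j"
    using order_trans[OF abs_ge_zero dual_regularD[OF reg \<open>j \<le> N\<close>, of "\<lambda>_. 0" K]] K_nonneg by simp
  ultimately show ?thesis
    unfolding v_def[symmetric] by (cases "v = 0") auto
qed

text \<open>One difference stays on the heat gradient and supplies the singular factor; the other
  \<open>m\<close> are distributed by \<open>dual_regular_product\<close>. The constant is quadratic
  in \<open>C\<close>, as the regularity of the law is used once for the law itself and once through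
  the field.\<close>

lemma flux_regular_le:
  assumes c: "continuous_on UNIV (b q)" and B: "\<And>x. norm (b q x) \<le> K"
    and V: "\<And>w. w \<in> space M \<Longrightarrow> V q w = field q (X q w)"
    and reg: "dual_regular (X q) m C h" and "q < T"
    and f: "continuous_on UNIV f" and A: "\<And>x. \<bar>f x\<bar> \<le> A"
  shows "\<bar>flux T ((fdiff h ^^ Suc m) f) q\<bar>
    \<le> 2 ^ m * C\<^sup>2 * K * 2 * A * (heat_const TYPE('d))\<^sup>2 * sqrt (norm h) ^ Suc m * (T - q) powr (- 3 / 4)"
proof -
  have t: "0 < T - q" using assms by simp
  have fm: "f \<in> borel_measurable borel" by (rule borel_measurable_continuous_onI[OF f])
  define G where "G = 2 * A * (heat_const TYPE('d))\<^sup>2 * (sqrt (norm h) * (T - q) powr (- 3 / 4))"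
  define g where "g = fdiff h (heat_grad (T - q) f)"
  have g: "continuous_on UNIV g" "norm (g x) \<le> G" for x
    using continuous_fdiff[OF heat_grad_continuous[OF t fm A], of 1 h] fdiff_heat_grad_le[OF t fm A, of h x]
    by (simp_all add: g_def G_def)
  have "flux T ((fdiff h ^^ Suc m) f) q = (\<integral>w. (fdiff h ^^ 0) (\<lambda>x. field q x \<bullet> (fdiff h ^^ m) g x) (X q w) \<partial>M)"
    unfolding flux_def heat_grad_fdiff[OF t f A] unfolding funpow_Suc_fdiff g_def
    by (intro Bochner_Integration.integral_cong) (simp_all add: V)
  also have "\<bar>\<dots>\<bar> \<le> 2 ^ m * (C * ((C * K) * G)) * sqrt (norm h) ^ (0 + 0 + m)"
    by (rule dual_regular_product[OF reg X_measurable g field_continuous[OF c B]])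
      (use field_fdiff_le[OF c B reg] in auto)
  finally show ?thesis
    by (simp add: G_def power2_eq_square mult_ac)
qed

text \<open>Duhamel's formula is started at \<open>s\<close>. In the initial term, one difference
  meets the Lipschitz bound of the semigroup, harmless since at least the time \<sigma> has elapsed,
  and the remaining \<open>m\<close> meet the law at time \<open>s\<close>. The time integral is
  controlled by \<open>flux_regular_le\<close>.\<close>

lemma dual_regular_Suc:
  assumes s: "0 \<le> s" "0 < \<sigma>" "s + \<sigma> \<le> t" and "t \<le> t0" and h: "norm h \<le> 1" and "0 \<le> C"
    and reg: "\<And>q. s \<le> q \<Longrightarrow> q \<le> t0 \<Longrightarrow> dual_regular (X q) m C h"
    and f: "continuous_on UNIV f" and A: "\<And>x. \<bar>f x\<bar> \<le> A"
  defines "\<kappa> \<equiv> heat_const TYPE('d)"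
  shows "\<bar>\<integral>w. (fdiff h ^^ Suc m) f (X t w) \<partial>M\<bar>
    \<le> (C * \<kappa> / sqrt \<sigma> + 2 ^ m * C\<^sup>2 * K * 2 * \<kappa>\<^sup>2 * (4 * (t0 + 1) powr (1 / 4))) * A * sqrt (norm h) ^ Suc m"
    (is "_ \<le> ?R")
proof -
  let ?\<eta> = "sqrt (norm h)"
  define F where "F = (fdiff h ^^ Suc m) f"
  have F: "continuous_on UNIV F" "\<And>x. \<bar>F x\<bar> \<le> 2 ^ Suc m * A"
    using continuous_fdiff[OF f, of "Suc m" h] norm_fdiff_le[OF A[folded real_norm_def], where m="Suc m" and h=h]
    unfolding F_def real_norm_def by auto
  have A0: "0 \<le> A" using A[of 0] by linarith
  have \<kappa>0: "0 < \<kappa>" unfolding \<kappa>_def by (rule heat_const_pos)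
  have fm: "f \<in> borel_measurable borel" "F \<in> borel_measurable borel"
    by (intro borel_measurable_continuous_onI f F)+
  \<comment> \<open>Duhamel's formula requires \<open>T > t\<close>, so the claim is proved for
    \<open>heat \<epsilon> F\<close> uniformly in \<epsilon> before \<epsilon> tends to 0. The
    restriction \<open>\<epsilon> \<le> 1\<close> is the source of \<open>t0 + 1\<close>.\<close>
  have bound: "\<bar>\<integral>w. heat \<epsilon> F (X t w) \<partial>M\<bar> \<le> ?R" if \<epsilon>: "0 < \<epsilon>" "\<epsilon> \<le> 1" for \<epsilon>
  proof -
    define T where "T = t + \<epsilon>"
    have T: "t < T" "T - t = \<epsilon>" "\<sigma> \<le> T - s" "0 < T - s" using s \<epsilon> by (auto simp: T_def)
    have "(\<integral>w. heat \<epsilon> F (X t w) \<partial>M)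
        = (\<integral>w. heat (T - s) F (X s w) \<partial>M) + (\<integral>q. indicator {s..t} q *\<^sub>R flux T F q \<partial>lborel)"
      using duhamel[OF s(1) _ T(1) fm(2) F(2)] s by (simp add: T)
    moreover have "\<bar>\<integral>w. heat (T - s) F (X s w) \<partial>M\<bar> \<le> (C * \<kappa> / sqrt \<sigma>) * A * ?\<eta> ^ Suc m"
    proof -
      define u where "u = fdiff h (heat (T - s) f)"
      have u: "continuous_on UNIV u"
        using continuous_fdiff[OF heat_continuous[OF T(4) fm(1) A[folded real_norm_def]], of 1 h]
        by (simp add: u_def)
      have ub: "\<bar>u x\<bar> \<le> A * (\<kappa> / sqrt \<sigma>) * ?\<eta>" for x
      proof -
        have "\<bar>u x\<bar> \<le> A * (\<kappa> * norm h / sqrt (T - s))"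
          using heat_lipschitz[OF T(4) fm(1) A[folded real_norm_def], of x h] by (simp add: u_def fdiff_apply \<kappa>_def)
        also have "\<dots> \<le> A * (\<kappa> * ?\<eta> / sqrt \<sigma>)"
        proof -
          \<comment> \<open>The semigroup gains a full power of \<open>norm h\<close>; for
            \<open>norm h \<le> 1\<close> it is weakened to the half power that the induction
            carries.\<close>
          have "norm h \<le> ?\<eta>" using h by (simp add: real_le_rsqrt power2_eq_square mult_left_le)
          then show ?thesis
            using A0 \<kappa>0 s(2) T by (intro mult_left_mono frac_le) auto
        qed
        finally show ?thesis by (simp add: mult_ac)
      qed
      have "heat (T - s) F = (fdiff h ^^ m) u"
        unfolding F_def u_def heat_fdiff[OF T(4) f A[folded real_norm_def]] unfolding funpow_Suc_fdiff ..
      then have "\<bar>\<integral>w. heat (T - s) F (X s w) \<partial>M\<bar> \<le> C * (A * (\<kappa> / sqrt \<sigma>) * ?\<eta>) * ?\<eta> ^ m"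
        using dual_regularD[OF reg order_refl u ub] s assms(4) by simp
      then show ?thesis by (simp add: mult_ac)
    qed
    moreover have "\<bar>\<integral>q. indicator {s..t} q *\<^sub>R flux T F q \<partial>lborel\<bar>
        \<le> (2 ^ m * C\<^sup>2 * K * 2 * \<kappa>\<^sup>2 * (4 * (t0 + 1) powr (1 / 4))) * A * ?\<eta> ^ Suc m"
    proof -
      define c where "c = 2 ^ m * C\<^sup>2 * K * 2 * A * \<kappa>\<^sup>2 * ?\<eta> ^ Suc m"
      have c0: "0 \<le> c" using K_nonneg A0 by (simp add: c_def)
      have st: "s \<le> t" using s by simp
      have i: "integrable lborel (\<lambda>q. indicator {s..t} q *\<^sub>R flux T F q)"
        by (rule integrable_indicator_Icc[OF _ flux_bound_Icc[OF _ T(1) fm(2) F(2)]]) (use fm in auto)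
      have "norm (\<integral>q. indicator {s..t} q *\<^sub>R flux T F q \<partial>lborel) \<le> (\<integral>q. norm (indicator {s..t} q *\<^sub>R flux T F q) \<partial>lborel)"
        by (rule integral_norm_bound)
      also have "\<dots> \<le> (\<integral>q. c * (indicator {s..t} q *\<^sub>R (T - q) powr (- 3 / 4)) \<partial>lborel)"
      proof (rule integral_mono_AE)
        show "AE q in lborel. norm (indicator {s..t} q *\<^sub>R flux T F q) \<le> c * (indicator {s..t} q *\<^sub>R (T - q) powr (- 3 / 4))"
          using V_eq
        proof eventually_elim
          case (elim q)
          show ?case
          proof (cases "q \<in> {s..t}")
            case True
            then have "0 \<le> q" using s by simp
            with elim have e: "continuous_on UNIV (b q)" "\<And>x. norm (b q x) \<le> K"
              "\<And>w. w \<in> space M \<Longrightarrow> V q w = field q (X q w)" by (auto simp: field_def)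
            have "\<bar>flux T F q\<bar> \<le> 2 ^ m * C\<^sup>2 * K * 2 * A * \<kappa>\<^sup>2 * ?\<eta> ^ Suc m * (T - q) powr (- 3 / 4)"
              unfolding F_def \<kappa>_def
              by (rule flux_regular_le[OF e reg _ f A]) (use True T assms(4) in auto)
            then show ?thesis using True by (simp add: c_def)
          qed simp
        qed
      qed (rule integrable_norm[OF i], rule integrable_mult_right[OF integral_powr_Icc(1)[OF st T(1)]])
      also have "\<dots> = c * (\<integral>q. indicator {s..t} q *\<^sub>R (T - q) powr (- 3 / 4) \<partial>lborel)"
        by simp
      also have "\<dots> \<le> c * (4 * (T - s) powr (1 / 4))"
        using c0 integral_powr_Icc(2)[OF st T(1)] by (rule mult_left_mono[rotated])
      also have "\<dots> \<le> c * (4 * (t0 + 1) powr (1 / 4))"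
        using c0 T s assms(4) \<epsilon> by (intro mult_left_mono powr_mono2) (auto simp: T_def)
      finally show ?thesis by (simp add: c_def mult_ac)
    qed
    ultimately show ?thesis by (simp add: algebra_simps)
  qed
  have lim: "(\<lambda>n. \<integral>w. heat (1 / real (Suc n)) F (X t w) \<partial>M) \<longlonglongrightarrow> (\<integral>w. F (X t w) \<partial>M)"
  proof (rule integral_dominated_convergence[where w="\<lambda>_. 2 ^ Suc m * A"])
    have [measurable]: "heat (1 / real (Suc n)) F \<in> borel_measurable borel" for n
      by (rule borel_measurable_continuous_onI[OF heat_continuous[OF _ fm(2) F(2)[folded real_norm_def]]]) simp
    show "(\<lambda>w. heat (1 / real (Suc n)) F (X t w)) \<in> borel_measurable M" for n
      by measurable
    show "(\<lambda>w. F (X t w)) \<in> borel_measurable M"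
      using fm(2) by measurable
    have "(\<lambda>n. heat (1 / real (Suc n)) F x) \<longlonglongrightarrow> F x" for x
      by (rule filterlim_compose[OF heat_tendsto[OF F(1) F(2)[folded real_norm_def]] filterlim_inverse_Suc_at_right])
    then show "AE w in M. (\<lambda>n. heat (1 / real (Suc n)) F (X t w)) \<longlonglongrightarrow> F (X t w)"
      by simp
    show "AE w in M. norm (heat (1 / real (Suc n)) F (X t w)) \<le> 2 ^ Suc m * A" for n
      using heat_norm_le[OF _ fm(2) F(2)[folded real_norm_def], of "1 / real (Suc n)"] by auto
  qed simp
  have "\<bar>\<integral>w. F (X t w) \<partial>M\<bar> \<le> ?R"
    by (rule LIMSEQ_le_const2[OF tendsto_rabs[OF lim]]) (use bound in auto)
  then show ?thesis by (simp only: F_def)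
qed

theorem dual_regular_all:
  assumes "0 < s" "s \<le> t0"
  shows "\<exists>C\<ge>0. \<forall>h q. norm h \<le> 1 \<longrightarrow> s \<le> q \<longrightarrow> q \<le> t0 \<longrightarrow> dual_regular (X q) m C h"
  using assms
proof (induction m arbitrary: s)
  case 0
  have "dual_regular (X q) 0 1 h" for q h
    unfolding dual_regular_def
  proof (intro allI impI)
    fix j :: nat and f :: "real ^ 'd \<Rightarrow> real" and A
    assume j: "j \<le> 0" and f: "continuous_on UNIV f" "\<forall>x. \<bar>f x\<bar> \<le> A"
    have [measurable]: "f \<in> borel_measurable borel" by (rule borel_measurable_continuous_onI[OF f(1)])
    have "norm (\<integral>w. f (X q w) \<partial>M) \<le> (\<integral>w. A \<partial>M)"
      by (rule norm_integral_le) (use f in auto)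
    then show "\<bar>\<integral>w. (fdiff h ^^ j) f (X q w) \<partial>M\<bar> \<le> 1 * A * sqrt (norm h) ^ j"
      using j by (simp add: prob_space)
  qed
  then show ?case by (intro exI[of _ 1]) auto
next
  case (Suc m)
  \<comment> \<open>The hypothesis is used from time \<open>s / 2\<close> on, so that times
    \<open>q \<ge> s\<close> leave a margin of \<open>\<sigma> = s / 2\<close> for the
    semigroup.\<close>
  obtain C where C: "0 \<le> C" "\<And>h q. norm h \<le> 1 \<Longrightarrow> s / 2 \<le> q \<Longrightarrow> q \<le> t0 \<Longrightarrow> dual_regular (X q) m C h"
    using Suc.IH[of "s / 2"] Suc.prems by auto
  define \<kappa> where "\<kappa> = heat_const TYPE('d)"
  define D where "D = C * \<kappa> / sqrt (s / 2) + 2 ^ m * C\<^sup>2 * K * 2 * \<kappa>\<^sup>2 * (4 * (t0 + 1) powr (1 / 4))"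
  have "dual_regular (X q) (Suc m) (max C D) h" if h: "norm h \<le> 1" and q: "s \<le> q" "q \<le> t0" for h q
    unfolding dual_regular_def
  proof (intro allI impI)
    fix j :: nat and f :: "real ^ 'd \<Rightarrow> real" and A
    assume j: "j \<le> Suc m" and f: "continuous_on UNIV f" "\<forall>x. \<bar>f x\<bar> \<le> A"
    have A0: "0 \<le> A" using f(2) order_trans[OF abs_ge_zero] by blast
    have "\<bar>\<integral>w. (fdiff h ^^ j) f (X q w) \<partial>M\<bar> \<le> (if j = Suc m then D else C) * A * sqrt (norm h) ^ j"
    proof (cases "j = Suc m")
      case True
      have "\<bar>\<integral>w. (fdiff h ^^ Suc m) f (X q w) \<partial>M\<bar> \<le> D * A * sqrt (norm h) ^ Suc m"
        unfolding D_def \<kappa>_def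
        by (rule dual_regular_Suc[of "s / 2"]) (use Suc.prems q h C f in auto)
      then show ?thesis using True by simp
    next
      case False
      then show ?thesis
        using dual_regularD[OF C(2)[OF h], of q j f A] Suc.prems q j f by auto
    qed
    also have "\<dots> \<le> max C D * A * sqrt (norm h) ^ j"
      using A0 by (intro mult_right_mono) auto
    finally show "\<bar>\<integral>w. (fdiff h ^^ j) f (X q w) \<partial>M\<bar> \<le> max C D * A * sqrt (norm h) ^ j" .
  qed
  then show ?case
    using C(1) by (intro exI[of _ "max C D"]) auto
qed

end

section \<open>Fourier inversion\<close>

lemma integral_lborel_vec_prod:
  fixes F :: "'d::finite \<Rightarrow> real \<Rightarrow> complex"
  assumes int: "\<And>i. integrable lborel (F i)"
  shows "(\<integral>x. (\<Prod>i\<in>UNIV. F i ((x::real ^ 'd) $ i)) \<partial>lborel) = (\<Prod>i\<in>UNIV. (\<integral>x. F i x \<partial>lborel))"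
proof -
  interpret product_sigma_finite "\<lambda>_::real ^ 'd. lborel :: real measure" ..
  have [measurable]: "F i \<in> borel_measurable borel" for i
    using borel_measurable_integrable[OF int[of i]] by simp
  have "(\<integral>x. (\<Prod>i\<in>UNIV. F i ((x::real ^ 'd) $ i)) \<partial>lborel) = (\<integral>x. (\<Prod>b\<in>Basis. F (axis_index b) ((x::real ^ 'd) \<bullet> b)) \<partial>lborel)"
    by (simp add: prod_Basis_vec[where g="\<lambda>i b. F i (_ \<bullet> b)"] inner_axis)
  also have "\<dots> = (\<integral>f. (\<Prod>b\<in>Basis. F (axis_index b) ((\<Sum>b\<in>Basis. f b *\<^sub>R b) \<bullet> (b::real ^ 'd))) \<partial>(\<Pi>\<^sub>M b\<in>Basis. lborel))"
    by (subst lborel_eq, subst integral_distr) auto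
  also have "\<dots> = (\<integral>f. (\<Prod>b\<in>Basis. F (axis_index (b::real ^ 'd)) (f b)) \<partial>(\<Pi>\<^sub>M b\<in>Basis. lborel))"
    by (intro Bochner_Integration.integral_cong refl prod.cong) simp
  also have "\<dots> = (\<Prod>b\<in>Basis. (\<integral>x. F (axis_index (b::real ^ 'd)) x \<partial>lborel))"
    by (rule product_integral_prod) (auto simp: int)
  also have "\<dots> = (\<Prod>i\<in>UNIV. (\<integral>x. F i x \<partial>lborel))"
    by (simp add: prod_Basis_vec[where g="\<lambda>i b. \<integral>x. F i x \<partial>lborel"])
  finally show ?thesis .
qed

lemma normal_density_char:
  assumes "0 < \<sigma>"
  shows "(\<integral>x. iexp (t * x) * complex_of_real (normal_density 0 \<sigma> x) \<partial>lborel) = exp (- (complex_of_real (\<sigma> * t))\<^sup>2 / 2)"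
proof -
  have "(\<integral>x. iexp (t * x) * complex_of_real (normal_density 0 \<sigma> x) \<partial>lborel)
      = \<bar>\<sigma>\<bar> *\<^sub>R (\<integral>x. iexp (t * (0 + \<sigma> * x)) * complex_of_real (normal_density 0 \<sigma> (0 + \<sigma> * x)) \<partial>lborel)"
    by (rule lborel_integral_real_affine) (use assms in auto)
  also have "\<dots> = (\<integral>x. \<bar>\<sigma>\<bar> *\<^sub>R (iexp (t * (0 + \<sigma> * x)) * complex_of_real (normal_density 0 \<sigma> (0 + \<sigma> * x))) \<partial>lborel)"
    by simp
  also have "\<dots> = (\<integral>x. std_normal_density x *\<^sub>R iexp ((\<sigma> * t) * x) \<partial>lborel)"
  proof (intro Bochner_Integration.integral_cong refl)
    fix x :: real
    have "\<sigma> * normal_density 0 \<sigma> (\<sigma> * x) = std_normal_density x"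
      using assms by (simp add: normal_density_def power_mult_distrib real_sqrt_mult)
    then have "complex_of_real \<sigma> * complex_of_real (normal_density 0 \<sigma> (\<sigma> * x)) = complex_of_real (std_normal_density x)"
      by (metis of_real_mult)
    then show "\<bar>\<sigma>\<bar> *\<^sub>R (iexp (t * (0 + \<sigma> * x)) * complex_of_real (normal_density 0 \<sigma> (0 + \<sigma> * x))) = std_normal_density x *\<^sub>R iexp ((\<sigma> * t) * x)"
      using assms by (simp add: scaleR_conv_of_real mult_ac)
  qed
  also have "\<dots> = char std_normal_distribution (\<sigma> * t)"
    unfolding char_def by (subst integral_density) auto
  also have "\<dots> = exp (- (complex_of_real (\<sigma> * t))\<^sup>2 / 2)"
    by (simp add: char_std_normal_distribution exp_of_real[symmetric])
  finally show ?thesis .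
qed

text \<open>The real part of the Gaussian characteristic function, which is a product of
  characteristic functions on the line.\<close>

lemma gauss_cos:
  assumes "0 < \<sigma>"
  shows "(\<integral>\<xi>. gauss_density \<sigma> \<xi> * cos (\<xi> \<bullet> y) \<partial>lborel) = exp (- \<sigma> * (norm (y::real ^ 'd))\<^sup>2 / 2)"
proof -
  let ?F = "\<lambda>i x. iexp (y $ i * x) * complex_of_real (normal_density 0 (sqrt \<sigma>) x)"
  have int: "integrable lborel (?F i)" for i
  proof (rule Bochner_Integration.integrable_bound)
    show "integrable lborel (normal_density 0 (sqrt \<sigma>))" using assms by auto
    show "AE x in lborel. norm (?F i x) \<le> norm (normal_density 0 (sqrt \<sigma>) x)"
      by (auto simp: norm_mult)
  qed simp
  have eq: "(\<Prod>i\<in>UNIV. ?F i (\<xi> $ i)) = gauss_density \<sigma> \<xi> *\<^sub>R iexp (\<xi> \<bullet> y)" for \<xi>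
  proof -
    have "(\<Prod>i\<in>UNIV. iexp (y $ i * \<xi> $ i)) = iexp (\<xi> \<bullet> y)"
      by (simp add: exp_sum[symmetric] inner_vec_def sum_distrib_left[symmetric] mult.commute)
    then show ?thesis
      by (simp add: prod.distrib gauss_density_def scaleR_conv_of_real mult.commute)
  qed
  have "integrable lborel (\<lambda>\<xi>. gauss_density \<sigma> \<xi> *\<^sub>R iexp (\<xi> \<bullet> y))"
  proof -
    have "integrable (gauss \<sigma>) (\<lambda>\<xi>. iexp (\<xi> \<bullet> y))"
      by (rule gauss_integrable_bounded[OF assms, of _ 1]) auto
    then show ?thesis unfolding gauss_def by (subst (asm) integrable_density) auto
  qed
  then have "(\<integral>\<xi>. Re (gauss_density \<sigma> \<xi> *\<^sub>R iexp (\<xi> \<bullet> y)) \<partial>lborel) = Re (\<integral>\<xi>. gauss_density \<sigma> \<xi> *\<^sub>R iexp (\<xi> \<bullet> y) \<partial>lborel)"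
    by (rule integral_Re)
  also have "(\<integral>\<xi>. gauss_density \<sigma> \<xi> *\<^sub>R iexp (\<xi> \<bullet> y) \<partial>lborel) = (\<Prod>i\<in>UNIV. \<integral>x. ?F i x \<partial>lborel)"
    unfolding eq[symmetric] by (rule integral_lborel_vec_prod[OF int])
  also have "\<dots> = (\<Prod>i\<in>UNIV. complex_of_real (exp (- \<sigma> * (y $ i)\<^sup>2 / 2)))"
    using assms by (subst normal_density_char) (auto simp: exp_of_real[symmetric] power_mult_distrib of_real_power[symmetric] simp del: of_real_power)
  also have "\<dots> = complex_of_real (exp (- \<sigma> * (norm y)\<^sup>2 / 2))"
    by (simp add: of_real_prod[symmetric] exp_sum[symmetric] norm_vec_def L2_set_def sum_nonneg
        sum_negf sum_divide_distrib[symmetric] sum_distrib_left[symmetric] del: of_real_prod)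
  finally show ?thesis
    by (simp add: Re_exp)
qed

abbreviation inversion_const :: "'d::finite itself \<Rightarrow> real" where
  "inversion_const _ \<equiv> (1 / (2 * pi)) ^ CARD('d)"

lemma gauss_weight_eq:
  "0 < \<epsilon> \<Longrightarrow> exp (- \<epsilon> * (norm \<xi>)\<^sup>2 / 2) = sqrt (2 * pi / \<epsilon>) ^ CARD('d) * gauss_density (1 / \<epsilon>) (\<xi>::real ^ 'd)"
  by (simp add: gauss_density_eq power_divide mult.commute)

text \<open>The weight \<open>exp (- \<epsilon> * (norm \<xi>)\<^sup>2 / 2)\<close> is a multiple of
  the Gaussian density of variance \<open>1 / \<epsilon>\<close>, so inversion for Gaussians is read
  off from their transform. General laws are reduced to this case by Gaussian smoothing.\<close>

lemma gauss_density_inversion: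
  assumes "0 < \<epsilon>"
  shows "gauss_density \<epsilon> (y::real ^ 'd)
    = inversion_const TYPE('d) * (\<integral>\<xi>. exp (- \<epsilon> * (norm \<xi>)\<^sup>2 / 2) * cos (\<xi> \<bullet> y) \<partial>lborel)"
proof -
  have k: "1 / sqrt (2 * pi * \<epsilon>) = (1 / (2 * pi)) * sqrt (2 * pi / \<epsilon>)"
    using assms by (simp add: real_sqrt_mult real_sqrt_divide field_simps)
  have "(\<integral>\<xi>. exp (- \<epsilon> * (norm \<xi>)\<^sup>2 / 2) * cos (\<xi> \<bullet> y) \<partial>lborel)
      = sqrt (2 * pi / \<epsilon>) ^ CARD('d) * (\<integral>\<xi>. gauss_density (1 / \<epsilon>) \<xi> * cos (\<xi> \<bullet> y) \<partial>lborel)"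
    unfolding gauss_weight_eq[OF assms] by (simp add: mult.assoc)
  also have "(\<integral>\<xi>. gauss_density (1 / \<epsilon>) \<xi> * cos (\<xi> \<bullet> y) \<partial>lborel) = exp (- (norm y)\<^sup>2 / (2 * \<epsilon>))"
    using assms by (subst gauss_cos) auto
  finally show ?thesis
    unfolding gauss_density_eq[OF assms] k by (simp only: power_mult_distrib mult.assoc)
qed

section \<open>Rapidly decaying functions and their trigonometric integrals\<close>

definition rapid_decay :: "(real ^ 'd \<Rightarrow> real) \<Rightarrow> bool" where
  "rapid_decay \<psi> \<longleftrightarrow> \<psi> \<in> borel_measurable borel \<and> (\<forall>N. \<exists>C. \<forall>\<xi>. \<bar>\<psi> \<xi>\<bar> * norm \<xi> ^ N \<le> C)"

lemma rapid_decay_measurable: "rapid_decay \<psi> \<Longrightarrow> \<psi> \<in> borel_measurable borel"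
  by (simp add: rapid_decay_def)

lemma rapid_decay_mult_inner:
  assumes "rapid_decay \<psi>"
  shows "rapid_decay (\<lambda>\<xi>. \<psi> \<xi> * (\<xi> \<bullet> v))"
  unfolding rapid_decay_def
proof (intro conjI allI)
  show "(\<lambda>\<xi>. \<psi> \<xi> * (\<xi> \<bullet> v)) \<in> borel_measurable borel"
    using rapid_decay_measurable[OF assms] by measurable
  fix N
  obtain C where C: "\<And>\<xi>. \<bar>\<psi> \<xi>\<bar> * norm \<xi> ^ Suc N \<le> C"
    using assms unfolding rapid_decay_def by blast
  have "\<bar>\<psi> \<xi> * (\<xi> \<bullet> v)\<bar> * norm \<xi> ^ N \<le> C * norm v" for \<xi>
  proof -
    have "\<bar>\<psi> \<xi> * (\<xi> \<bullet> v)\<bar> * norm \<xi> ^ N \<le> (\<bar>\<psi> \<xi>\<bar> * (norm \<xi> * norm v)) * norm \<xi> ^ N"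
      using Cauchy_Schwarz_ineq2[of \<xi> v] by (intro mult_right_mono) (auto simp: abs_mult mult_left_mono)
    also have "\<dots> = (\<bar>\<psi> \<xi>\<bar> * norm \<xi> ^ Suc N) * norm v" by simp
    also have "\<dots> \<le> C * norm v" using C by (intro mult_right_mono) auto
    finally show ?thesis .
  qed
  then show "\<exists>C. \<forall>\<xi>. \<bar>\<psi> \<xi> * (\<xi> \<bullet> v)\<bar> * norm \<xi> ^ N \<le> C" by blast
qed

lemma rapid_decay_cmult:
  assumes "rapid_decay \<psi>"
  shows "rapid_decay (\<lambda>\<xi>. c * \<psi> \<xi>)"
  unfolding rapid_decay_def
proof (intro conjI allI)
  show "(\<lambda>\<xi>. c * \<psi> \<xi>) \<in> borel_measurable borel"
    using rapid_decay_measurable[OF assms] by measurable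
  fix N
  obtain C where "\<And>\<xi>. \<bar>\<psi> \<xi>\<bar> * norm \<xi> ^ N \<le> C"
    using assms unfolding rapid_decay_def by blast
  then have "\<bar>c * \<psi> \<xi>\<bar> * norm \<xi> ^ N \<le> \<bar>c\<bar> * C" for \<xi>
    by (simp add: abs_mult mult.assoc mult_left_mono)
  then show "\<exists>C. \<forall>\<xi>. \<bar>c * \<psi> \<xi>\<bar> * norm \<xi> ^ N \<le> C" by blast
qed

lemma rapid_decay_minus: "rapid_decay \<psi> \<Longrightarrow> rapid_decay (\<lambda>\<xi>. - \<psi> \<xi>)"
  using rapid_decay_cmult[of \<psi> "- 1"] by simp

lemma integrable_inverse_prod_square:
  "integrable lborel (\<lambda>\<xi>::real ^ 'd. \<Prod>i\<in>UNIV. inverse (1 + (\<xi> $ i)\<^sup>2))"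
proof (rule integrableI_nonneg)
  have "set_integrable lborel (einterval (-\<infinity>) \<infinity>) (\<lambda>x::real. inverse (1 + x\<^sup>2))"
    by (rule integrable_inverse_1_plus_square)
  then have i: "integrable lborel (\<lambda>x::real. inverse (1 + x\<^sup>2))"
    by (simp add: set_integrable_def)
  have "(\<integral>\<^sup>+\<xi>. ennreal (\<Prod>i\<in>UNIV. inverse (1 + ((\<xi>::real ^ 'd) $ i)\<^sup>2)) \<partial>lborel)
      = (\<integral>\<^sup>+\<xi>. (\<Prod>i\<in>UNIV. ennreal (inverse (1 + ((\<xi>::real ^ 'd) $ i)\<^sup>2))) \<partial>lborel)"
    by (subst prod_ennreal) auto
  also have "\<dots> = (\<Prod>i\<in>(UNIV::'d set). \<integral>\<^sup>+x. ennreal (inverse (1 + x\<^sup>2)) \<partial>lborel)"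
    by (rule nn_integral_lborel_vec_prod) measurable
  also have "\<dots> < \<infinity>"
    using i by (subst nn_integral_eq_integral) (auto simp: ennreal_power power_less_top_ennreal)
  finally show "(\<integral>\<^sup>+\<xi>. ennreal (\<Prod>i\<in>UNIV. inverse (1 + ((\<xi>::real ^ 'd) $ i)\<^sup>2)) \<partial>lborel) < \<infinity>" .
qed (auto intro!: prod_nonneg)

lemma rapid_decay_integrable:
  assumes "rapid_decay (\<psi> :: real ^ 'd \<Rightarrow> real)"
  shows "integrable lborel \<psi>"
proof -
  obtain C0 where C0: "\<And>\<xi>. \<bar>\<psi> \<xi>\<bar> * norm \<xi> ^ 0 \<le> C0"
    using assms unfolding rapid_decay_def by blast
  \<comment> \<open>The comparison weight is a product of \<open>CARD('d)\<close> factors, each at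
    most \<open>1 + (norm \<xi>)\<^sup>2\<close>, hence the exponent
    \<open>2 * CARD('d)\<close>.\<close>
  obtain C1 where C1: "\<And>\<xi>. \<bar>\<psi> \<xi>\<bar> * norm \<xi> ^ (2 * CARD('d)) \<le> C1"
    using assms unfolding rapid_decay_def by blast
  show ?thesis
  proof (rule Bochner_Integration.integrable_bound)
    show "integrable lborel (\<lambda>\<xi>::real ^ 'd. (2 ^ CARD('d) * (C0 + C1)) * (\<Prod>i\<in>UNIV. inverse (1 + (\<xi> $ i)\<^sup>2)))"
      by (intro integrable_mult_right integrable_inverse_prod_square)
    show "AE \<xi> in lborel. norm (\<psi> \<xi>) \<le> norm ((2 ^ CARD('d) * (C0 + C1)) * (\<Prod>i\<in>UNIV. inverse (1 + (\<xi> $ i)\<^sup>2)))"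
    proof (rule AE_I2)
      fix \<xi> :: "real ^ 'd"
      let ?P = "\<Prod>i\<in>UNIV. (1 + (\<xi> $ i)\<^sup>2)"
      have P0: "0 < ?P" by (intro prod_pos) (auto intro: add_pos_nonneg)
      have "?P \<le> (\<Prod>i\<in>(UNIV::'d set). 1 + (norm \<xi>)\<^sup>2)"
        by (intro prod_mono) (auto intro!: power_mono component_le_norm_cart simp: abs_le_square_iff[symmetric])
      also have "\<dots> = (1 + (norm \<xi>)\<^sup>2) ^ CARD('d)" by simp
      also have "\<dots> \<le> (2 * max 1 ((norm \<xi>)\<^sup>2)) ^ CARD('d)"
        by (intro power_mono) auto
      also have "\<dots> \<le> 2 ^ CARD('d) * (1 + norm \<xi> ^ (2 * CARD('d)))"
        unfolding power_mult_distrib power_mult by (intro mult_left_mono) (auto simp: max_def)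
      finally have "?P \<le> 2 ^ CARD('d) * (1 + norm \<xi> ^ (2 * CARD('d)))" .
      then have "\<bar>\<psi> \<xi>\<bar> * ?P \<le> \<bar>\<psi> \<xi>\<bar> * (2 ^ CARD('d) * (1 + norm \<xi> ^ (2 * CARD('d))))"
        by (intro mult_left_mono) auto
      also have "\<dots> = 2 ^ CARD('d) * (\<bar>\<psi> \<xi>\<bar> * norm \<xi> ^ 0 + \<bar>\<psi> \<xi>\<bar> * norm \<xi> ^ (2 * CARD('d)))"
        by (simp add: algebra_simps)
      also have "\<dots> \<le> 2 ^ CARD('d) * (C0 + C1)"
        by (intro mult_left_mono add_mono C0 C1) auto
      finally have "\<bar>\<psi> \<xi>\<bar> \<le> (2 ^ CARD('d) * (C0 + C1)) / ?P"
        using P0 by (simp add: field_simps)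
      also have "\<dots> = (2 ^ CARD('d) * (C0 + C1)) * (\<Prod>i\<in>UNIV. inverse (1 + (\<xi> $ i)\<^sup>2))"
        by (simp add: prod_inversef[symmetric] divide_inverse comp_def)
      finally show "norm (\<psi> \<xi>) \<le> norm ((2 ^ CARD('d) * (C0 + C1)) * (\<Prod>i\<in>UNIV. inverse (1 + (\<xi> $ i)\<^sup>2)))"
        by simp
    qed
  qed (use rapid_decay_measurable[OF assms] in simp)
qed

text \<open>A real form of the inverse Fourier transform. Using a cosine and a sine part together
  makes the class closed under differentiation.\<close>

definition trig_integral :: "(real ^ 'd \<Rightarrow> real) \<Rightarrow> (real ^ 'd \<Rightarrow> real) \<Rightarrow> real ^ 'd \<Rightarrow> real" where
  "trig_integral \<phi> \<psi> x = (\<integral>\<xi>. cos (\<xi> \<bullet> x) * \<phi> \<xi> + sin (\<xi> \<bullet> x) * \<psi> \<xi> \<partial>lborel)"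

text \<open>Both bounds are components of one complex estimate: the first-order remainder of
  \<open>iexp b\<close>, rotated by \<open>iexp a\<close>.\<close>

lemma trig_taylor:
  fixes a b :: real
  shows "\<bar>cos (a + b) - cos a + sin a * b\<bar> \<le> b\<^sup>2" "\<bar>sin (a + b) - sin a - cos a * b\<bar> \<le> b\<^sup>2"
proof -
  define w where "w = iexp b - (\<Sum>k\<le>1. (\<i> * b) ^ k / fact k)"
  define z where "z = iexp a * w"
  have "cmod z = cmod w"
    by (simp add: z_def norm_mult)
  also have "cmod w \<le> \<bar>b\<bar> ^ Suc 1 / fact (Suc 1)"
    unfolding w_def by (rule iexp_approx1)
  also have "\<dots> \<le> b\<^sup>2" by (simp add: power2_eq_square)
  finally have z: "cmod z \<le> b\<^sup>2" .
  have w: "Re w = cos b - 1" "Im w = sin b - b"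
    by (simp_all add: w_def Re_exp Im_exp)
  have "Re z = cos (a + b) - cos a + sin a * b" "Im z = sin (a + b) - sin a - cos a * b"
    unfolding z_def times_complex.simps w by (simp_all add: Re_exp Im_exp cos_add sin_add algebra_simps)
  then show "\<bar>cos (a + b) - cos a + sin a * b\<bar> \<le> b\<^sup>2" "\<bar>sin (a + b) - sin a - cos a * b\<bar> \<le> b\<^sup>2"
    using abs_Re_le_cmod[of z] abs_Im_le_cmod[of z] z by (metis order_trans)+
qed

lemma rapid_decay_mult_norm:
  assumes "rapid_decay \<psi>"
  shows "rapid_decay (\<lambda>\<xi>. \<psi> \<xi> * norm \<xi> ^ k)"
  unfolding rapid_decay_def
proof (intro conjI allI)
  show "(\<lambda>\<xi>. \<psi> \<xi> * norm \<xi> ^ k) \<in> borel_measurable borel"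
    using rapid_decay_measurable[OF assms] by measurable
  fix N
  obtain C where "\<And>\<xi>. \<bar>\<psi> \<xi>\<bar> * norm \<xi> ^ (k + N) \<le> C"
    using assms unfolding rapid_decay_def by blast
  then have "\<bar>\<psi> \<xi> * norm \<xi> ^ k\<bar> * norm \<xi> ^ N \<le> C" for \<xi>
    by (simp add: abs_mult power_add mult.assoc)
  then show "\<exists>C. \<forall>\<xi>. \<bar>\<psi> \<xi> * norm \<xi> ^ k\<bar> * norm \<xi> ^ N \<le> C" by blast
qed

lemma abs_trig_le:
  fixes a p q :: real
  shows "\<bar>cos a * p + sin a * q\<bar> \<le> \<bar>p\<bar> + \<bar>q\<bar>"
proof -
  have "\<bar>cos a * p\<bar> \<le> \<bar>p\<bar>" "\<bar>sin a * q\<bar> \<le> \<bar>q\<bar>"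
    unfolding abs_mult by (rule mult_left_le_one_le; simp)+
  then show ?thesis by linarith
qed

lemma trig_integrable:
  assumes "rapid_decay \<phi>" "rapid_decay \<psi>"
  shows "integrable lborel (\<lambda>\<xi>. cos (\<xi> \<bullet> x) * \<phi> \<xi> + sin (\<xi> \<bullet> x) * \<psi> \<xi>)"
proof (rule Bochner_Integration.integrable_bound)
  note [measurable] = rapid_decay_measurable[OF assms(1)] rapid_decay_measurable[OF assms(2)]
  show "integrable lborel (\<lambda>\<xi>. \<bar>\<phi> \<xi>\<bar> + \<bar>\<psi> \<xi>\<bar>)"
    using rapid_decay_integrable[OF assms(1)] rapid_decay_integrable[OF assms(2)] by auto
  show "(\<lambda>\<xi>. cos (\<xi> \<bullet> x) * \<phi> \<xi> + sin (\<xi> \<bullet> x) * \<psi> \<xi>) \<in> borel_measurable lborel" by measurable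
  show "AE \<xi> in lborel. norm (cos (\<xi> \<bullet> x) * \<phi> \<xi> + sin (\<xi> \<bullet> x) * \<psi> \<xi>) \<le> norm (\<bar>\<phi> \<xi>\<bar> + \<bar>\<psi> \<xi>\<bar>)"
  proof (rule AE_I2)
    fix \<xi>
    show "norm (cos (\<xi> \<bullet> x) * \<phi> \<xi> + sin (\<xi> \<bullet> x) * \<psi> \<xi>) \<le> norm (\<bar>\<phi> \<xi>\<bar> + \<bar>\<psi> \<xi>\<bar>)"
      using abs_trig_le[of "\<xi> \<bullet> x" "\<phi> \<xi>" "\<psi> \<xi>"] by simp
  qed
qed

lemma has_derivative_if_quadratic:
  fixes f :: "'a::real_normed_vector \<Rightarrow> 'b::real_normed_vector"
  assumes "bounded_linear L" and q: "\<And>d. norm (f (x + d) - f x - L d) \<le> C * (norm d)\<^sup>2"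
  shows "(f has_derivative L) (at x)"
  unfolding has_derivative_at
proof (rule conjI[OF assms(1)], rule Lim_null_comparison)
  have "norm (norm (f (x + d) - f x - L d) / norm d) \<le> C * norm d" if "d \<noteq> 0" for d
    using q[of d] that by (simp add: divide_le_eq power2_eq_square mult.assoc)
  then show "\<forall>\<^sub>F d in at 0. norm (norm (f (x + d) - f x - L d) / norm d) \<le> C * norm d"
    by (simp add: eventually_at_filter)
  have "((\<lambda>d::'a. C * norm d) \<longlongrightarrow> C * norm (0::'a)) (at 0)"
    by (intro tendsto_intros)
  then show "((\<lambda>d::'a. C * norm d) \<longlongrightarrow> 0) (at 0)" by simp
qed

lemma trig_integral_has_derivative:
  assumes "rapid_decay \<phi>" "rapid_decay \<psi>"
  shows "(trig_integral \<phi> \<psi> has_derivative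
    (\<lambda>v. trig_integral (\<lambda>\<xi>. \<psi> \<xi> * (\<xi> \<bullet> v)) (\<lambda>\<xi>. - (\<phi> \<xi> * (\<xi> \<bullet> v))) x)) (at x)"
proof -
  note [measurable] = rapid_decay_measurable[OF assms(1)] rapid_decay_measurable[OF assms(2)]
  \<comment> \<open>The gradient as a vector. Writing \<open>L v\<close> as
    \<open>G \<bullet> v\<close> yields its bounded linearity at once.\<close>
  define G where "G = (\<integral>\<xi>. (cos (\<xi> \<bullet> x) * \<psi> \<xi> - sin (\<xi> \<bullet> x) * \<phi> \<xi>) *\<^sub>R \<xi> \<partial>lborel)"
  define L where "L v = trig_integral (\<lambda>\<xi>. \<psi> \<xi> * (\<xi> \<bullet> v)) (\<lambda>\<xi>. - (\<phi> \<xi> * (\<xi> \<bullet> v))) x" for v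
  have iG: "integrable lborel (\<lambda>\<xi>. (cos (\<xi> \<bullet> x) * \<psi> \<xi> - sin (\<xi> \<bullet> x) * \<phi> \<xi>) *\<^sub>R \<xi>)"
  proof (rule Bochner_Integration.integrable_bound)
    show "integrable lborel (\<lambda>\<xi>. \<bar>\<psi> \<xi> * norm \<xi> ^ 1\<bar> + \<bar>\<phi> \<xi> * norm \<xi> ^ 1\<bar>)"
      by (intro Bochner_Integration.integrable_add integrable_abs rapid_decay_integrable rapid_decay_mult_norm assms)
    have "\<bar>cos (\<xi> \<bullet> x) * \<psi> \<xi> - sin (\<xi> \<bullet> x) * \<phi> \<xi>\<bar> \<le> \<bar>\<psi> \<xi>\<bar> + \<bar>\<phi> \<xi>\<bar>" for \<xi>
      using abs_trig_le[of "\<xi> \<bullet> x" "\<psi> \<xi>" "- \<phi> \<xi>"] by simp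
    then have "\<bar>cos (\<xi> \<bullet> x) * \<psi> \<xi> - sin (\<xi> \<bullet> x) * \<phi> \<xi>\<bar> * norm \<xi> \<le> (\<bar>\<psi> \<xi>\<bar> + \<bar>\<phi> \<xi>\<bar>) * norm \<xi>" for \<xi>
      by (intro mult_right_mono) auto
    then show "AE \<xi> in lborel. norm ((cos (\<xi> \<bullet> x) * \<psi> \<xi> - sin (\<xi> \<bullet> x) * \<phi> \<xi>) *\<^sub>R \<xi>) \<le> norm (\<bar>\<psi> \<xi> * norm \<xi> ^ 1\<bar> + \<bar>\<phi> \<xi> * norm \<xi> ^ 1\<bar>)"
      by (simp add: abs_mult distrib_right)
  qed measurable
  have L: "L v = G \<bullet> v" for v
  proof -
    have "G \<bullet> v = (\<integral>\<xi>. ((cos (\<xi> \<bullet> x) * \<psi> \<xi> - sin (\<xi> \<bullet> x) * \<phi> \<xi>) *\<^sub>R \<xi>) \<bullet> v \<partial>lborel)"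
      unfolding G_def by (rule integral_inner_left[symmetric]) (rule iG)
    also have "\<dots> = L v"
      unfolding L_def trig_integral_def
      by (rule Bochner_Integration.integral_cong[OF refl]) (simp add: algebra_simps)
    finally show ?thesis ..
  qed
  have bl: "bounded_linear L"
    unfolding L[abs_def] by (rule bounded_linear_inner_right)
  define C where "C = (\<integral>\<xi>. \<bar>\<phi> \<xi> * norm \<xi> ^ 2\<bar> + \<bar>\<psi> \<xi> * norm \<xi> ^ 2\<bar> \<partial>lborel)"
  have iC: "integrable lborel (\<lambda>\<xi>. \<bar>\<phi> \<xi> * norm \<xi> ^ 2\<bar> + \<bar>\<psi> \<xi> * norm \<xi> ^ 2\<bar>)"
    by (intro Bochner_Integration.integrable_add integrable_abs rapid_decay_integrable rapid_decay_mult_norm assms)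
  have "norm (trig_integral \<phi> \<psi> (x + d) - trig_integral \<phi> \<psi> x - L d) \<le> C * (norm d)\<^sup>2" for d
  proof -
    let ?f = "\<lambda>\<xi>. (cos (\<xi> \<bullet> x + \<xi> \<bullet> d) - cos (\<xi> \<bullet> x) + sin (\<xi> \<bullet> x) * (\<xi> \<bullet> d)) * \<phi> \<xi>
      + (sin (\<xi> \<bullet> x + \<xi> \<bullet> d) - sin (\<xi> \<bullet> x) - cos (\<xi> \<bullet> x) * (\<xi> \<bullet> d)) * \<psi> \<xi>"
    have eq: "trig_integral \<phi> \<psi> (x + d) - trig_integral \<phi> \<psi> x - L d = (\<integral>\<xi>. ?f \<xi> \<partial>lborel)"
    proof -
      have i: "integrable lborel (\<lambda>\<xi>. cos (\<xi> \<bullet> (x + d)) * \<phi> \<xi> + sin (\<xi> \<bullet> (x + d)) * \<psi> \<xi>)"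
        "integrable lborel (\<lambda>\<xi>. cos (\<xi> \<bullet> x) * \<phi> \<xi> + sin (\<xi> \<bullet> x) * \<psi> \<xi>)"
        "integrable lborel (\<lambda>\<xi>. cos (\<xi> \<bullet> x) * (\<psi> \<xi> * (\<xi> \<bullet> d)) + sin (\<xi> \<bullet> x) * - (\<phi> \<xi> * (\<xi> \<bullet> d)))"
        by (rule trig_integrable; intro assms rapid_decay_minus rapid_decay_mult_inner)+
      have "trig_integral \<phi> \<psi> (x + d) - trig_integral \<phi> \<psi> x - L d
          = (\<integral>\<xi>. (cos (\<xi> \<bullet> (x + d)) * \<phi> \<xi> + sin (\<xi> \<bullet> (x + d)) * \<psi> \<xi>)
              - (cos (\<xi> \<bullet> x) * \<phi> \<xi> + sin (\<xi> \<bullet> x) * \<psi> \<xi>)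
              - (cos (\<xi> \<bullet> x) * (\<psi> \<xi> * (\<xi> \<bullet> d)) + sin (\<xi> \<bullet> x) * - (\<phi> \<xi> * (\<xi> \<bullet> d))) \<partial>lborel)"
        unfolding trig_integral_def L_def
          Bochner_Integration.integral_diff[OF Bochner_Integration.integrable_diff[OF i(1,2)] i(3)]
          Bochner_Integration.integral_diff[OF i(1,2)] ..
      also have "\<dots> = (\<integral>\<xi>. ?f \<xi> \<partial>lborel)"
        by (rule Bochner_Integration.integral_cong[OF refl]) (simp add: algebra_simps inner_add_right)
      finally show ?thesis .
    qed
    have "norm (\<integral>\<xi>. ?f \<xi> \<partial>lborel) \<le> (\<integral>\<xi>. (\<bar>\<phi> \<xi> * norm \<xi> ^ 2\<bar> + \<bar>\<psi> \<xi> * norm \<xi> ^ 2\<bar>) * (norm d)\<^sup>2 \<partial>lborel)"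
    proof (rule norm_integral_le)
      fix \<xi>
      have sq: "(\<xi> \<bullet> d)\<^sup>2 \<le> (norm \<xi>)\<^sup>2 * (norm d)\<^sup>2"
        using Cauchy_Schwarz_ineq[of \<xi> d] by (simp add: power2_norm_eq_inner)
      have "norm (?f \<xi>) \<le> \<bar>cos (\<xi> \<bullet> x + \<xi> \<bullet> d) - cos (\<xi> \<bullet> x) + sin (\<xi> \<bullet> x) * (\<xi> \<bullet> d)\<bar> * \<bar>\<phi> \<xi>\<bar>
          + \<bar>sin (\<xi> \<bullet> x + \<xi> \<bullet> d) - sin (\<xi> \<bullet> x) - cos (\<xi> \<bullet> x) * (\<xi> \<bullet> d)\<bar> * \<bar>\<psi> \<xi>\<bar>"
        unfolding real_norm_def abs_mult[symmetric] by (rule abs_triangle_ineq)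
      also have "\<dots> \<le> (\<xi> \<bullet> d)\<^sup>2 * \<bar>\<phi> \<xi>\<bar> + (\<xi> \<bullet> d)\<^sup>2 * \<bar>\<psi> \<xi>\<bar>"
        by (intro add_mono mult_right_mono trig_taylor abs_ge_zero)
      also have "\<dots> \<le> ((norm \<xi>)\<^sup>2 * (norm d)\<^sup>2) * \<bar>\<phi> \<xi>\<bar> + ((norm \<xi>)\<^sup>2 * (norm d)\<^sup>2) * \<bar>\<psi> \<xi>\<bar>"
        by (intro add_mono mult_right_mono sq abs_ge_zero)
      also have "\<dots> = (\<bar>\<phi> \<xi> * norm \<xi> ^ 2\<bar> + \<bar>\<psi> \<xi> * norm \<xi> ^ 2\<bar>) * (norm d)\<^sup>2"
        by (simp add: abs_mult algebra_simps)
      finally show "norm (?f \<xi>) \<le> (\<bar>\<phi> \<xi> * norm \<xi> ^ 2\<bar> + \<bar>\<psi> \<xi> * norm \<xi> ^ 2\<bar>) * (norm d)\<^sup>2" .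
      show "integrable lborel (\<lambda>\<xi>. (\<bar>\<phi> \<xi> * norm \<xi> ^ 2\<bar> + \<bar>\<psi> \<xi> * norm \<xi> ^ 2\<bar>) * (norm d)\<^sup>2)"
        by (rule integrable_mult_left) (rule iC)
    qed measurable
    then show ?thesis
      unfolding eq by (simp only: C_def integral_mult_left_zero)
  qed
  from has_derivative_if_quadratic[where f="trig_integral \<phi> \<psi>" and x=x and C=C, OF bl this] show ?thesis
    unfolding L_def[abs_def] .
qed

text \<open>The induction ranges over all pairs of coefficient functions, since a derivative
  exchanges the two and multiplies them by a linear function of \<xi>, which preserves rapid
  decay.\<close>

lemma trig_integral_Ck:
  assumes "rapid_decay \<phi>" "rapid_decay \<psi>"
  shows "Ck k (trig_integral \<phi> \<psi>)"
  using assms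
proof (induction k arbitrary: \<phi> \<psi>)
  case 0
  have "trig_integral \<phi> \<psi> differentiable (at x)" for x
    using trig_integral_has_derivative[OF "0.prems"] by (auto simp: differentiable_def)
  then show ?case
    by (simp add: continuous_at_imp_continuous_on differentiable_imp_continuous_within)
next
  case (Suc k)
  note d = trig_integral_has_derivative[OF Suc.prems]
  have "frechet_derivative (trig_integral \<phi> \<psi>) (at x)
      = (\<lambda>v. trig_integral (\<lambda>\<xi>. \<psi> \<xi> * (\<xi> \<bullet> v)) (\<lambda>\<xi>. - (\<phi> \<xi> * (\<xi> \<bullet> v))) x)" for x
    using frechet_derivative_at[OF d] by simp
  moreover have "trig_integral \<phi> \<psi> differentiable (at x)" for x
    using d by (auto simp: differentiable_def)
  moreover have "Ck k (trig_integral (\<lambda>\<xi>. \<psi> \<xi> * (\<xi> \<bullet> v)) (\<lambda>\<xi>. - (\<phi> \<xi> * (\<xi> \<bullet> v))))" for v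
    by (intro Suc.IH rapid_decay_minus rapid_decay_mult_inner Suc.prems)
  ultimately show ?case by simp
qed

section \<open>Densities from rapidly decaying characteristic functions\<close>

lemma gauss_density_integrable:
  assumes "0 < \<sigma>"
  shows "integrable lborel (gauss_density \<sigma> :: real ^ 'd \<Rightarrow> real)"
proof -
  have "integrable (gauss \<sigma>) (\<lambda>_::real ^ 'd. 1::real)"
    by (rule gauss_integrable_bounded[OF assms, of _ 1]) auto
  then show ?thesis unfolding gauss_def by (subst (asm) integrable_density) auto
qed

lemma gauss_weight_integrable:
  assumes "0 < \<epsilon>"
  shows "integrable lborel (\<lambda>\<xi>::real ^ 'd. exp (- \<epsilon> * (norm \<xi>)\<^sup>2 / 2))"
  unfolding gauss_weight_eq[OF assms]
  by (intro integrable_mult_right gauss_density_integrable) (use assms in simp)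

lemma gauss_density_le: "0 < \<epsilon> \<Longrightarrow> gauss_density \<epsilon> (y::real ^ 'd) \<le> (1 / sqrt (2 * pi * \<epsilon>)) ^ CARD('d)"
  by (subst gauss_density_eq) (auto intro!: mult_left_le)

lemma heat_eq_lborel:
  fixes f :: "real ^ 'd \<Rightarrow> real"
  assumes [measurable]: "f \<in> borel_measurable borel"
  shows "heat \<epsilon> f y = (\<integral>x. gauss_density \<epsilon> (x - y) * f x \<partial>lborel)"
proof -
  have "heat \<epsilon> f y = (\<integral>x. gauss_density \<epsilon> (y + x - y) * f (y + x) \<partial>lborel)"
    by (simp add: heat_def integral_gauss)
  also have "\<dots> = (\<integral>x. gauss_density \<epsilon> (x - y) * f x \<partial>lborel)"
    by (rule integral_lborel_shift[of "\<lambda>x. gauss_density \<epsilon> (x - y) * f x"]) measurable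
  finally show ?thesis .
qed

context prob_space
begin

definition char_cos :: "('a \<Rightarrow> real ^ 'd) \<Rightarrow> real ^ 'd \<Rightarrow> real" where
  "char_cos Y \<xi> = (\<integral>w. cos (\<xi> \<bullet> Y w) \<partial>M)"

definition char_sin :: "('a \<Rightarrow> real ^ 'd) \<Rightarrow> real ^ 'd \<Rightarrow> real" where
  "char_sin Y \<xi> = (\<integral>w. sin (\<xi> \<bullet> Y w) \<partial>M)"

text \<open>The density of \<open>Y\<close> plus an independent centred Gaussian with covariance
  \<epsilon> times the identity.\<close>

definition smoothed_density :: "('a \<Rightarrow> real ^ 'd) \<Rightarrow> real \<Rightarrow> real ^ 'd \<Rightarrow> real" where
  "smoothed_density Y \<epsilon> x = (\<integral>w. gauss_density \<epsilon> (x - Y w) \<partial>M)"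

lemma expectation_cos_diff:
  assumes [measurable]: "Y \<in> borel_measurable M"
  shows "(\<integral>w. cos (\<xi> \<bullet> (x - Y w)) \<partial>M) = cos (\<xi> \<bullet> x) * char_cos Y \<xi> + sin (\<xi> \<bullet> x) * char_sin Y \<xi>"
proof -
  have i: "integrable M (\<lambda>w. cos (\<xi> \<bullet> Y w))" "integrable M (\<lambda>w. sin (\<xi> \<bullet> Y w))"
    by (auto intro!: integrable_const_bound[of _ 1])
  have "(\<integral>w. cos (\<xi> \<bullet> (x - Y w)) \<partial>M)
      = (\<integral>w. cos (\<xi> \<bullet> x) * cos (\<xi> \<bullet> Y w) + sin (\<xi> \<bullet> x) * sin (\<xi> \<bullet> Y w) \<partial>M)"
    by (simp add: inner_diff_right cos_diff)
  then show ?thesis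
    using i by (simp add: char_cos_def char_sin_def)
qed

lemma smoothed_density_eq:
  fixes Y :: "'a \<Rightarrow> real ^ 'd"
  assumes [measurable]: "Y \<in> borel_measurable M" and "0 < \<epsilon>"
  shows "smoothed_density Y \<epsilon> x = inversion_const TYPE('d) * (\<integral>\<xi>. exp (- \<epsilon> * (norm \<xi>)\<^sup>2 / 2) *
    (cos (\<xi> \<bullet> x) * char_cos Y \<xi> + sin (\<xi> \<bullet> x) * char_sin Y \<xi>) \<partial>lborel)"
proof -
  interpret P: pair_sigma_finite "lborel :: (real ^ 'd) measure" M ..
  let ?e = "\<lambda>\<xi>::real ^ 'd. exp (- \<epsilon> * (norm \<xi>)\<^sup>2 / 2)"
  have e: "integrable lborel ?e" by (rule gauss_weight_integrable) fact
  have i0: "integrable (lborel \<Otimes>\<^sub>M M) (\<lambda>p. ?e (fst p))"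
  proof -
    have "integrable (lborel \<Otimes>\<^sub>M M) (\<lambda>(\<xi>, w::'a). ?e \<xi>)"
      by (rule P.Fubini_integrable) (use e in \<open>auto simp: prob_space\<close>)
    then show ?thesis by (simp only: split_beta')
  qed
  have i: "integrable (lborel \<Otimes>\<^sub>M M) (\<lambda>(\<xi>, w). ?e \<xi> * cos (\<xi> \<bullet> (x - Y w)))"
    by (rule Bochner_Integration.integrable_bound[OF i0]) (auto simp: abs_mult mult_left_le)
  have "smoothed_density Y \<epsilon> x = (\<integral>w. inversion_const TYPE('d) * (\<integral>\<xi>. ?e \<xi> * cos (\<xi> \<bullet> (x - Y w)) \<partial>lborel) \<partial>M)"
    unfolding smoothed_density_def gauss_density_inversion[OF \<open>0 < \<epsilon>\<close>] ..
  also have "\<dots> = inversion_const TYPE('d) * (\<integral>w. (\<integral>\<xi>. ?e \<xi> * cos (\<xi> \<bullet> (x - Y w)) \<partial>lborel) \<partial>M)"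
    by (rule integral_mult_right_zero)
  also have "(\<integral>w. (\<integral>\<xi>. ?e \<xi> * cos (\<xi> \<bullet> (x - Y w)) \<partial>lborel) \<partial>M)
      = (\<integral>\<xi>. (\<integral>w. ?e \<xi> * cos (\<xi> \<bullet> (x - Y w)) \<partial>M) \<partial>lborel)"
    by (rule P.Fubini_integral[OF i])
  also have "\<dots> = (\<integral>\<xi>. ?e \<xi> * (cos (\<xi> \<bullet> x) * char_cos Y \<xi> + sin (\<xi> \<bullet> x) * char_sin Y \<xi>) \<partial>lborel)"
    by (simp add: expectation_cos_diff)
  finally show ?thesis .
qed

lemma expectation_heat_eq:
  fixes Y :: "'a \<Rightarrow> real ^ 'd" and f :: "real ^ 'd \<Rightarrow> real"
  assumes [measurable]: "Y \<in> borel_measurable M" and "0 < \<epsilon>"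
    and [measurable]: "f \<in> borel_measurable borel" and f: "\<And>x. \<bar>f x\<bar> \<le> indicator (box a b) x"
  shows "(\<integral>w. heat \<epsilon> f (Y w) \<partial>M) = (\<integral>x. f x * smoothed_density Y \<epsilon> x \<partial>lborel)"
proof -
  interpret P: pair_sigma_finite "lborel :: (real ^ 'd) measure" M ..
  let ?C = "(1 / sqrt (2 * pi * \<epsilon>)) ^ CARD('d)"
  have "integrable (lborel \<Otimes>\<^sub>M M) (\<lambda>p. indicator (box a b \<times> space M) p *\<^sub>R (gauss_density \<epsilon> (fst p - Y (snd p)) * f (fst p)))"
  proof (rule integrableI_bounded_set_indicator)
    show "emeasure (lborel \<Otimes>\<^sub>M M) (box a b \<times> space M) < \<infinity>"
      by (simp add: emeasure_pair_measure_Times emeasure_lborel_box_eq emeasure_space_1)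
    have "norm (gauss_density \<epsilon> (fst p - Y (snd p)) * f (fst p)) \<le> ?C * 1" for p
      unfolding norm_mult
      using order_trans[OF f indicator_le_1, of "fst p"] gauss_density_le[OF \<open>0 < \<epsilon>\<close>, of "fst p - Y (snd p)"] \<open>0 < \<epsilon>\<close>
      by (intro mult_mono) auto
    then show "AE p in lborel \<Otimes>\<^sub>M M. p \<in> box a b \<times> space M \<longrightarrow> norm (gauss_density \<epsilon> (fst p - Y (snd p)) * f (fst p)) \<le> ?C"
      by auto
  qed auto
  moreover have "x \<in> box a b" if "f x \<noteq> 0" for x
    using f[of x] that by (cases "x \<in> box a b") auto
  ultimately have i: "integrable (lborel \<Otimes>\<^sub>M M) (\<lambda>(x, w). gauss_density \<epsilon> (x - Y w) * f x)"
    by (subst (asm) Bochner_Integration.integrable_cong[OF refl, where g="\<lambda>(x, w). gauss_density \<epsilon> (x - Y w) * f x"])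
      (auto simp: space_pair_measure indicator_def)
  have "(\<integral>w. heat \<epsilon> f (Y w) \<partial>M) = (\<integral>w. (\<integral>x. gauss_density \<epsilon> (x - Y w) * f x \<partial>lborel) \<partial>M)"
    by (simp add: heat_eq_lborel)
  also have "\<dots> = (\<integral>x. (\<integral>w. gauss_density \<epsilon> (x - Y w) * f x \<partial>M) \<partial>lborel)"
    by (rule P.Fubini_integral[OF i])
  also have "\<dots> = (\<integral>x. f x * smoothed_density Y \<epsilon> x \<partial>lborel)"
    by (simp add: smoothed_density_def mult.commute)
  finally show ?thesis .
qed

text \<open>The smoothed densities are given by the inversion integral with a Gaussian weight. By
  dominated convergence they tend to \<open>p\<close> and are bounded uniformly, which identifies
  \<open>p\<close> as the density against compactly supported test functions and thereby on
  boxes.\<close>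

theorem smooth_density_of_rapid_char:
  fixes Y :: "'a \<Rightarrow> real ^ 'd"
  assumes Y[measurable]: "Y \<in> borel_measurable M"
    and c: "rapid_decay (char_cos Y)" and s: "rapid_decay (char_sin Y)"
  shows "\<exists>p. (\<forall>x. 0 \<le> p x) \<and> distributed M lborel Y (\<lambda>x. ennreal (p x)) \<and> smooth p"
proof -
  let ?k = "inversion_const TYPE('d)"
  let ?h = "\<lambda>x \<xi>. cos (\<xi> \<bullet> x) * char_cos Y \<xi> + sin (\<xi> \<bullet> x) * char_sin Y \<xi>"
  define p where "p = trig_integral (\<lambda>\<xi>. ?k * char_cos Y \<xi>) (\<lambda>\<xi>. ?k * char_sin Y \<xi>)"
  note [measurable] = rapid_decay_measurable[OF c] rapid_decay_measurable[OF s]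
  have p_eq: "p x = ?k * (\<integral>\<xi>. ?h x \<xi> \<partial>lborel)" for x
    unfolding p_def trig_integral_def by (subst integral_mult_right_zero[symmetric]) (simp add: algebra_simps)
  have smooth: "smooth p"
    unfolding smooth_def p_def by (intro allI trig_integral_Ck rapid_decay_cmult c s)
  have cont: "continuous_on UNIV p"
    using smooth unfolding smooth_def by (metis Ck.simps(1))
  have [measurable]: "p \<in> borel_measurable borel" by (rule borel_measurable_continuous_onI[OF cont])
  define \<epsilon> where "\<epsilon> n = 1 / real (Suc n)" for n
  have \<epsilon>: "0 < \<epsilon> n" for n by (simp add: \<epsilon>_def)
  let ?w = "\<lambda>\<xi>. \<bar>char_cos Y \<xi>\<bar> + \<bar>char_sin Y \<xi>\<bar>"
  let ?e = "\<lambda>n \<xi>. exp (- \<epsilon> n * (norm (\<xi>::real ^ 'd))\<^sup>2 / 2)"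
  define B where "B = ?k * (\<integral>\<xi>. ?w \<xi> \<partial>lborel)"
  have w: "integrable lborel ?w"
    using rapid_decay_integrable[OF c] rapid_decay_integrable[OF s] by auto
  have ew: "norm (?e n \<xi> * ?h x \<xi>) \<le> ?w \<xi>" for n x \<xi>
  proof -
    have "norm (?e n \<xi> * ?h x \<xi>) \<le> 1 * ?w \<xi>"
      unfolding norm_mult using \<epsilon>[of n] abs_trig_le by (intro mult_mono) auto
    then show ?thesis by simp
  qed
  have dens_eq: "smoothed_density Y (\<epsilon> n) x = ?k * (\<integral>\<xi>. ?e n \<xi> * ?h x \<xi> \<partial>lborel)" for n x
    by (rule smoothed_density_eq[OF Y \<epsilon>])
  have dens_le: "\<bar>smoothed_density Y (\<epsilon> n) x\<bar> \<le> B" for n x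
  proof -
    have "norm (\<integral>\<xi>. ?e n \<xi> * ?h x \<xi> \<partial>lborel) \<le> (\<integral>\<xi>. ?w \<xi> \<partial>lborel)"
      by (rule norm_integral_le[OF _ w ew]) measurable
    then show ?thesis
      unfolding dens_eq B_def by (simp add: abs_mult mult_left_mono)
  qed
  have dens_nonneg: "0 \<le> smoothed_density Y (\<epsilon> n) x" for n x
    unfolding smoothed_density_def by (intro Bochner_Integration.integral_nonneg) simp
  have dens_meas[measurable]: "smoothed_density Y e \<in> borel_measurable borel" for e
    unfolding smoothed_density_def[abs_def] by measurable
  have lim: "(\<lambda>n. smoothed_density Y (\<epsilon> n) x) \<longlonglongrightarrow> p x" for x
  proof -
    have "(\<lambda>n. \<integral>\<xi>. ?e n \<xi> * ?h x \<xi> \<partial>lborel) \<longlonglongrightarrow> (\<integral>\<xi>. ?h x \<xi> \<partial>lborel)"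
    proof (rule integral_dominated_convergence[OF _ _ w])
      have \<epsilon>0: "\<epsilon> \<longlonglongrightarrow> 0"
        unfolding \<epsilon>_def using LIMSEQ_Suc[OF lim_1_over_n] by simp
      have "(\<lambda>n. ?e n \<xi> * ?h x \<xi>) \<longlonglongrightarrow> exp (- 0 * (norm \<xi>)\<^sup>2 / 2) * ?h x \<xi>" for \<xi>
        by (intro tendsto_intros \<epsilon>0) simp
      then show "AE \<xi> in lborel. (\<lambda>n. ?e n \<xi> * ?h x \<xi>) \<longlonglongrightarrow> ?h x \<xi>" by simp
      show "AE \<xi> in lborel. norm (?e n \<xi> * ?h x \<xi>) \<le> ?w \<xi>" for n
        using ew by simp
    qed measurable
    then show ?thesis unfolding dens_eq p_eq by (rule tendsto_mult_left)
  qed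
  have p_nonneg: "0 \<le> p x" for x
    by (rule LIMSEQ_le_const[OF lim]) (use dens_nonneg in auto)
  have p_le: "\<bar>p x\<bar> \<le> B" for x
    by (rule LIMSEQ_le_const2[OF tendsto_rabs[OF lim]]) (use dens_le in auto)

  \<comment> \<open>Restricting the test functions to a box lets a constant bound on the densities
    serve as majorant; integrability of \<open>p\<close> over the whole space is not yet
    known.\<close>
  have test: "(\<integral>w. f (Y w) \<partial>M) = (\<integral>x. f x * p x \<partial>lborel)"
    if fc: "continuous_on UNIV f" and fb: "\<And>x. \<bar>f x\<bar> \<le> indicator (box a b) x" for f :: "real ^ 'd \<Rightarrow> real" and a b
  proof -
    have [measurable]: "f \<in> borel_measurable borel" by (rule borel_measurable_continuous_onI[OF fc])
    have f1: "norm (f x) \<le> 1" for x using order_trans[OF fb indicator_le_1, of x] by simp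
    have eq: "(\<integral>w. heat (\<epsilon> n) f (Y w) \<partial>M) = (\<integral>x. f x * smoothed_density Y (\<epsilon> n) x \<partial>lborel)" for n
      by (rule expectation_heat_eq[OF Y \<epsilon> _ fb]) measurable
    have "(\<lambda>n. \<integral>w. heat (\<epsilon> n) f (Y w) \<partial>M) \<longlonglongrightarrow> (\<integral>w. f (Y w) \<partial>M)"
    proof (rule integral_dominated_convergence[where w="\<lambda>_. 1"])
      have [measurable]: "heat (\<epsilon> n) f \<in> borel_measurable borel" for n
        by (rule borel_measurable_continuous_onI[OF heat_continuous[OF \<epsilon> _ f1]]) measurable
      show "(\<lambda>w. heat (\<epsilon> n) f (Y w)) \<in> borel_measurable M" for n by measurable
      have "(\<lambda>n. heat (\<epsilon> n) f x) \<longlonglongrightarrow> f x" for x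
        unfolding \<epsilon>_def
        by (rule filterlim_compose[OF heat_tendsto[OF fc f1] filterlim_inverse_Suc_at_right])
      then show "AE w in M. (\<lambda>n. heat (\<epsilon> n) f (Y w)) \<longlonglongrightarrow> f (Y w)" by simp
      show "AE w in M. norm (heat (\<epsilon> n) f (Y w)) \<le> 1" for n
        by (intro AE_I2 heat_norm_le[OF \<epsilon> _ f1]) measurable
    qed auto
    moreover have "(\<lambda>n. \<integral>x. f x * smoothed_density Y (\<epsilon> n) x \<partial>lborel) \<longlonglongrightarrow> (\<integral>x. f x * p x \<partial>lborel)"
    proof (rule integral_dominated_convergence[where w="\<lambda>x. indicator (box a b) x * B"])
      show "integrable lborel (\<lambda>x. indicator (box a b) x * B)"
        by (intro integrable_mult_left integrable_real_indicator) (auto simp: emeasure_lborel_box_eq)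
      show "AE x in lborel. (\<lambda>n. f x * smoothed_density Y (\<epsilon> n) x) \<longlonglongrightarrow> f x * p x"
        by (intro AE_I2 tendsto_mult_left lim)
      show "AE x in lborel. norm (f x * smoothed_density Y (\<epsilon> n) x) \<le> indicator (box a b) x * B" for n
        unfolding real_norm_def abs_mult by (intro AE_I2 mult_mono fb dens_le) auto
    qed measurable
    ultimately show ?thesis
      unfolding eq by (rule LIMSEQ_unique)
  qed

  have box: "emeasure (distr M borel Y) (box a b) = emeasure (density lborel (\<lambda>x. ennreal (p x))) (box a b)" for a b
  proof -
    \<comment> \<open>Continuous functions supported in the closure of the box that increase to the
      indicator of the open box: the distance to the complement is positive exactly inside.\<close>
    define f where "f n x = min 1 (real n * infdist x (- box a b))" for n and x :: "real ^ 'd"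
    have ne: "- box a b \<noteq> {}" using bounded_box[of a b] not_bounded_UNIV by (metis Compl_empty_eq double_complement)
    have fc: "continuous_on UNIV (f n)" for n
      unfolding f_def by (intro continuous_intros)
    have [measurable]: "f n \<in> borel_measurable borel" for n by (rule borel_measurable_continuous_onI[OF fc])
    have fb: "\<bar>f n x\<bar> \<le> indicator (box a b) x" for n x
      using infdist_nonneg[of x "- box a b"] by (auto simp: f_def indicator_def)
    have fl: "(\<lambda>n. f n x) \<longlonglongrightarrow> indicator (box a b) x" for x
    proof (cases "x \<in> box a b")
      case True
      have d: "0 < infdist x (- box a b)"
        by (rule infdist_pos_not_in_closed) (use True ne open_box in auto)
      obtain N where N: "1 / infdist x (- box a b) < real N" using reals_Archimedean2 by blast
      have "f n x = 1" if "N \<le> n" for n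
      proof -
        have "1 < real N * infdist x (- box a b)" using N d by (simp add: field_simps)
        also have "\<dots> \<le> real n * infdist x (- box a b)" using that d by (intro mult_right_mono) auto
        finally show ?thesis by (simp add: f_def)
      qed
      then have "\<forall>\<^sub>F n in sequentially. f n x = 1" by (auto simp: eventually_sequentially)
      then show ?thesis using True by (simp add: tendsto_eventually)
    next
      case False
      then have "f n x = 0" for n by (simp add: f_def)
      then show ?thesis using False by simp
    qed
    have "(\<lambda>n. \<integral>w. f n (Y w) \<partial>M) \<longlonglongrightarrow> (\<integral>w. indicator (box a b) (Y w) \<partial>M)"
    proof (rule integral_dominated_convergence[where w="\<lambda>_. 1"])
      show "AE w in M. norm (f n (Y w)) \<le> 1" for n
        by (intro AE_I2 order_trans[OF _ indicator_le_1]) (use fb in auto)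
    qed (use fl in auto)
    moreover have "(\<lambda>n. \<integral>x. f n x * p x \<partial>lborel) \<longlonglongrightarrow> (\<integral>x. indicator (box a b) x * p x \<partial>lborel)"
    proof (rule integral_dominated_convergence[where w="\<lambda>x. indicator (box a b) x * B"])
      show "integrable lborel (\<lambda>x. indicator (box a b) x * B)"
        by (intro integrable_mult_left integrable_real_indicator) (auto simp: emeasure_lborel_box_eq)
      show "AE x in lborel. (\<lambda>n. f n x * p x) \<longlonglongrightarrow> indicator (box a b) x * p x"
        by (intro AE_I2 tendsto_mult_right fl)
      show "AE x in lborel. norm (f n x * p x) \<le> indicator (box a b) x * B" for n
        unfolding real_norm_def abs_mult by (intro AE_I2 mult_mono fb p_le) auto
    qed measurable
    ultimately have eq: "(\<integral>w. indicator (box a b) (Y w) \<partial>M) = (\<integral>x. indicator (box a b) x * p x \<partial>lborel)"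
      unfolding test[OF fc fb] by (rule LIMSEQ_unique)
    have ip: "integrable lborel (\<lambda>x. indicator (box a b) x * p x)"
    proof -
      have "integrable lborel (\<lambda>x. indicator (box a b) x *\<^sub>R p x)"
        by (rule integrableI_bounded_set_indicator[of _ _ _ B]) (use p_le in \<open>auto simp: emeasure_lborel_box_eq\<close>)
      then show ?thesis by simp
    qed
    have "emeasure (distr M borel Y) (box a b) = emeasure M (Y -` box a b \<inter> space M)"
      by (subst emeasure_distr) auto
    also have "\<dots> = ennreal (measure M (Y -` box a b \<inter> space M))"
      by (rule emeasure_eq_measure)
    also have "measure M (Y -` box a b \<inter> space M) = (\<integral>w. indicator (Y -` box a b \<inter> space M) w \<partial>M)"
      by simp
    also have "\<dots> = (\<integral>w. indicator (box a b) (Y w) \<partial>M)"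
      by (rule Bochner_Integration.integral_cong) (auto simp: indicator_def)
    also have "ennreal \<dots> = (\<integral>\<^sup>+x. ennreal (indicator (box a b) x * p x) \<partial>lborel)"
      unfolding eq by (rule nn_integral_eq_integral[OF ip, symmetric]) (use p_nonneg in auto)
    also have "\<dots> = emeasure (density lborel (\<lambda>x. ennreal (p x))) (box a b)"
      by (subst emeasure_density) (auto intro!: nn_integral_cong simp: indicator_def)
    finally show ?thesis .
  qed
  have "distr M lborel Y = distr M borel Y" by (rule distr_cong) auto
  also have "\<dots> = density lborel (\<lambda>x. ennreal (p x))"
  proof (rule measure_eqI_generator_eq)
    let ?E = "range (\<lambda>(a, b). box a b :: (real ^ 'd) set)"
    show "Int_stable ?E" by (auto simp: Int_stable_def box_Int_box)
    show "?E \<subseteq> Pow UNIV" "sets (distr M borel Y) = sigma_sets UNIV ?E"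
      "sets (density lborel (\<lambda>x. ennreal (p x))) = sigma_sets UNIV ?E"
      by (simp_all add: borel_eq_box)
    let ?A = "\<lambda>n::nat. box (- (real n *\<^sub>R One)) (real n *\<^sub>R One) :: (real ^ 'd) set"
    show "range ?A \<subseteq> ?E" "(\<Union>i. ?A i) = UNIV"
      unfolding UN_box_eq_UNIV by auto
    show "emeasure (distr M borel Y) (?A i) \<noteq> \<infinity>" for i
      by (subst emeasure_distr) (auto simp: emeasure_eq_measure)
    show "emeasure (distr M borel Y) X = emeasure (density lborel (\<lambda>x. ennreal (p x))) X" if "X \<in> ?E" for X
      using that box by auto
  qed
  finally have "distributed M lborel Y (\<lambda>x. ennreal (p x))"
    by (simp add: distributed_def)
  then show ?thesis
    using p_nonneg smooth by blast
qed

end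

section \<open>The McKean-Vlasov equation\<close>

lemma fdiff_antiperiodic:
  fixes f :: "'a::real_normed_vector \<Rightarrow> real"
  assumes "\<And>x. f (x + h) = - f x"
  shows "(fdiff h ^^ m) f x = (- 2) ^ m * f x"
proof (induction m arbitrary: x)
  case (Suc m)
  have "(fdiff h ^^ Suc m) f x = (fdiff h ^^ m) f (x + h) - (fdiff h ^^ m) f x"
    by (simp add: fdiff_apply[of h "(fdiff h ^^ m) f"])
  then show ?case
    using assms by (simp add: Suc.IH)
qed simp

context prob_space
begin

text \<open>A shift by \<open>h\<close> changes the sign of \<open>g (\<xi> \<bullet> x)\<close>, so
  \<open>2 * N\<close> differences multiply it by \<open>4 ^ N\<close>, whereas dual regularity
  bounds the result by a multiple of \<open>sqrt (norm h) ^ (2 * N) = norm h ^ N\<close>, with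
  \<open>norm h = pi / norm \<xi>\<close>.\<close>

lemma rapid_decay_trig:
  fixes Y :: "'a \<Rightarrow> real ^ 'd" and g :: "real \<Rightarrow> real"
  assumes [measurable]: "Y \<in> borel_measurable M"
    and reg: "\<And>m. \<exists>C\<ge>0. \<forall>h. norm h \<le> 1 \<longrightarrow> dual_regular Y m C h"
    and g: "\<And>a. g (a + pi) = - g a" "\<And>a. \<bar>g a\<bar> \<le> 1" "continuous_on UNIV g"
  shows "rapid_decay (\<lambda>\<xi>. \<integral>w. g (\<xi> \<bullet> Y w) \<partial>M)"
  unfolding rapid_decay_def
proof (intro conjI allI)
  have [measurable]: "g \<in> borel_measurable borel" by (rule borel_measurable_continuous_onI[OF g(3)])
  show "(\<lambda>\<xi>. \<integral>w. g (\<xi> \<bullet> Y w) \<partial>M) \<in> borel_measurable borel" by measurable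
  have le1: "\<bar>\<integral>w. g (\<xi> \<bullet> Y w) \<partial>M\<bar> \<le> 1" for \<xi>
  proof -
    have "norm (\<integral>w. g (\<xi> \<bullet> Y w) \<partial>M) \<le> (\<integral>w. 1 \<partial>M)"
      by (rule norm_integral_le) (use g(2) in auto)
    then show ?thesis by (simp add: prob_space)
  qed
  fix N
  obtain C where C: "0 \<le> C" "\<And>h. norm h \<le> 1 \<Longrightarrow> dual_regular Y (2 * N) C h"
    using reg[of "2 * N"] by blast
  have "\<bar>\<integral>w. g (\<xi> \<bullet> Y w) \<partial>M\<bar> * norm \<xi> ^ N \<le> max 1 C * pi ^ N" for \<xi>
  \<comment> \<open>Regularity is available only for \<open>norm h \<le> 1\<close>, that is for
    \<open>norm \<xi> \<ge> pi\<close>; smaller frequencies are covered by the trivial bound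
    1.\<close>
  proof (cases "norm \<xi> \<le> pi")
    case True
    have "\<bar>\<integral>w. g (\<xi> \<bullet> Y w) \<partial>M\<bar> * norm \<xi> ^ N \<le> 1 * pi ^ N"
      using True le1 by (intro mult_mono power_mono) auto
    also have "\<dots> \<le> max 1 C * pi ^ N" by (intro mult_right_mono) auto
    finally show ?thesis .
  next
    case False
    then have n: "pi < norm \<xi>" "0 < norm \<xi>" using pi_gt_zero by linarith+
    define h where "h = (pi / (norm \<xi>)\<^sup>2) *\<^sub>R \<xi>"
    have h: "\<xi> \<bullet> h = pi" "norm h = pi / norm \<xi>"
      using n by (auto simp: h_def power2_norm_eq_inner[symmetric]) (simp add: power2_eq_square)
    have h1: "norm h \<le> 1" using n h by simp
    have fd: "(fdiff h ^^ (2 * N)) (\<lambda>x. g (\<xi> \<bullet> x)) x = (- 2) ^ (2 * N) * g (\<xi> \<bullet> x)" for x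
      by (rule fdiff_antiperiodic) (simp add: inner_add_right h g(1))
    have "continuous_on UNIV (\<lambda>x. g (\<xi> \<bullet> x))"
      by (intro continuous_on_compose2[OF g(3)] continuous_intros) auto
    from dual_regularD[OF C(2)[OF h1] order_refl this g(2)]
    have "4 ^ N * \<bar>\<integral>w. g (\<xi> \<bullet> Y w) \<partial>M\<bar> \<le> C * (pi / norm \<xi>) ^ N"
      using n by (simp add: fd h power_mult abs_mult)
    moreover have "1 * \<bar>\<integral>w. g (\<xi> \<bullet> Y w) \<partial>M\<bar> \<le> 4 ^ N * \<bar>\<integral>w. g (\<xi> \<bullet> Y w) \<partial>M\<bar>"
      by (intro mult_right_mono) auto
    ultimately have "\<bar>\<integral>w. g (\<xi> \<bullet> Y w) \<partial>M\<bar> \<le> C * (pi / norm \<xi>) ^ N" by linarith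
    then have "\<bar>\<integral>w. g (\<xi> \<bullet> Y w) \<partial>M\<bar> * norm \<xi> ^ N \<le> C * pi ^ N"
      using n by (simp add: power_divide field_simps)
    also have "\<dots> \<le> max 1 C * pi ^ N" by (intro mult_right_mono) auto
    finally show ?thesis .
  qed
  then show "\<exists>C. \<forall>\<xi>. \<bar>\<integral>w. g (\<xi> \<bullet> Y w) \<partial>M\<bar> * norm \<xi> ^ N \<le> C" by blast
qed

end

lemma (in mean_field_brownian) smooth_density:
  assumes "0 < t"
  shows "\<exists>p. (\<forall>x. 0 \<le> p x) \<and> distributed M lborel (X t) (\<lambda>x. ennreal (p x)) \<and> smooth p"
proof -
  have reg: "\<exists>C\<ge>0. \<forall>h. norm h \<le> 1 \<longrightarrow> dual_regular (X t) m C h" for m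
    using dual_regular_all[OF assms order_refl, of m] by blast
  show ?thesis
  proof (rule smooth_density_of_rapid_char[OF X_measurable])
    show "rapid_decay (char_cos (X t))"
      unfolding char_cos_def[abs_def]
      by (rule rapid_decay_trig[OF X_measurable reg]) (auto intro: continuous_intros)
    show "rapid_decay (char_sin (X t))"
      unfolding char_sin_def[abs_def]
      by (rule rapid_decay_trig[OF X_measurable reg]) (auto intro: continuous_intros)
  qed
qed

section \<open>From the hypotheses of the theorem to the locale\<close>

lemma Cb1_norm_bound:
  fixes f :: "'a::euclidean_space \<Rightarrow> 'b::euclidean_space"
  assumes f: "f \<in> Cb1"
  shows "norm (f x) \<le> Cb1_norm f"
proof -
  have d: "f differentiable (at x)" for x
    using f by (simp add: Cb1_def)
  have "norm (f x) \<le> (SUP x. norm (f x))"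
  proof (rule cSUP_upper)
    show "bdd_above (range (\<lambda>x. norm (f x)))"
      using f by (auto simp: Cb1_def bounded_iff bdd_above_def)
  qed simp
  moreover have "0 \<le> (SUP x. onorm (frechet_derivative f (at x)))"
  proof (rule order_trans)
    show "0 \<le> onorm (frechet_derivative f (at 0))"
      using d[of 0] by (intro onorm_pos_le has_derivative_bounded_linear) (simp add: frechet_derivative_works)
    show "onorm (frechet_derivative f (at 0)) \<le> (SUP x. onorm (frechet_derivative f (at x)))"
    proof (rule cSUP_upper)
      show "bdd_above (range (\<lambda>x. onorm (frechet_derivative f (at x))))"
        using f by (auto simp: Cb1_def intro: bounded_imp_bdd_above)
    qed simp
  qed
  ultimately show ?thesis by (simp add: Cb1_norm_def)
qed

lemma Cb1_continuous:
  fixes f :: "'a::euclidean_space \<Rightarrow> 'b::euclidean_space"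
  shows "f \<in> Cb1 \<Longrightarrow> continuous_on UNIV f"
  by (simp add: Cb1_def continuous_at_imp_continuous_on differentiable_imp_continuous_within)

lemma continuous_process_measurable:
  fixes X :: "real \<Rightarrow> 'w \<Rightarrow> 'b::metric_space"
  assumes X[measurable]: "\<And>q. X q \<in> borel_measurable M"
    and c: "\<And>w. w \<in> space M \<Longrightarrow> continuous_on {0..} (\<lambda>q. X q w)"
    and neg: "\<And>q w. q < 0 \<Longrightarrow> X q w = z"
  shows "(\<lambda>(q, w). X q w) \<in> borel_measurable (borel \<Otimes>\<^sub>M M)"
proof (rule borel_measurable_LIMSEQ_metric)
  \<comment> \<open>Times are rounded down to a grid, which makes the approximations countable in
    time. Rounding down keeps nonnegative times nonnegative, where continuity applies, and negative
    times negative, where the process is constant.\<close>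
  let ?d = "\<lambda>n q. real_of_int \<lfloor>real (Suc n) * q\<rfloor> / real (Suc n)"
  show "(\<lambda>p. X (?d n (fst p)) (snd p)) \<in> borel_measurable (borel \<Otimes>\<^sub>M M)" for n
  proof (rule measurable_compose_countable[where f="\<lambda>k p. X (real_of_int k / real (Suc n)) (snd p)" and g="\<lambda>p. \<lfloor>real (Suc n) * fst p\<rfloor>"])
    show "(\<lambda>p. X (real_of_int k / real (Suc n)) (snd p)) \<in> borel_measurable (borel \<Otimes>\<^sub>M M)" for k
      by (rule measurable_compose[OF measurable_snd X])
    show "(\<lambda>p. \<lfloor>real (Suc n) * fst p\<rfloor>) \<in> borel \<Otimes>\<^sub>M M \<rightarrow>\<^sub>M count_space UNIV"
      by measurable
  qed
  have lim: "(\<lambda>n. ?d n q) \<longlonglongrightarrow> q" for q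
  proof (rule tendsto_sandwich[of "\<lambda>n. q - 1 / real (Suc n)" _ _ "\<lambda>_. q"])
    have "q - 1 / real (Suc n) \<le> ?d n q" for n
    proof -
      have "q - 1 / real (Suc n) = (real (Suc n) * q - 1) / real (Suc n)"
        by (simp add: diff_divide_distrib)
      also have "\<dots> \<le> ?d n q"
        using floor_correct[of "real (Suc n) * q"] by (intro divide_right_mono) linarith+
      finally show ?thesis .
    qed
    then show "\<forall>\<^sub>F n in sequentially. q - 1 / real (Suc n) \<le> ?d n q" by simp
    have "?d n q \<le> q" for n
      using of_int_floor_le[of "real (Suc n) * q"] by (simp add: field_simps)
    then show "\<forall>\<^sub>F n in sequentially. ?d n q \<le> q" by simp
    have "(\<lambda>n. q - 1 / real (Suc n)) \<longlonglongrightarrow> q - 0"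
      by (intro tendsto_diff tendsto_const LIMSEQ_Suc[OF lim_1_over_n])
    then show "(\<lambda>n. q - 1 / real (Suc n)) \<longlonglongrightarrow> q" by simp
  qed simp
  fix p assume "p \<in> space ((borel :: real measure) \<Otimes>\<^sub>M M)"
  then obtain q w where p: "p = (q, w)" "w \<in> space M" by (auto simp: space_pair_measure)
  have "(\<lambda>n. X (?d n q) w) \<longlonglongrightarrow> X q w"
  proof (cases "0 \<le> q")
    case True
    then have "0 \<le> ?d n q" for n by simp
    then show ?thesis
      using True by (intro continuous_on_tendsto_compose[OF c[OF p(2)] lim]) auto
  next
    case False
    have "?d n q < 0" for n
    proof -
      have "real (Suc n) * q < 0" using False by (simp add: mult_pos_neg)
      then have "\<lfloor>real (Suc n) * q\<rfloor> < 0" by simp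
      then show ?thesis by (simp add: divide_neg_pos)
    qed
    then have "X (?d n q) w = z" for n by (rule neg)
    then show ?thesis using neg[of q w] False by simp
  qed
  then show "(\<lambda>n. X (?d n (fst p)) (snd p)) \<longlonglongrightarrow> (\<lambda>(q, w). X q w) p" by (simp add: p)
qed

lemma (in prob_space) indep_var_of_filtration:
  assumes F: "sets F \<subseteq> sets M" "space F = space M"
    and U: "U \<in> borel_measurable F" and Z: "Z \<in> borel_measurable M"
    and indep: "indep_set (sets F) (sets (vimage_algebra (space M) Z borel))"
  shows "indep_var borel U borel Z"
proof -
  have U': "U \<in> borel_measurable M"
    using U measurable_mono[of borel borel F M] F by auto
  have sub: "sigma_sets (space M) {U -` A \<inter> space M | A. A \<in> sets borel} \<subseteq> sets F"
    using measurable_sets[OF U] F(2) by (intro sets.sigma_sets_subset[of _ F, unfolded F(2)]) auto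
  show ?thesis
    unfolding indep_var_eq
  proof (intro conjI U' Z)
    show "indep_set (sigma_sets (space M) {U -` A \<inter> space M | A. A \<in> sets borel})
        (sigma_sets (space M) {Z -` A \<inter> space M | A. A \<in> sets borel})"
      using indep sub unfolding indep_sets2_eq sets_vimage_algebra by blast
  qed
qed

theorem theorem1p2:
  fixes M :: "'w measure" and F :: "real \<Rightarrow> 'w measure"
    and b :: "real \<Rightarrow> real ^ 'd \<Rightarrow> real ^ 'd"
    and \<mu>0 :: "(real ^ 'd) measure"
    and W X :: "real \<Rightarrow> 'w \<Rightarrow> real ^ 'd"
  assumes "(\<lambda>(t, x). b t x) \<in> borel_measurable (restrict_space borel {0..} \<Otimes>\<^sub>M borel)"
    and "\<And>t. t > 0 \<Longrightarrow> b t \<in> Cb1"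
    and "(\<lambda>t. Cb1_norm (b t)) \<in> Linfty_on {0..}"
    and "prob_space \<mu>0" and "sets \<mu>0 = sets borel"
    and "filtered_prob_space M F"
    and "brownian_motion M F W"
    and "indep_of_process M (X 0) W"
    and "McKean_Vlasov_solution M F b \<mu>0 W X"
  shows "\<forall>t>0. \<exists>p :: real ^ 'd \<Rightarrow> real.
           (\<forall>x. 0 \<le> p x) \<and> distributed M lborel (X t) (\<lambda>x. ennreal (p x)) \<and> smooth p"
proof -
  interpret prob_space M using assms(6) by (simp add: filtered_prob_space_def)
  have F: "sets (F t) \<subseteq> sets M" "space (F t) = space M" for t
  proof -
    have f: "filtration (space M) F" and s: "\<forall>t. sets (F t) \<subseteq> sets M"
      using assms(6) by (simp_all add: filtered_prob_space_def)
    show "sets (F t) \<subseteq> sets M" using s by blast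
    show "space (F t) = space M" by (rule filtration.space_F[OF f])
  qed
  have FM: "f \<in> borel_measurable M" if "f \<in> borel_measurable (F t)" for f :: "'w \<Rightarrow> real ^ 'd" and t
    by (rule subsetD[OF measurable_mono that]) (use F in auto)
  have XF: "X t \<in> borel_measurable (F t)" and WF: "W t \<in> borel_measurable (F t)" if "0 \<le> t" for t
    using that assms(7,9) by (auto simp: McKean_Vlasov_solution_def brownian_motion_def adapted_to_def)
  have XM: "X t \<in> borel_measurable M" and WM: "W t \<in> borel_measurable M" if "0 \<le> t" for t
    by (rule FM[OF XF[OF that]], rule FM[OF WF[OF that]])

  obtain N0 where N0: "N0 \<in> null_sets M" "\<And>w. w \<in> space M \<Longrightarrow> w \<notin> N0 \<Longrightarrow> continuous_on {0..} (\<lambda>t. X t w)"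
  proof -
    have "AE w in M. continuous_on {0..} (\<lambda>t. X t w)"
      using assms(9) by (simp add: McKean_Vlasov_solution_def continuous_paths_def)
    then show thesis using that by (fastforce simp: eventually_ae_filter)
  qed
  have [measurable]: "N0 \<in> sets M" using N0(1) by auto
  \<comment> \<open>A modification of \<open>X\<close> without exceptional paths, hence jointly measurable.\<close>
  define X' where "X' q w = (if 0 \<le> q \<and> w \<notin> N0 then X q w else 0)" for q w
  have X'_meas: "X' q \<in> borel_measurable M" for q
  proof (cases "0 \<le> q")
    case True
    note [measurable] = XM[OF True]
    show ?thesis using True unfolding X'_def[abs_def] by simp
  qed (simp add: X'_def[abs_def])
  have X'2[measurable]: "(\<lambda>(q, w). X' q w) \<in> borel_measurable (borel \<Otimes>\<^sub>M M)"
  proof (rule continuous_process_measurable[OF X'_meas])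
    fix w assume w: "w \<in> space M"
    show "continuous_on {0..} (\<lambda>q. X' q w)"
    proof (cases "w \<in> N0")
      case False
      have "continuous_on {0..} (\<lambda>q. X' q w) \<longleftrightarrow> continuous_on {0..} (\<lambda>q. X q w)"
        by (rule continuous_on_cong) (auto simp: X'_def False)
      then show ?thesis using N0(2)[OF w False] by simp
    qed (simp add: X'_def)
  qed (simp add: X'_def)
  have X'_AE: "AE w in M. X' q w = X q w" if "0 \<le> q" for q
    using AE_not_in[OF N0(1)] by eventually_elim (simp add: X'_def that)

  \<comment> \<open>The essential bound refers to Lebesgue measure. It is transferred to
    \<open>lborel\<close>, so that the exceptional set of times can be taken Borel; time 0 is left
    out because membership in \<open>Cb1\<close> is assumed for positive times only.\<close>
  obtain K Nb where K: "0 \<le> K" and Nb: "Nb \<in> null_sets lborel"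
    and b_bound: "\<And>q x. 0 < q \<Longrightarrow> q \<notin> Nb \<Longrightarrow> norm (b q x) \<le> K"
  proof -
    obtain C where C: "AE t in lebesgue_on {0..}. \<bar>Cb1_norm (b t)\<bar> \<le> C"
      using assms(3) by (auto simp: Linfty_on_def)
    have "AE t in lebesgue. t \<in> {0..} \<longrightarrow> \<bar>Cb1_norm (b t)\<bar> \<le> C"
      using C by (subst (asm) AE_restrict_space_iff) auto
    then have "AE t in lborel. t \<in> {0..} \<longrightarrow> \<bar>Cb1_norm (b t)\<bar> \<le> C"
      by (simp add: AE_completion_iff)
    then obtain N where N: "N \<in> null_sets lborel" "{t. \<not> (t \<in> {0..} \<longrightarrow> \<bar>Cb1_norm (b t)\<bar> \<le> C)} \<subseteq> N"
      by (auto simp: eventually_ae_filter)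
    have "norm (b q x) \<le> max 0 C" if "0 < q" "q \<notin> N" for q x
    proof -
      have "\<bar>Cb1_norm (b q)\<bar> \<le> C" using subsetD[OF N(2), of q] that by auto
      then show ?thesis using Cb1_norm_bound[OF assms(2)[OF that(1)], of x] by simp
    qed
    then show thesis using that[of "max 0 C" N] N(1) by auto
  qed
  have [measurable]: "Nb \<in> sets borel" using Nb by auto

  \<comment> \<open>Measurability of \<open>b\<close> is only given for \<open>t \<ge> 0\<close>.\<close>
  define b' where "b' q = b (max 0 q)" for q
  have b'_meas[measurable]: "(\<lambda>(q, x). b' q x) \<in> borel_measurable (borel \<Otimes>\<^sub>M borel)"
  proof -
    have "(\<lambda>p. (max 0 (fst p), snd p)) \<in> borel \<Otimes>\<^sub>M (borel :: (real ^ 'd) measure) \<rightarrow>\<^sub>M restrict_space borel {0::real..} \<Otimes>\<^sub>M borel"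
      by (intro measurable_Pair measurable_restrict_space2) auto
    from measurable_compose[OF this assms(1)] show ?thesis
      by (simp add: b'_def split_beta')
  qed
  \<comment> \<open>The drift is set to 0 at exceptional and nonpositive times, so that its bound
    holds everywhere. The law enters through an integral over a second copy \<open>w'\<close> of the
    sample point, which reduces joint measurability to that of a parameter integral.\<close>
  define V where "V q w = indicator ({0<..} - Nb) q *\<^sub>R (\<integral>w'. b' q (X' q w - X' q w') \<partial>M)" for q w
  have good: "b' q = b q" "V q w = (\<integral>w'. b q (X' q w - X' q w') \<partial>M)" if "0 < q" "q \<notin> Nb" for q w
    using that by (simp_all add: b'_def V_def max_def)
  have V2: "(\<lambda>(q, w). V q w) \<in> borel_measurable (borel \<Otimes>\<^sub>M M)"
  proof -
    have 1: "(\<lambda>r. X' (fst (fst r)) (snd (fst r))) \<in> borel_measurable ((borel \<Otimes>\<^sub>M M) \<Otimes>\<^sub>M M)"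
      using measurable_compose[OF measurable_fst X'2] by (simp add: split_beta')
    have 2: "(\<lambda>r. X' (fst (fst r)) (snd r)) \<in> borel_measurable ((borel \<Otimes>\<^sub>M M) \<Otimes>\<^sub>M M)"
      using measurable_compose[of "\<lambda>r. (fst (fst r), snd r)" "(borel \<Otimes>\<^sub>M M) \<Otimes>\<^sub>M M" "borel \<Otimes>\<^sub>M M", OF _ X'2] by simp
    have "(\<lambda>r. b' (fst (fst r)) (X' (fst (fst r)) (snd (fst r)) - X' (fst (fst r)) (snd r))) \<in> borel_measurable ((borel \<Otimes>\<^sub>M M) \<Otimes>\<^sub>M M)"
      using measurable_compose[of "\<lambda>r. (fst (fst r), X' (fst (fst r)) (snd (fst r)) - X' (fst (fst r)) (snd r))"
          "(borel \<Otimes>\<^sub>M M) \<Otimes>\<^sub>M M" "borel \<Otimes>\<^sub>M borel", OF _ b'_meas] 1 2 by simp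
    then have "(\<lambda>p. \<integral>w'. b' (fst p) (X' (fst p) (snd p) - X' (fst p) w') \<partial>M) \<in> borel_measurable (borel \<Otimes>\<^sub>M M)"
      by (intro borel_measurable_lebesgue_integral) (simp add: split_beta')
    then show ?thesis
      unfolding V_def split_beta' by measurable
  qed
  have V_bound: "norm (V q w) \<le> K" for q w
  proof (cases "0 < q \<and> q \<notin> Nb")
    case True
    have "norm (V q w) \<le> (\<integral>w'. norm (b q (X' q w - X' q w')) \<partial>M)"
      using True good by (simp add: integral_norm_bound)
    also have "\<dots> \<le> (\<integral>w'. K \<partial>M)"
      by (rule integral_mono') (use True b_bound K in auto)
    finally show ?thesis by (simp add: prob_space)
  qed (use K in \<open>auto simp: V_def indicator_def\<close>)

  have drift_eq: "mean_field_drift b q (X q w) (distr M borel (X q)) = V q w"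
    if q: "0 < q" "q \<notin> Nb" and w: "w \<notin> N0" for q w
  proof -
    note [measurable] = XM[OF less_imp_le[OF q(1)]] X'_meas[of q]
    have [measurable]: "b q \<in> borel_measurable borel"
      by (rule borel_measurable_continuous_onI[OF Cb1_continuous[OF assms(2)[OF q(1)]]])
    have "mean_field_drift b q (X q w) (distr M borel (X q)) = (\<integral>w'. b q (X q w - X q w') \<partial>M)"
      unfolding mean_field_drift_def by (subst integral_distr) auto
    also have "\<dots> = (\<integral>w'. b q (X q w - X' q w') \<partial>M)"
      by (rule integral_cong_AE) (use X'_AE[of q] q in auto)
    also have "\<dots> = V q w"
      using good[OF q] q w by (simp add: X'_def)
    finally show ?thesis .
  qed

  interpret mean_field_brownian M X' W V K b
  proof
    show "W t \<in> borel_measurable M" if "0 \<le> t" for t by (rule WM[OF that])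
    show "distr M borel (\<lambda>w. W t w - W s w) = gauss (t - s)" if "0 \<le> s" "s < t" for s t
    proof -
      have "distributed M lborel (\<lambda>w. W t w - W s w)
          (\<lambda>x. ennreal (\<Prod>i\<in>UNIV. normal_density 0 (sqrt (t - s)) (x $ i)))"
        using assms(7) that by (simp add: brownian_motion_def)
      then have "distr M lborel (\<lambda>w. W t w - W s w) = gauss (t - s)"
        by (simp add: distributed_def gauss_def gauss_density_def)
      moreover have "distr M lborel (\<lambda>w. W t w - W s w) = distr M borel (\<lambda>w. W t w - W s w)"
        by (rule distr_cong) auto
      ultimately show ?thesis by simp
    qed
    show "indep_var borel (X' s) borel (\<lambda>w. W t w - W s w)" if st: "0 \<le> s" "s < t" for s t
    proof -
      have t: "0 \<le> t" using st by simp
      note [measurable] = XM[OF st(1)] WM[OF st(1)] WM[OF t] X'_meas[of s]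
      let ?Z = "\<lambda>w. W t w - W s w"
      have Z: "?Z \<in> borel_measurable M" by measurable
      have "indep_var borel (X s) borel ?Z"
        by (rule indep_var_of_filtration[OF F XF[OF st(1)] Z]) (use assms(7) st in \<open>simp add: brownian_motion_def\<close>)
      moreover have "distr M borel (X s) = distr M borel (X' s)"
        by (rule distr_cong_AE) (use X'_AE[OF st(1)] in auto)
      moreover have "distr M (borel \<Otimes>\<^sub>M borel) (\<lambda>w. (X s w, ?Z w)) = distr M (borel \<Otimes>\<^sub>M borel) (\<lambda>w. (X' s w, ?Z w))"
        by (rule distr_cong_AE) (use X'_AE[OF st(1)] in auto)
      \<comment> \<open>Independence depends only on the joint and marginal laws, and these are
        unchanged when \<open>X s\<close> is altered on a null set.\<close>
      ultimately show ?thesis by (simp add: indep_var_distribution_eq)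
    qed
    show "AE w in M. \<forall>t\<ge>0. X' t w = X' 0 w + (\<integral>q. indicator {0..t} q *\<^sub>R V q w \<partial>lborel) + W t w"
    proof -
      have "AE w in M. \<forall>t\<ge>0.
        set_integrable lborel {0..t} (\<lambda>s. mean_field_drift b s (X s w) (distr M borel (X s))) \<and>
        X t w = X 0 w + (LINT s:{0..t}|lborel. mean_field_drift b s (X s w) (distr M borel (X s))) + W t w"
        using assms(9) by (simp add: McKean_Vlasov_solution_def)
      then show ?thesis
        using AE_not_in[OF N0(1)] AE_space
      proof eventually_elim
        case (elim w)
        show ?case
        proof (intro allI impI)
          fix t :: real assume t: "0 \<le> t"
          let ?m = "\<lambda>s. mean_field_drift b s (X s w) (distr M borel (X s))"
          have m: "set_integrable lborel {0..t} ?m"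
            and Xt: "X t w = X 0 w + (LINT s:{0..t}|lborel. ?m s) + W t w"
            using elim(1) t by blast+
          have eq: "(LINT s:{0..t}|lborel. ?m s) = (\<integral>q. indicator {0..t} q *\<^sub>R V q w \<partial>lborel)"
            unfolding set_lebesgue_integral_def
          proof (rule integral_cong_AE)
            show "(\<lambda>s. indicator {0..t} s *\<^sub>R ?m s) \<in> borel_measurable lborel"
              using m unfolding set_integrable_def by (rule borel_measurable_integrable)
            have "(\<lambda>q. V q w) \<in> borel_measurable borel"
              using measurable_compose[OF measurable_Pair2' V2, of w] elim(3) by simp
            then show "(\<lambda>q. indicator {0..t} q *\<^sub>R V q w) \<in> borel_measurable lborel" by measurable
            \<comment> \<open>The identity \<open>drift_eq\<close> is available off
              \<open>Nb\<close> and at positive times, hence the two discarded null sets.\<close>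
            show "AE q in lborel. indicator {0..t} q *\<^sub>R ?m q = indicator {0..t} q *\<^sub>R V q w"
              using AE_not_in[OF Nb] AE_lborel_singleton[of 0]
              by eventually_elim (use drift_eq elim(2) in \<open>auto simp: indicator_def\<close>)
          qed
          have "X' t w = X t w" "X' 0 w = X 0 w"
            using elim(2) t by (simp_all add: X'_def)
          then show "X' t w = X' 0 w + (\<integral>q. indicator {0..t} q *\<^sub>R V q w \<partial>lborel) + W t w"
            using Xt unfolding eq by simp
        qed
      qed
    qed
    show "AE q in lborel. 0 \<le> q \<longrightarrow> continuous_on UNIV (b q) \<and> (\<forall>x. norm (b q x) \<le> K) \<and>
        (\<forall>w\<in>space M. V q w = (\<integral>w'. b q (X' q w - X' q w') \<partial>M))"
      using AE_not_in[OF Nb] AE_lborel_singleton[of 0]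
    proof eventually_elim
      case (elim q)
      then show ?case
        using Cb1_continuous[OF assms(2), of q] b_bound[of q] good[of q] by auto
    qed
  qed (fact X'2 V2 V_bound)+

  show ?thesis
  proof (intro allI impI)
    fix t :: real assume t: "0 < t"
    then obtain p where p: "\<forall>x. 0 \<le> p x" "distributed M lborel (X' t) (\<lambda>x. ennreal (p x))" "smooth p"
      using smooth_density by blast
    have "distr M lborel (X t) = distr M lborel (X' t)"
      by (rule distr_cong_AE) (use X'_AE[of t] XM[of t] X'_meas[of t] t in auto)
    then have "distributed M lborel (X t) (\<lambda>x. ennreal (p x))"
      using p(2) XM[of t] t by (simp add: distributed_def)
    with p show "\<exists>p. (\<forall>x. 0 \<le> p x) \<and> distributed M lborel (X t) (\<lambda>x. ennreal (p x)) \<and> smooth p"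
      by blast
  qed
qed

end
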